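(* Let $\mathcal{M}$ be any decidable expansion of $\langle \mathbb{R},+,<,1\rangle$ such that every nonempty $\mathcal{M}$-definable relation contains a point with rational components. Then it is decidable whether an $\mathcal{M}$-definable relation $X\subseteq\mathbb{R}^n$ is $\langle \mathbb{R},+,<,1\rangle$-definable.
   Context: Definable means first-order definable without parameters: for a structure $\mathcal{M}$ with domain $D$, a relation $Y\subseteq D^m$ ($m\geq 1$) is $\mathcal{M}$-definable if there is a first-order formula (with equality) in the signature of $\mathcal{M}$, without parameters, defining $Y$ in $\mathcal{M}$. A structure is decidable if its first-order theory (the set of sentences of its signature true in it) is decidable. In the decision problem the input is an $\mathcal{M}$-formula defining the relation $X$. *)

theory Defs
  imports Complex_Main "HOL-Library.Nat_Bijection"
begin

text \<open>Function and relation symbols, as well as variables, are named by natural numbers;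
  constants are function symbols of arity 0. Variables are named, not de Bruijn indices.\<close>

datatype tm = Var nat | Fun nat "tm list"

datatype fm = Eq tm tm | Rel nat "tm list" | Neg fm | Conj fm fm | Exi nat fm

text \<open>A structure whose domain is the whole type \<^typ>\<open>'a\<close>. The arity maps form the signature:
  a name mapped to \<^const>\<open>None\<close> is not a symbol of it. Interpretations matter only for symbols of
  the signature and for argument lists of the right length.\<close>

record 'a struct =
  fun_ar :: "nat \<Rightarrow> nat option"
  rel_ar :: "nat \<Rightarrow> nat option"
  fun_int :: "nat \<Rightarrow> 'a list \<Rightarrow> 'a"
  rel_int :: "nat \<Rightarrow> 'a list \<Rightarrow> bool"

fun wf_tm :: "'a struct \<Rightarrow> tm \<Rightarrow> bool" where
  "wf_tm M (Var i) \<longleftrightarrow> True"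
| "wf_tm M (Fun f ts) \<longleftrightarrow> fun_ar M f = Some (length ts) \<and> (\<forall>t\<in>set ts. wf_tm M t)"

fun wf_fm :: "'a struct \<Rightarrow> fm \<Rightarrow> bool" where
  "wf_fm M (Eq s t) \<longleftrightarrow> wf_tm M s \<and> wf_tm M t"
| "wf_fm M (Rel r ts) \<longleftrightarrow> rel_ar M r = Some (length ts) \<and> (\<forall>t\<in>set ts. wf_tm M t)"
| "wf_fm M (Neg p) \<longleftrightarrow> wf_fm M p"
| "wf_fm M (Conj p q) \<longleftrightarrow> wf_fm M p \<and> wf_fm M q"
| "wf_fm M (Exi i p) \<longleftrightarrow> wf_fm M p"

fun fv_tm :: "tm \<Rightarrow> nat set" where
  "fv_tm (Var i) = {i}"
| "fv_tm (Fun f ts) = (\<Union>t\<in>set ts. fv_tm t)"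

fun fv :: "fm \<Rightarrow> nat set" where
  "fv (Eq s t) = fv_tm s \<union> fv_tm t"
| "fv (Rel r ts) = (\<Union>t\<in>set ts. fv_tm t)"
| "fv (Neg p) = fv p"
| "fv (Conj p q) = fv p \<union> fv q"
| "fv (Exi i p) = fv p - {i}"

fun tm_val :: "'a struct \<Rightarrow> (nat \<Rightarrow> 'a) \<Rightarrow> tm \<Rightarrow> 'a" where
  "tm_val M v (Var i) = v i"
| "tm_val M v (Fun f ts) = fun_int M f (map (tm_val M v) ts)"

fun sat :: "'a struct \<Rightarrow> (nat \<Rightarrow> 'a) \<Rightarrow> fm \<Rightarrow> bool" where
  "sat M v (Eq s t) \<longleftrightarrow> tm_val M v s = tm_val M v t"
| "sat M v (Rel r ts) \<longleftrightarrow> rel_int M r (map (tm_val M v) ts)"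
| "sat M v (Neg p) \<longleftrightarrow> \<not> sat M v p"
| "sat M v (Conj p q) \<longleftrightarrow> sat M v p \<and> sat M v q"
| "sat M v (Exi i p) \<longleftrightarrow> (\<exists>a. sat M (v(i := a)) p)"

definition theory_of :: "'a struct \<Rightarrow> fm set" where
  "theory_of M = {p. wf_fm M p \<and> fv p = {} \<and> (\<forall>v. sat M v p)}"

definition expansion :: "'a struct \<Rightarrow> 'a struct \<Rightarrow> bool" where
  "expansion M N \<longleftrightarrow>
     fun_ar N \<subseteq>\<^sub>m fun_ar M \<and> rel_ar N \<subseteq>\<^sub>m rel_ar M \<and>
     (\<forall>f xs. fun_ar N f = Some (length xs) \<longrightarrow> fun_int M f xs = fun_int N f xs) \<and>
     (\<forall>r xs. rel_ar N r = Some (length xs) \<longrightarrow> rel_int M r xs = rel_int N r xs)"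

text \<open>A formula defines an \<open>n\<close>-ary relation, a set of lists of length \<open>n\<close>, when its free variables
  are among \<open>0, \<dots>, n - 1\<close>; the variable \<open>i\<close> then stands for the \<open>i\<close>-th component. Only for such
  formulas is the following set meaningful.\<close>

definition defined_rel :: "'a struct \<Rightarrow> nat \<Rightarrow> fm \<Rightarrow> 'a list set" where
  "defined_rel M n p = {xs. length xs = n \<and> sat M (\<lambda>i. xs ! i) p}"

definition formula_in :: "'a struct \<Rightarrow> nat \<Rightarrow> fm \<Rightarrow> bool" where
  "formula_in M n p \<longleftrightarrow> wf_fm M p \<and> fv p \<subseteq> {..<n}"

definition definable :: "'a struct \<Rightarrow> nat \<Rightarrow> 'a list set \<Rightarrow> bool" where
  "definable M n X \<longleftrightarrow> 1 \<le> n \<and> (\<exists>p. formula_in M n p \<and> X = defined_rel M n p)"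

text \<open>\<open>recursive n f\<close>: \<open>f\<close> is a total recursive function of \<open>n\<close> arguments. This is the smallest
  class containing the initial functions and closed under composition, primitive recursion and
  minimisation of regular functions. Values on lists of length other than \<open>n\<close> are irrelevant.\<close>

inductive recursive :: "nat \<Rightarrow> (nat list \<Rightarrow> nat) \<Rightarrow> bool" where
  zero: "recursive n (\<lambda>xs. 0)"
| succ: "recursive 1 (\<lambda>xs. Suc (xs ! 0))"
| proj: "i < n \<Longrightarrow> recursive n (\<lambda>xs. xs ! i)"
| comp: "recursive (length gs) f \<Longrightarrow> (\<forall>g\<in>set gs. recursive n g) \<Longrightarrow>
    recursive n (\<lambda>xs. f (map (\<lambda>g. g xs) gs))"
| prim: "recursive n f \<Longrightarrow> recursive (n + 2) g \<Longrightarrow>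
    recursive (n + 1) (\<lambda>xs. rec_nat (f (tl xs)) (\<lambda>k r. g (k # r # tl xs)) (hd xs))"
| mini: "recursive (n + 1) f \<Longrightarrow> (\<forall>xs. length xs = n \<longrightarrow> (\<exists>k. f (k # xs) = 0)) \<Longrightarrow>
    recursive n (\<lambda>xs. LEAST k. f (k # xs) = 0)"

definition decidable :: "nat set \<Rightarrow> bool" where
  "decidable A \<longleftrightarrow> (\<exists>f. recursive 1 f \<and> (\<forall>x. f [x] = (if x \<in> A then 1 else 0)))"

fun tm_code :: "tm \<Rightarrow> nat" where
  "tm_code (Var i) = prod_encode (0, i)"
| "tm_code (Fun f ts) = prod_encode (Suc f, list_encode (map tm_code ts))"

fun fm_code :: "fm \<Rightarrow> nat" where
  "fm_code (Eq s t) = prod_encode (0, prod_encode (tm_code s, tm_code t))"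
| "fm_code (Rel r ts) = prod_encode (1, prod_encode (r, list_encode (map tm_code ts)))"
| "fm_code (Neg p) = prod_encode (2, fm_code p)"
| "fm_code (Conj p q) = prod_encode (3, prod_encode (fm_code p, fm_code q))"
| "fm_code (Exi i p) = prod_encode (4, prod_encode (i, fm_code p))"

lemma tm_code_inject: "tm_code s = tm_code t \<longleftrightarrow> s = t"
proof (induction s arbitrary: t)
  case (Var i)
  then show ?case by (cases t) auto
next
  case (Fun f ts)
  show ?case
  proof (cases t)
    case (Fun g us)
    have "map tm_code ts = map tm_code us \<longleftrightarrow> ts = us"
      using Fun.IH by (auto simp: list_eq_iff_nth_eq)
    then show ?thesis by (simp add: Fun list_encode_eq)
  qed simp
qed

lemma fm_code_inject: "fm_code p = fm_code q \<longleftrightarrow> p = q"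
proof (induction p arbitrary: q)
  case (Rel r ts)
  have "inj tm_code"
    by (simp add: inj_def tm_code_inject)
  then show ?case by (cases q) (auto simp: inj_map_eq_map list_encode_eq)
next
  case (Eq s t)
  then show ?case by (cases q) (auto simp: tm_code_inject)
next
  case (Neg p)
  then show ?case by (cases q) auto
next
  case (Conj p1 p2)
  then show ?case by (cases q) auto
next
  case (Exi i p)
  then show ?case by (cases q) auto
qed

text \<open>The condition concerns the set of all true sentences among all natural numbers, so for an
  infinite signature it also makes the signature, with its arities, decidable.\<close>

definition decidable_struct :: "'a struct \<Rightarrow> bool" where
  "decidable_struct M \<longleftrightarrow> decidable (fm_code ` theory_of M)"

text \<open>The function symbols are \<open>0\<close> for addition and \<open>1\<close> for the constant one, and the relation
  symbol is \<open>0\<close> for the strict order.\<close>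

definition real_add :: "real struct" where
  "real_add = \<lparr>fun_ar = [0 \<mapsto> 2, 1 \<mapsto> 0], rel_ar = [0 \<mapsto> 2],
     fun_int = (\<lambda>f xs. if f = 0 then xs ! 0 + xs ! 1 else 1),
     rel_int = (\<lambda>r xs. xs ! 0 < xs ! 1)\<rparr>"

end

theory Submission
  imports Defs "HOL-Library.Function_Algebras"
begin

text \<open>
  For a point \<open>x\<close> let \<open>dirs x\<close> be the linear space of the directions along which \<open>X\<close> is locally
  invariant near \<open>x\<close>, and call \<open>x\<close> singular if this space is trivial. The set \<open>X\<close> is a finite Boolean
  combination of halfspaces as soon as only finitely many flats \<open>x + dirs x\<close> occur, since then
  \<open>X\<close> is constant along every segment that crosses none of them. Following a flat until the germ of
  \<open>X\<close> changes leads to a flat of smaller dimension, and a flat along which the germ never changes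
  meets some coordinate subspace in a singular point of the section of \<open>X\<close>. Hence all flats pass
  through finitely many points if all these sections have finitely many singular points. Finiteness of
  the set of direction spaces then follows by compactness, provided that \<open>X\<close> is near every point \<open>z\<close>
  invariant under the homothety with centre \<open>z\<close> and ratio \<open>1/2\<close>: this moves a punctured
  neighbourhood of \<open>z\<close> onto a compact shell.

  Both conditions (finitely many singular points in the coordinate sections, local invariance under
  halving) are first-order in \<open>\<langle>\<real>,+,<,1,X\<rangle>\<close>, because a subset of \<open>\<real>\<^sup>n\<close> is finite iff it is bounded and
  discrete at every point of \<open>\<real>\<^sup>n\<close>. Quantifier elimination shows that they are necessary. The
  hypothesis on rational points makes the singular points and the direction spaces rational, since
  isolated points of definable sets are rational. So definability of \<open>X\<close> is equivalent to a sentence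
  which is computable from the defining formula.
\<close>

section \<open>Vectors and echelon bases\<close>

text \<open>Besides \<open>X\<close> the sentence may use only addition, order and 1, and this
  shapes the criterion. Likewise a line of invariance is replaced by the condition
  \<open>nonsing\<close>. For arbitrary \<open>X\<close> only one implication survives:
  \<open>nonsing\<close> yields a nonzero direction, so \<open>sing\<close> contains every point
  without directions, and finiteness of \<open>sing\<close> is a safe hypothesis. The converse needs
  a conical \<open>X\<close>, and that is available for necessity: a set determined by signs of
  affine functions is conical at each of its points. Sections by all coordinate subspaces are
  required because a flat of positive dimension along which the germ never changes carries no
  singular point of \<open>X\<close> itself. Since parameters are forbidden, a point not known to be
  rational cannot be mentioned in a formula; a box with rational corners around it takes its
  place.\<close>

instantiation "fun" :: (type, real_vector) real_vector
begin
definition scaleR_fun :: "real \<Rightarrow> ('a \<Rightarrow> 'b) \<Rightarrow> 'a \<Rightarrow> 'b" where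
  "scaleR_fun c f = (\<lambda>i. c *\<^sub>R f i)"
instance
  by standard (simp_all add: scaleR_fun_def fun_eq_iff algebra_simps)
end

lemma scaleR_fun_apply [simp]: "(c *\<^sub>R f) i = c *\<^sub>R f i"
  by (simp add: scaleR_fun_def)

lemma uminus_fun_apply [simp]: "(- f) i = - f i" for f :: "'a \<Rightarrow> 'b::ab_group_add"
  by (simp add: fun_Compl_def)

lemma minus_fun_apply' [simp]: "(f - g) i = f i - g i" for f :: "'a \<Rightarrow> 'b::ab_group_add"
  by (simp add: fun_diff_def)

lemma sum_fun_apply [simp]: "(\<Sum>a\<in>A. f a) i = (\<Sum>a\<in>A. f a i)"
  for f :: "'c \<Rightarrow> 'a \<Rightarrow> 'b::comm_monoid_add"
  by (induction A rule: infinite_finite_induct) auto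

text \<open>Euclidean space of dimension \<open>n\<close> is \<open>supp_in {..<n}\<close>. Points
  of all dimensions thus share one type with valuations, and a point can be handed to
  \<open>sat\<close> directly.\<close>

definition supp_in :: "nat set \<Rightarrow> (nat \<Rightarrow> real) set" where
  "supp_in J = {x. \<forall>i. i \<notin> J \<longrightarrow> x i = 0}"

text \<open>The maximum norm is used because its balls can be written with addition and order
  alone.\<close>

definition near :: "nat \<Rightarrow> (nat \<Rightarrow> real) \<Rightarrow> (nat \<Rightarrow> real) \<Rightarrow> real \<Rightarrow> bool" where
  "near n x y r \<longleftrightarrow> (\<forall>i<n. \<bar>x i - y i\<bar> < r)"

lemma subspace_supp_in: "subspace (supp_in J)"
  by (auto simp: supp_in_def subspace_def)

lemmas supp_in_add = subspace_add[OF subspace_supp_in]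
  and supp_in_diff = subspace_diff[OF subspace_supp_in]
  and supp_in_scale = subspace_scale[OF subspace_supp_in]
  and supp_in_zero = subspace_0[OF subspace_supp_in]

lemma supp_in_mono: "I \<subseteq> J \<Longrightarrow> supp_in I \<subseteq> supp_in J"
  by (auto simp: supp_in_def)

lemma near_refl: "0 < r \<Longrightarrow> near n x x r"
  by (auto simp: near_def)

lemma near_mono: "near n x y r \<Longrightarrow> r \<le> s \<Longrightarrow> near n x y s"
  by (force simp: near_def)

lemma near_trans: "near n x y r \<Longrightarrow> near n y z s \<Longrightarrow> near n x z (r + s)"
  by (fastforce simp: near_def)

lemma near_trans': "near n x y r \<Longrightarrow> near n y z s \<Longrightarrow> r + s \<le> t \<Longrightarrow> near n x z t"
  using near_trans near_mono by blast

lemma near_cancel [simp]: "near n (a + x) (a + y) r \<longleftrightarrow> near n x y r"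
  "near n (x + a) (y + a) r \<longleftrightarrow> near n x y r"
  by (auto simp: near_def)

lemma near_add_left [simp]: "near n (x + u) x r \<longleftrightarrow> near n u 0 r"
  by (auto simp: near_def)

definition absum :: "nat \<Rightarrow> (nat \<Rightarrow> real) \<Rightarrow> real" where
  "absum n v = (\<Sum>i<n. \<bar>v i\<bar>)"

lemma absum_nonneg: "0 \<le> absum n v"
  by (auto simp: absum_def intro: sum_nonneg)

lemma abs_le_absum: "i < n \<Longrightarrow> \<bar>v i\<bar> \<le> absum n v"
  unfolding absum_def by (rule member_le_sum) auto

lemma near_scale: "\<bar>t\<bar> * absum n v < r \<Longrightarrow> near n (t *\<^sub>R v) 0 r"
proof -
  assume a: "\<bar>t\<bar> * absum n v < r"
  have "\<bar>t\<bar> * \<bar>v i\<bar> < r" if "i < n" for i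
    using mult_left_mono[OF abs_le_absum[OF that, of v], of "\<bar>t\<bar>"] a by simp
  then show ?thesis by (simp add: near_def abs_mult)
qed

lemma near_scale_ex:
  assumes "0 < r" shows "\<exists>d>0. \<forall>t. \<bar>t\<bar> < d \<longrightarrow> near n (t *\<^sub>R v) 0 r"
proof (intro exI conjI allI impI)
  let ?d = "r / (1 + absum n v)"
  have p: "0 < 1 + absum n v" using absum_nonneg[of n v] by linarith
  show "0 < ?d" using assms p by simp
  fix t assume t: "\<bar>t\<bar> < ?d"
  have "\<bar>t\<bar> * absum n v \<le> \<bar>t\<bar> * (1 + absum n v)" by (simp add: mult_left_mono)
  also have "\<dots> < r" using t p by (simp add: pos_less_divide_eq)
  finally show "near n (t *\<^sub>R v) 0 r" by (rule near_scale)
qed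

lemma near_scaleI: "near n x y r \<Longrightarrow> 0 < c \<Longrightarrow> near n (c *\<^sub>R x) (c *\<^sub>R y) (c * r)"
  by (auto simp: near_def right_diff_distrib[symmetric] abs_mult)

lemma near_sums: 
  assumes "near n u 0 r" "near n v 0 s" shows "near n (u + v) 0 (r + s)"
proof -
  have "near n (u + v) u s" using assms(2) by simp
  from near_trans[OF this assms(1)] show ?thesis by (simp add: add.commute)
qed

lemma near_convex:
  assumes "near n y x r" "near n (y + v) x r" "0 \<le> t" "t \<le> 1"
  shows "near n (y + t *\<^sub>R v) x r"
  unfolding near_def
proof (intro allI impI)
  fix i assume i: "i < n"
  have "\<bar>y i - x i\<bar> < r" "\<bar>y i + v i - x i\<bar> < r" using assms i by (auto simp: near_def)
  then have a: "- r < y i - x i" "y i - x i < r" "- r < y i + v i - x i" "y i + v i - x i < r" by auto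
  have e: "(y + t *\<^sub>R v) i - x i = (1 - t) * (y i - x i) + t * (y i + v i - x i)"
    by (simp add: algebra_simps)
  have "(1 - t) * (y i - x i) + t * (y i + v i - x i) < r"
    by (rule convex_bound_lt) (use a assms in auto)
  moreover have "(1 - t) * (- (y i - x i)) + t * (- (y i + v i - x i)) < r"
    by (rule convex_bound_lt) (use a assms in auto)
  then have "- ((1 - t) * (y i - x i) + t * (y i + v i - x i)) < r"
    by (simp only: mult_minus_right minus_add_distrib)
  ultimately show "\<bar>(y + t *\<^sub>R v) i - x i\<bar> < r"
    unfolding e abs_less_iff by blast
qed

lemma finite_radius:
  assumes "finite A" "\<And>a. a \<in> A \<Longrightarrow> \<exists>e>(0::real). Q a e" "\<And>a e e'. Q a e \<Longrightarrow> e' \<le> e \<Longrightarrow> Q a e'"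
  shows "\<exists>e>0. \<forall>a\<in>A. Q a e"
  using assms(1,2)
proof (induction A)
  case empty
  show ?case by (intro exI[of _ 1]) simp
next
  case (insert a A)
  then obtain e e' where "e > 0" "e' > 0" "Q a e" "\<forall>b\<in>A. Q b e'" by (metis insertCI)
  then show ?case using assms(3)
    by (intro exI[of _ "min e e'"]) (metis insertE min.cobounded1 min.cobounded2 min_less_iff_conj)
qed

lemma near_combination:
  assumes "I \<subseteq> {..<n}" "0 < e"
  shows "\<exists>d>0. \<forall>u. near n u 0 d \<longrightarrow> near n (\<Sum>i\<in>I. u i *\<^sub>R w i) 0 e"
proof -
  define b where "b = 1 + (\<Sum>i\<in>I. absum n (w i))"
  have b: "1 \<le> b" by (simp add: b_def sum_nonneg absum_nonneg)
  show ?thesis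
  proof (intro exI[of _ "e / b"] conjI allI impI)
    show eb: "0 < e / b" using assms b by simp
    fix u assume u: "near n u 0 (e / b)"
    show "near n (\<Sum>i\<in>I. u i *\<^sub>R w i) 0 e"
      unfolding near_def
    proof (intro allI impI)
      fix j assume j: "j < n"
      have "\<bar>\<Sum>i\<in>I. u i * w i j\<bar> \<le> (\<Sum>i\<in>I. \<bar>u i\<bar> * \<bar>w i j\<bar>)"
        using sum_abs[of "\<lambda>i. u i * w i j" I] by (simp add: abs_mult)
      also have "\<dots> \<le> (\<Sum>i\<in>I. e / b * absum n (w i))"
      proof (rule sum_mono)
        fix i assume i: "i \<in> I"
        have "\<bar>u i\<bar> \<le> e / b" using u i assms(1) by (force simp: near_def)
        then show "\<bar>u i\<bar> * \<bar>w i j\<bar> \<le> e / b * absum n (w i)"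
          using abs_le_absum[OF j, of "w i"] eb by (intro mult_mono) auto
      qed
      also have "\<dots> = e / b * (b - 1)" by (simp add: b_def sum_distrib_left)
      also have "\<dots> < e / b * b" using eb by (intro mult_strict_left_mono) auto
      also have "\<dots> = e" using b by simp
      finally show "\<bar>(\<Sum>i\<in>I. u i *\<^sub>R w i) j - 0 j\<bar> < e" by simp
    qed
  qed
qed

text \<open>A reduced echelon family with pivot set \<open>I\<close>. The coefficient of
  \<open>w i\<close> in a combination is the \<open>i\<close>-th coordinate of the result, so
  coefficients need not be solved for. Spanning is not demanded.\<close>

definition echelon :: "nat \<Rightarrow> (nat \<Rightarrow> real) set \<Rightarrow> nat set \<Rightarrow> (nat \<Rightarrow> nat \<Rightarrow> real) \<Rightarrow> bool" where
  "echelon n L I w \<longleftrightarrow> I \<subseteq> {..<n} \<and> (\<forall>i\<in>I. w i \<in> L \<and> (\<forall>j\<in>I. w i j = (if j = i then 1 else 0)))"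

text \<open>For a subspace of \<open>supp_in {..<n}\<close> this is the dimension, obtained as the
  largest possible number of pivots.\<close>

definition rank :: "nat \<Rightarrow> (nat \<Rightarrow> real) set \<Rightarrow> nat" where
  "rank n L = Max {card I |I. \<exists>w. echelon n L I w}"

lemma
  shows finite_echelon: "finite {card I |I. \<exists>w. echelon n L I w}"
    and echelon_rank: "\<exists>I w. echelon n L I w \<and> card I = rank n L"
    and echelon_le_rank: "echelon n L I w \<Longrightarrow> card I \<le> rank n L"
proof -
  have "{card I |I. \<exists>w. echelon n L I w} \<subseteq> card ` Pow {..<n}"
    by (auto simp: echelon_def)
  then show f: "finite {card I |I. \<exists>w. echelon n L I w}" by (rule finite_subset) simp
  have "echelon n L {} w" for w by (simp add: echelon_def)
  then have "{card I |I. \<exists>w. echelon n L I w} \<noteq> {}" by blast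
  from Max_in[OF f this] show "\<exists>I w. echelon n L I w \<and> card I = rank n L"
    by (auto simp: rank_def)
  show "echelon n L I w \<Longrightarrow> card I \<le> rank n L"
    unfolding rank_def by (rule Max_ge[OF f]) auto
qed

lemma rank_le: "rank n L \<le> n"
proof -
  obtain I w where "echelon n L I w" "card I = rank n L" using echelon_rank by blast
  then show ?thesis using card_mono[of "{..<n}" I] by (auto simp: echelon_def)
qed

lemma echelon_reduce:
  assumes "subspace L" "echelon n L I w" "u \<in> L"
  shows "u - (\<Sum>i\<in>I. u i *\<^sub>R w i) \<in> L" "\<forall>j\<in>I. (u - (\<Sum>i\<in>I. u i *\<^sub>R w i)) j = 0"
proof -
  show "u - (\<Sum>i\<in>I. u i *\<^sub>R w i) \<in> L"
    using assms by (intro subspace_diff subspace_sum subspace_scale) (auto simp: echelon_def)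
  have f: "finite I" using assms(2) finite_subset by (auto simp: echelon_def)
  have "(\<Sum>i\<in>I. u i * w i j) = u j" if "j \<in> I" for j
  proof -
    have "(\<Sum>i\<in>I. u i * w i j) = (\<Sum>i\<in>I. if j = i then u i else 0)"
      using assms(2) that by (intro sum.cong) (auto simp: echelon_def)
    then show ?thesis using f that by simp
  qed
  then show "\<forall>j\<in>I. (u - (\<Sum>i\<in>I. u i *\<^sub>R w i)) j = 0" by simp
qed

text \<open>One Gauss-Jordan step: normalise \<open>u\<close> at the new pivot \<open>k\<close> and
  clear column \<open>k\<close> in the old vectors.\<close>

lemma echelon_extend:
  assumes "subspace L" "echelon n L I w" "u \<in> L" "\<forall>i\<in>I. u i = 0" "k < n" "u k \<noteq> 0"
  shows "\<exists>w'. echelon n L (insert k I) w'"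
proof -
  define e where "e = (1 / u k) *\<^sub>R u"
  define w' where "w' = (\<lambda>i. if i = k then e else w i - w i k *\<^sub>R e)"
  have k: "k \<notin> I" using assms by auto
  have e: "e \<in> L" "e k = 1" "\<forall>i\<in>I. e i = 0"
    using assms by (auto simp: e_def intro: subspace_scale)
  have "echelon n L (insert k I) w'"
    unfolding echelon_def
  proof (intro conjI ballI)
    show "insert k I \<subseteq> {..<n}" using assms by (auto simp: echelon_def)
    fix i assume i: "i \<in> insert k I"
    show "w' i \<in> L" using i e assms(1,2)
      by (auto simp: w'_def echelon_def intro!: subspace_diff subspace_scale)
    fix j assume j: "j \<in> insert k I"
    show "w' i j = (if j = i then 1 else 0)"
      using i j e k assms(2) by (auto simp: w'_def echelon_def)
  qed
  then show ?thesis by blast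
qed

text \<open>A nonzero vector vanishing at all pivots would supply a further pivot, against
  maximality. Hence a maximal echelon family spans.\<close>

lemma echelon_full:
  assumes "subspace L" "L \<subseteq> supp_in {..<n}" "echelon n L I w" "card I = rank n L" "u \<in> L" "\<forall>i\<in>I. u i = 0"
  shows "u = 0"
proof (rule ccontr)
  assume "u \<noteq> 0"
  then obtain k where k: "u k \<noteq> 0" by (auto simp: fun_eq_iff)
  then have "k < n" using assms by (auto simp: supp_in_def)
  then obtain w' where "echelon n L (insert k I) w'" using echelon_extend assms k by blast
  from echelon_le_rank[OF this] have "card (insert k I) \<le> card I" using assms by simp
  moreover have "finite I" using assms(3) finite_subset by (auto simp: echelon_def)
  moreover have "k \<notin> I" using k assms by auto
  ultimately show False by simp
qed

definition basis_of :: "nat \<Rightarrow> (nat \<Rightarrow> real) set \<Rightarrow> nat set \<Rightarrow> (nat \<Rightarrow> nat \<Rightarrow> real) \<Rightarrow> bool" where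
  "basis_of n L I w \<longleftrightarrow> echelon n L I w \<and> (\<forall>u\<in>L. u = (\<Sum>i\<in>I. u i *\<^sub>R w i))"

lemma basis_exists:
  assumes "subspace L" "L \<subseteq> supp_in {..<n}"
  shows "\<exists>I w. basis_of n L I w"
proof -
  obtain I w where w: "echelon n L I w" "card I = rank n L" using echelon_rank by blast
  have "u = (\<Sum>i\<in>I. u i *\<^sub>R w i)" if "u \<in> L" for u
    using echelon_full[OF assms w echelon_reduce[OF assms(1) w(1) that]]
    by (rule eq_iff_diff_eq_0[THEN iffD2])
  then show ?thesis using w by (auto simp: basis_of_def)
qed

lemma basis_finite: "basis_of n L I w \<Longrightarrow> finite I"
  using finite_subset by (auto simp: echelon_def basis_of_def)

text \<open>Turns membership in \<open>L\<close> into linear equations whose coefficients are the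
  entries of the echelon basis. This is the form in which closedness is proved and in which flats
  are later written as formulas.\<close>

lemma basis_mem_iff:
  assumes "subspace L" "L \<subseteq> supp_in {..<n}" "basis_of n L I w" "u \<in> supp_in {..<n}"
  shows "u \<in> L \<longleftrightarrow> (\<forall>j<n. u j = (\<Sum>i\<in>I. u i * w i j))"
proof
  assume "u \<in> L"
  then have "u = (\<Sum>i\<in>I. u i *\<^sub>R w i)" using assms by (auto simp: basis_of_def)
  then have "u j = (\<Sum>i\<in>I. u i *\<^sub>R w i) j" for j by (rule fun_cong)
  then show "\<forall>j<n. u j = (\<Sum>i\<in>I. u i * w i j)"
    unfolding sum_fun_apply scaleR_fun_apply real_scaleR_def by blast
next
  assume a: "\<forall>j<n. u j = (\<Sum>i\<in>I. u i * w i j)"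
  let ?s = "\<Sum>i\<in>I. u i *\<^sub>R w i"
  have s: "?s \<in> L" using assms(1,3) by (intro subspace_sum subspace_scale) (auto simp: basis_of_def echelon_def)
  have "u j = ?s j" for j
  proof (cases "j < n")
    case True
    from a[rule_format, OF this] show ?thesis
      unfolding sum_fun_apply scaleR_fun_apply real_scaleR_def .
  next
    case False
    moreover have "?s \<in> supp_in {..<n}" using s assms(2) by blast
    ultimately have "?s j = 0" "u j = 0" using assms(4) by (simp_all add: supp_in_def del: sum_fun_apply)
    then show ?thesis by metis
  qed
  then have "u = ?s" by (rule ext)
  then show "u \<in> L" using s by metis
qed

text \<open>Reducing a vector of \<open>L'\<close> outside \<open>L\<close> by a maximal family of
  \<open>L\<close> leaves a nonzero remainder, which provides one more pivot.\<close>

lemma rank_strict: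
  assumes "subspace L" "subspace L'" "L' \<subseteq> supp_in {..<n}" "L \<subset> L'"
  shows "rank n L < rank n L'"
proof -
  obtain I w where w: "echelon n L I w" "card I = rank n L" using echelon_rank by blast
  then have w': "echelon n L' I w" using assms(4) by (auto simp: echelon_def)
  obtain u where u: "u \<in> L'" "u \<notin> L" using assms(4) by auto
  let ?s = "\<Sum>i\<in>I. u i *\<^sub>R w i"
  have "?s \<in> L" using assms(1) w by (intro subspace_sum subspace_scale) (auto simp: echelon_def)
  then have "u - ?s \<noteq> 0" using u by auto
  then obtain k where k: "(u - ?s) k \<noteq> 0" by (auto simp: fun_eq_iff)
  note r = echelon_reduce[OF assms(2) w' u(1)]
  have "u - ?s \<in> supp_in {..<n}" using r(1) assms(3) by blast
  then have "k < n" using k unfolding supp_in_def by blast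
  then obtain w2 where "echelon n L' (insert k I) w2" using echelon_extend[OF assms(2) w' r] k by blast
  from echelon_le_rank[OF this] have "card (insert k I) \<le> rank n L'" .
  moreover have "finite I" using w finite_subset by (auto simp: echelon_def)
  moreover have "k \<notin> I" using r k by auto
  ultimately show ?thesis using w by simp
qed

text \<open>Some equation of \<open>L\<close> fails at \<open>z\<close> with an error
  \<open>c\<close>. That error changes by less than \<open>b\<close> times the distance, so within
  distance \<open>c / b\<close> the equation still fails.\<close>

lemma subspace_complement_open:
  assumes "subspace L" "L \<subseteq> supp_in {..<n}" "z \<in> supp_in {..<n}" "z \<notin> L"
  shows "\<exists>e>0. \<forall>y\<in>L. \<not> near n y z e"
proof -
  obtain I w where w: "basis_of n L I w" using basis_exists[OF assms(1,2)] by blast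
  have f: "finite I" "I \<subseteq> {..<n}" using basis_finite[OF w] w by (auto simp: basis_of_def echelon_def)
  obtain j where j: "j < n" "z j \<noteq> (\<Sum>i\<in>I. z i * w i j)"
    using basis_mem_iff[OF assms(1,2) w assms(3)] assms(4) by blast
  define c where "c = \<bar>z j - (\<Sum>i\<in>I. z i * w i j)\<bar>"
  define b where "b = 1 + (\<Sum>i\<in>I. \<bar>w i j\<bar>)"
  have b: "0 < b" unfolding b_def by (simp add: add_pos_nonneg sum_nonneg)
  have c: "0 < c" using j by (simp add: c_def)
  show ?thesis
  proof (intro exI conjI ballI notI)
    show "0 < c / b" using b c by simp
    fix y assume y: "y \<in> L" "near n y z (c / b)"
    then have yj: "y j = (\<Sum>i\<in>I. y i * w i j)"
      using basis_mem_iff[OF assms(1,2) w] assms(2) j by blast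
    have "z j - (\<Sum>i\<in>I. z i * w i j) = (z j - y j) + (\<Sum>i\<in>I. (y i - z i) * w i j)"
      using yj by (simp add: left_diff_distrib sum_subtractf)
    then have "c \<le> \<bar>z j - y j\<bar> + \<bar>\<Sum>i\<in>I. (y i - z i) * w i j\<bar>"
      unfolding c_def by linarith
    also have "\<dots> \<le> \<bar>z j - y j\<bar> + (\<Sum>i\<in>I. \<bar>y i - z i\<bar> * \<bar>w i j\<bar>)"
      using sum_abs[of "\<lambda>i. (y i - z i) * w i j" I] by (simp add: abs_mult)
    also have "(\<Sum>i\<in>I. \<bar>y i - z i\<bar> * \<bar>w i j\<bar>) \<le> (\<Sum>i\<in>I. c / b * \<bar>w i j\<bar>)"
      using y(2) f by (intro sum_mono mult_right_mono) (force simp: near_def)+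
    also have "\<bar>z j - y j\<bar> + (\<Sum>i\<in>I. c / b * \<bar>w i j\<bar>) < c / b + (\<Sum>i\<in>I. c / b * \<bar>w i j\<bar>)"
      using y(2) j by (auto simp: near_def abs_minus_commute)
    also have "\<dots> = c / b * b" by (simp add: b_def sum_distrib_left distrib_left)
    also have "\<dots> = c" using b by simp
    finally show False by simp
  qed
qed

section \<open>Sequential compactness of boxes and connectedness of segments\<close>

lemma convergent_subseq_coord:
  fixes f :: "nat \<Rightarrow> nat \<Rightarrow> real"
  assumes "\<forall>k. \<forall>i<n. \<bar>f k i\<bar> \<le> B"
  shows "\<exists>s l. strict_mono s \<and> (\<forall>i<n. (\<lambda>k. f (s k) i) \<longlonglongrightarrow> l i)"
  using assms
proof (induction n)
  case 0
  have "strict_mono (id :: nat \<Rightarrow> nat)" by (simp add: strict_mono_def)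
  then show ?case by blast
next
  case (Suc n)
  then obtain s l where s: "strict_mono (s::nat\<Rightarrow>nat)" "\<forall>i<n. (\<lambda>k. f (s k) i) \<longlonglongrightarrow> l i" by auto
  obtain t :: "nat \<Rightarrow> nat" where t: "strict_mono t" "monoseq (\<lambda>k. f (s (t k)) n)"
    using seq_monosub[of "\<lambda>k. f (s k) n"] by auto
  have "Bseq (\<lambda>k. f (s (t k)) n)" using Suc.prems by (intro BseqI'[of _ B]) auto
  then obtain a where a: "(\<lambda>k. f (s (t k)) n) \<longlonglongrightarrow> a"
    using Bseq_monoseq_convergent t by (auto simp: convergent_def)
  have "(\<lambda>k. f (s (t k)) i) \<longlonglongrightarrow> l i" if "i < n" for i
    using LIMSEQ_subseq_LIMSEQ[OF s(2)[rule_format, OF that] t(1)] by (simp add: o_def)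
  then have "\<forall>i<Suc n. (\<lambda>k. f ((s \<circ> t) k) i) \<longlonglongrightarrow> (l(n := a)) i"
    using a by (auto simp: less_Suc_eq)
  then show ?case using strict_mono_o[OF s(1) t(1)] by blast
qed

lemma near_eventually:
  assumes "\<forall>i<n. (\<lambda>k. f k i) \<longlonglongrightarrow> l i" "0 < e"
  shows "\<forall>\<^sub>F k in sequentially. near n (f k) l e"
proof -
  have "\<forall>i\<in>{..<n}. \<forall>\<^sub>F k in sequentially. \<bar>f k i - l i\<bar> < e"
    using assms by (auto simp: tendsto_iff dist_real_def)
  then have "\<forall>\<^sub>F k in sequentially. \<forall>i\<in>{..<n}. \<bar>f k i - l i\<bar> < e"
    by (intro eventually_ball_finite) auto
  then show ?thesis by (simp add: near_def Ball_def)
qed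

lemma locally_const_segment:
  fixes P :: "real \<Rightarrow> bool"
  assumes "\<And>t. 0 \<le> t \<Longrightarrow> t \<le> 1 \<Longrightarrow> \<exists>d>0. \<forall>s. 0 \<le> s \<and> s \<le> 1 \<and> \<bar>s - t\<bar> < d \<longrightarrow> P s = P t"
  shows "P 0 = P 1"
proof -
  have "0 \<le> (0::real) \<longrightarrow> (1::real) \<le> 1 \<longrightarrow> P 0 = P 1"
  proof (rule Bolzano[where P = "\<lambda>a b. 0 \<le> a \<longrightarrow> b \<le> 1 \<longrightarrow> P a = P b"])
    fix x :: real assume "0 \<le> x" "x \<le> 1"
    then obtain d where d: "d > 0" "\<forall>s. 0 \<le> s \<and> s \<le> 1 \<and> \<bar>s - x\<bar> < d \<longrightarrow> P s = P x" using assms by blast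
    show "\<exists>d>0. \<forall>a b. a \<le> x \<and> x \<le> b \<and> b - a < d \<longrightarrow> 0 \<le> a \<longrightarrow> b \<le> 1 \<longrightarrow> P a = P b"
    proof (intro exI[of _ d] conjI d allI impI)
      fix a b assume "a \<le> x \<and> x \<le> b \<and> b - a < d" "0 \<le> a" "b \<le> 1"
      then have "P a = P x" "P b = P x"
        by (intro d(2)[rule_format]; simp)+
      then show "P a = P b" by simp
    qed
  qed auto
  then show ?thesis by simp
qed

section \<open>Directions of local invariance\<close>

locale relation =
  fixes n :: nat and X :: "(nat \<Rightarrow> real) \<Rightarrow> bool"
begin

abbreviation points :: "(nat \<Rightarrow> real) set" where
  "points \<equiv> supp_in {..<n}"

text \<open>The set \<open>J\<close> selects a coordinate subspace, and \<open>X\<close> is examined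
  only inside it; \<open>J = {..<n}\<close> gives the directions of \<open>X\<close> itself. One
  radius bounds both the base point and the multiple of \<open>v\<close>.\<close>

definition inv_space :: "nat set \<Rightarrow> (nat \<Rightarrow> real) \<Rightarrow> (nat \<Rightarrow> real) set" where
  "inv_space J x = {v \<in> supp_in J. \<exists>r>0. \<forall>y\<in>supp_in J. near n y x r \<longrightarrow>
     (\<forall>t. \<bar>t\<bar> < r \<longrightarrow> X y = X (y + t *\<^sub>R v))}"

abbreviation dirs :: "(nat \<Rightarrow> real) \<Rightarrow> (nat \<Rightarrow> real) set" where
  "dirs \<equiv> inv_space {..<n}"

lemma inv_spaceI:
  assumes "v \<in> supp_in J" "0 < r"
    "\<And>y t. y \<in> supp_in J \<Longrightarrow> near n y x r \<Longrightarrow> \<bar>t\<bar> < r \<Longrightarrow> X y = X (y + t *\<^sub>R v)"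
  shows "v \<in> inv_space J x"
  using assms unfolding inv_space_def by blast

lemma inv_spaceE:
  assumes "v \<in> inv_space J x"
  shows "\<exists>r>0. \<forall>y t. y \<in> supp_in J \<longrightarrow> near n y x r \<longrightarrow> \<bar>t\<bar> < r \<longrightarrow> X y = X (y + t *\<^sub>R v)"
  using assms unfolding inv_space_def by blast

lemma inv_space_supp: "inv_space J x \<subseteq> supp_in J"
  by (auto simp: inv_space_def)

text \<open>For a sum, move along \<open>v\<close> and then along \<open>w\<close>; the halved
  radius keeps the intermediate point in the ball that belongs to \<open>w\<close>.\<close>

lemma subspace_inv_space: "subspace (inv_space J x)"
  unfolding subspace_def
proof (intro conjI ballI allI)
  show "0 \<in> inv_space J x" by (rule inv_spaceI[of _ _ 1]) (simp_all add: supp_in_zero)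
next
  fix v w assume vw: "v \<in> inv_space J x" "w \<in> inv_space J x"
  note supp = vw[THEN subsetD[OF inv_space_supp]]
  obtain r where r: "0 < r" "\<And>y t. y \<in> supp_in J \<Longrightarrow> near n y x r \<Longrightarrow> \<bar>t\<bar> < r \<Longrightarrow> X y = X (y + t *\<^sub>R v)"
    using inv_spaceE[OF vw(1)] by blast
  obtain s where s: "0 < s" "\<And>y t. y \<in> supp_in J \<Longrightarrow> near n y x s \<Longrightarrow> \<bar>t\<bar> < s \<Longrightarrow> X y = X (y + t *\<^sub>R w)"
    using inv_spaceE[OF vw(2)] by blast
  obtain d where d: "0 < d" "\<And>t. \<bar>t\<bar> < d \<Longrightarrow> near n (t *\<^sub>R v) 0 (s / 2)"
    using near_scale_ex[of "s/2" n v] s(1) by auto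
  show "v + w \<in> inv_space J x"
  proof (rule inv_spaceI)
    show "v + w \<in> supp_in J" using supp by (rule supp_in_add)
    show "0 < min (min r (s/2)) d" using r s d by simp
    fix y t assume y: "y \<in> supp_in J" "near n y x (min (min r (s/2)) d)" "\<bar>t\<bar> < min (min r (s/2)) d"
    have "X y = X (y + t *\<^sub>R v)"
      by (rule r(2)) (use y in \<open>auto elim: near_mono\<close>)
    also have "\<dots> = X ((y + t *\<^sub>R v) + t *\<^sub>R w)"
    proof (rule s(2))
      show "y + t *\<^sub>R v \<in> supp_in J" using y supp by (intro supp_in_add supp_in_scale)
      have "near n (y + t *\<^sub>R v) y (s/2)" using d(2)[of t] y by simp
      moreover have "near n y x (s/2)" by (rule near_mono[OF y(2)]) simp
      ultimately show "near n (y + t *\<^sub>R v) x s" by (rule near_trans') simp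
    qed (use y s in auto)
    finally show "X y = X (y + t *\<^sub>R (v + w))" by (simp add: scaleR_add_right add.assoc)
  qed
next
  fix c :: real and v assume v: "v \<in> inv_space J x"
  obtain r where r: "0 < r" "\<And>y t. y \<in> supp_in J \<Longrightarrow> near n y x r \<Longrightarrow> \<bar>t\<bar> < r \<Longrightarrow> X y = X (y + t *\<^sub>R v)"
    using inv_spaceE[OF v] by blast
  have c: "0 < 1 + \<bar>c\<bar>" by (simp add: add_pos_nonneg)
  show "c *\<^sub>R v \<in> inv_space J x"
  proof (rule inv_spaceI)
    show "c *\<^sub>R v \<in> supp_in J" using v inv_space_supp by (blast intro: supp_in_scale)
    show "0 < r / (1 + \<bar>c\<bar>)" using r c by simp
    fix y t assume y: "y \<in> supp_in J" "near n y x (r / (1 + \<bar>c\<bar>))" "\<bar>t\<bar> < r / (1 + \<bar>c\<bar>)"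
    have le: "r / (1 + \<bar>c\<bar>) \<le> r" using r c by (simp add: field_simps)
    have "\<bar>t\<bar> * \<bar>c\<bar> \<le> \<bar>t\<bar> * (1 + \<bar>c\<bar>)" by (simp add: mult_left_mono)
    also have "\<dots> < r" using y(3) c by (simp add: pos_less_divide_eq)
    finally have "\<bar>t * c\<bar> < r" by (simp add: abs_mult)
    then show "X y = X (y + t *\<^sub>R (c *\<^sub>R v))"
      using r(2)[of y "t * c"] y le near_mono by auto
  qed
qed

text \<open>Each direction comes with a radius of its own. One radius for all small vectors of the
  space is obtained by moving along the finitely many basis vectors in turn; the coefficients are
  pivot coordinates, hence small together with the vector.\<close>

lemma uniform_radius:
  assumes J: "J \<subseteq> {..<n}"
  shows "\<exists>r>0. \<forall>y\<in>supp_in J. near n y x r \<longrightarrow> (\<forall>v\<in>inv_space J x. near n v 0 r \<longrightarrow> X y = X (y + v))"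
proof -
  have L: "inv_space J x \<subseteq> points" using inv_space_supp supp_in_mono[OF J] by blast
  obtain I w where w: "basis_of n (inv_space J x) I w"
    using basis_exists[OF subspace_inv_space L] by blast
  have wI: "w i \<in> inv_space J x" if "i \<in> I" for i using w that by (auto simp: basis_of_def echelon_def)
  have In: "I \<subseteq> {..<n}" using w by (auto simp: basis_of_def echelon_def)
  have *: "A \<subseteq> I \<Longrightarrow> \<exists>r>0. \<forall>y\<in>supp_in J. near n y x r \<longrightarrow>
      (\<forall>c. (\<forall>i\<in>A. \<bar>c i\<bar> < r) \<longrightarrow> X y = X (y + (\<Sum>i\<in>A. c i *\<^sub>R w i)))" if "finite A" for A
    using that
  proof (induction A)
    case empty
    then show ?case by (intro exI[of _ 1]) simp
  next
    case (insert a A)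
    then obtain s where s: "0 < s" "\<And>y c. y \<in> supp_in J \<Longrightarrow> near n y x s \<Longrightarrow>
      (\<forall>i\<in>A. \<bar>c i\<bar> < s) \<Longrightarrow> X y = X (y + (\<Sum>i\<in>A. c i *\<^sub>R w i))"
      using insert.IH insert.prems by blast
    have wa: "w a \<in> inv_space J x" using wI insert by auto
    then have was: "w a \<in> supp_in J" using inv_space_supp by blast
    obtain r where r: "0 < r" "\<And>y t. y \<in> supp_in J \<Longrightarrow> near n y x r \<Longrightarrow> \<bar>t\<bar> < r \<Longrightarrow> X y = X (y + t *\<^sub>R w a)"
      using inv_spaceE[OF wa] by blast
    obtain d where d: "0 < d" "\<And>t. \<bar>t\<bar> < d \<Longrightarrow> near n (t *\<^sub>R w a) 0 (s / 2)"
      using near_scale_ex[of "s/2" n "w a"] s(1) by auto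
    show ?case
    proof (intro exI[of _ "min (min r (s/2)) d"] conjI ballI impI allI)
      show "0 < min (min r (s/2)) d" using r s d by simp
      fix y c assume y: "y \<in> supp_in J" "near n y x (min (min r (s/2)) d)"
        and c: "\<forall>i\<in>insert a A. \<bar>c i\<bar> < min (min r (s/2)) d"
      have "X y = X (y + c a *\<^sub>R w a)"
        by (rule r(2)) (use y c in \<open>auto elim: near_mono\<close>)
      also have "\<dots> = X ((y + c a *\<^sub>R w a) + (\<Sum>i\<in>A. c i *\<^sub>R w i))"
      proof (rule s(2))
        show "y + c a *\<^sub>R w a \<in> supp_in J" using y was by (intro supp_in_add supp_in_scale)
        have "near n (y + c a *\<^sub>R w a) y (s/2)" using d(2)[of "c a"] c by simp
        moreover have "near n y x (s/2)" by (rule near_mono[OF y(2)]) simp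
        ultimately show "near n (y + c a *\<^sub>R w a) x s" by (rule near_trans') simp
        show "\<forall>i\<in>A. \<bar>c i\<bar> < s" using c s(1) by force
      qed
      finally show "X y = X (y + (\<Sum>i\<in>insert a A. c i *\<^sub>R w i))"
        using insert by (simp add: add.assoc)
    qed
  qed
  from *[OF basis_finite[OF w] order.refl] obtain r where r: "0 < r" "\<And>y c. y \<in> supp_in J \<Longrightarrow> near n y x r \<Longrightarrow>
      (\<forall>i\<in>I. \<bar>c i\<bar> < r) \<Longrightarrow> X y = X (y + (\<Sum>i\<in>I. c i *\<^sub>R w i))" by blast
  show ?thesis
  proof (intro exI[of _ r] conjI ballI impI r(1))
    fix y v assume a: "y \<in> supp_in J" "near n y x r" "v \<in> inv_space J x" "near n v 0 r"
    have "v = (\<Sum>i\<in>I. v i *\<^sub>R w i)" using w a(3) by (auto simp: basis_of_def)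
    moreover have "X y = X (y + (\<Sum>i\<in>I. v i *\<^sub>R w i))"
      by (rule r(2)) (use a In in \<open>auto simp: near_def\<close>)
    ultimately show "X y = X (y + v)" by metis
  qed
qed

text \<open>Semicontinuity: passing to a nearby point can only add directions, since a smaller ball
  around it lies in the ball of uniform invariance.\<close>

lemma inv_space_near_mono:
  assumes J: "J \<subseteq> {..<n}" 
  shows "\<exists>r>0. \<forall>y\<in>supp_in J. near n y x r \<longrightarrow> inv_space J x \<subseteq> inv_space J y"
proof -
  obtain r where r: "0 < r" "\<forall>y\<in>supp_in J. near n y x r \<longrightarrow> (\<forall>v\<in>inv_space J x. near n v 0 r \<longrightarrow> X y = X (y + v))"
    using uniform_radius[OF J] by blast
  show ?thesis
  proof (intro exI[of _ "r/2"] conjI ballI impI subsetI)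
    show "0 < r/2" using r by simp
    fix y v assume y: "y \<in> supp_in J" "near n y x (r/2)" and v: "v \<in> inv_space J x"
    obtain d where d: "0 < d" "\<And>t. \<bar>t\<bar> < d \<Longrightarrow> near n (t *\<^sub>R v) 0 r"
      using near_scale_ex[of r n v] r(1) by auto
    show "v \<in> inv_space J y"
    proof (rule inv_spaceI)
      show "v \<in> supp_in J" using v inv_space_supp by blast
      show "0 < min (r/2) d" using r d by simp
      fix q t assume q: "q \<in> supp_in J" "near n q y (min (r/2) d)" "\<bar>t\<bar> < min (r/2) d"
      have "near n q x r" using near_trans'[OF q(2) y(2)] by simp
      moreover have "t *\<^sub>R v \<in> inv_space J x" using v subspace_inv_space by (blast intro: subspace_scale)
      ultimately show "X q = X (q + t *\<^sub>R v)" using r(2) q d(2)[of t] by auto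
    qed
  qed
qed

section \<open>Germs of \<open>X\<close> and their transport\<close>

definition germ :: "(nat \<Rightarrow> real) \<Rightarrow> (nat \<Rightarrow> real) \<Rightarrow> bool" where
  "germ x y \<longleftrightarrow> (\<exists>r>0. \<forall>u\<in>points. near n u 0 r \<longrightarrow> X (x + u) = X (y + u))"

lemma germ_refl: "germ x x" unfolding germ_def by (intro exI[of _ 1]) simp

lemma germ_sym: "germ x y \<Longrightarrow> germ y x" unfolding germ_def by metis

lemma germ_trans: assumes "germ x y" "germ y z" shows "germ x z"
proof -
  obtain r s where "0 < r" "0 < s" "\<forall>u\<in>points. near n u 0 r \<longrightarrow> X (x + u) = X (y + u)"
    "\<forall>u\<in>points. near n u 0 s \<longrightarrow> X (y + u) = X (z + u)"
    using assms unfolding germ_def by blast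
  then show ?thesis unfolding germ_def
    by (intro exI[of _ "min r s"])
      (metis min.cobounded1 min.cobounded2 min_less_iff_conj near_mono)
qed

lemma germ_shift:
  assumes "germ x y"
  shows "\<exists>r>0. \<forall>u\<in>points. near n u 0 r \<longrightarrow> germ (x + u) (y + u)"
proof -
  obtain r where r: "0 < r" "\<forall>u\<in>points. near n u 0 r \<longrightarrow> X (x + u) = X (y + u)"
    using assms unfolding germ_def by blast
  have "germ (x + u) (y + u)" if "u \<in> points" "near n u 0 (r/2)" for u
    unfolding germ_def
  proof (intro exI[of _ "r/2"] conjI ballI impI)
    fix v assume v: "v \<in> points" "near n v 0 (r/2)"
    have "near n (u + v) 0 r" using near_sums[OF that(2) v(2)] by simp
    then show "X (x + u + v) = X (y + u + v)" using r that v by (simp add: add.assoc supp_in_add)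
  qed (use r in auto)
  then show ?thesis using r by (intro exI[of _ "r/2"]) auto
qed

text \<open>Translations and homotheties preserve the directions of lines. The ratio 1 serves for
  equal germs, the ratios 1/2 and 2 for the halving condition.\<close>

lemma scaled_germ_dirs:
  assumes x: "x \<in> points" and y: "y \<in> points" and c: "0 < c" and r: "0 < r"
    and eq: "\<And>u. u \<in> points \<Longrightarrow> near n u 0 r \<Longrightarrow> X (x + u) = X (y + c *\<^sub>R u)"
  shows "dirs x \<subseteq> dirs y"
proof
  fix v assume v: "v \<in> dirs x"
  then have vp: "v \<in> points" using inv_space_supp by blast
  obtain s where s: "0 < s" "\<And>y t. y \<in> points \<Longrightarrow> near n y x s \<Longrightarrow> \<bar>t\<bar> < s \<Longrightarrow> X y = X (y + t *\<^sub>R v)"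
    using inv_spaceE[OF v] by blast
  obtain d where d: "0 < d" "\<And>t. \<bar>t\<bar> < d \<Longrightarrow> near n (t *\<^sub>R v) 0 (r/2)"
    using near_scale_ex[of "r/2" n v] r by auto
  define m where "m = min (min (r/2) s) d"
  have m: "0 < m" "m \<le> r/2" "m \<le> s" "m \<le> d" using r s d by (auto simp: m_def)
  show "v \<in> dirs y"
  proof (rule inv_spaceI[OF vp])
    show "0 < c * m" using c m by simp
    fix q t assume q: "q \<in> points" "near n q y (c * m)" "\<bar>t\<bar> < c * m"
    define u where "u = (1 / c) *\<^sub>R (q - y)"
    have u: "u \<in> points" unfolding u_def using q y by (intro supp_in_diff supp_in_scale)
    have qu: "q = y + c *\<^sub>R u" using c by (simp add: u_def)
    have "near n (q - y) 0 (c * m)" using q(2) by (simp add: near_def)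
    from near_scaleI[OF this, of "1 / c"] have nu: "near n u 0 m" using c by (simp add: u_def)
    have t: "\<bar>t / c\<bar> < m" using q(3) c by (simp add: field_simps)
    have nu2: "near n u 0 (r/2)" and nus: "near n u 0 s" using near_mono[OF nu] m by blast+
    have "X q = X (x + u)" unfolding qu by (rule eq[OF u near_mono[OF nu2], symmetric]) (use r in simp)
    also have "\<dots> = X ((x + u) + (t / c) *\<^sub>R v)"
    proof (rule s(2))
      show "x + u \<in> points" using x u by (rule supp_in_add)
      show "near n (x + u) x s" using nus by (simp only: near_add_left)
    qed (use t m in simp)
    also have "(x + u) + (t / c) *\<^sub>R v = x + (u + (t / c) *\<^sub>R v)" by (rule add.assoc)
    also have "X \<dots> = X (y + c *\<^sub>R (u + (t / c) *\<^sub>R v))"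
    proof (rule eq)
      show "u + (t / c) *\<^sub>R v \<in> points" using u vp by (intro supp_in_add supp_in_scale)
      show "near n (u + (t / c) *\<^sub>R v) 0 r" using near_sums[OF nu2 d(2)[of "t / c"]] t m by simp
    qed
    also have "y + c *\<^sub>R (u + (t / c) *\<^sub>R v) = q + t *\<^sub>R v" using c by (simp add: qu scaleR_add_right)
    finally show "X q = X (q + t *\<^sub>R v)" .
  qed
qed

lemma germ_dirs_subset:
  assumes "germ x y" "x \<in> points" "y \<in> points" shows "dirs x \<subseteq> dirs y"
proof -
  obtain r where "0 < r" "\<forall>u\<in>points. near n u 0 r \<longrightarrow> X (x + u) = X (y + u)"
    using assms(1) unfolding germ_def by blast
  then show ?thesis by (intro scaled_germ_dirs[OF assms(2,3), of 1 r]) auto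
qed

lemma germ_dirs: "germ x y \<Longrightarrow> x \<in> points \<Longrightarrow> y \<in> points \<Longrightarrow> dirs x = dirs y"
  using germ_dirs_subset germ_sym by blast

lemma dirs_points: "dirs x \<subseteq> points" by (rule inv_space_supp)

lemma dirs_scale: "v \<in> dirs x \<Longrightarrow> c *\<^sub>R v \<in> dirs x"
  using subspace_inv_space by (rule subspace_scale)

lemma germ_along:
  assumes "x \<in> points"
  shows "\<exists>r>0. \<forall>v\<in>dirs x. near n v 0 r \<longrightarrow> germ x (x + v)"
proof -
  obtain r where r: "0 < r" "\<forall>y\<in>points. near n y x r \<longrightarrow> (\<forall>v\<in>dirs x. near n v 0 r \<longrightarrow> X y = X (y + v))"
    using uniform_radius by blast
  show ?thesis unfolding germ_def
  proof (intro exI[of _ r] conjI ballI impI r(1))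
    fix v u assume v: "v \<in> dirs x" "near n v 0 r" and u: "u \<in> points" "near n u 0 r"
    have "x + u \<in> points" using assms u by (intro supp_in_add)
    then have "X (x + u) = X ((x + u) + v)" using r(2) v u by simp
    then show "X (x + u) = X (x + v + u)" by (simp add: ac_simps)
  qed
qed

text \<open>Invariance under one vector, required only where both ends lie in the ball. This makes
  the condition symmetric under \<open>u \<mapsto> - u\<close> and stable under integer multiples,
  and it mentions no real multiple of \<open>u\<close>.\<close>

definition inv_by :: "nat set \<Rightarrow> (nat \<Rightarrow> real) \<Rightarrow> real \<Rightarrow> (nat \<Rightarrow> real) \<Rightarrow> bool" where
  "inv_by J x r u \<longleftrightarrow> (\<forall>y\<in>supp_in J. near n y x r \<and> near n (y + u) x r \<longrightarrow> X y = X (y + u))"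

text \<open>The first-order substitute for the existence of a direction of invariance: real multiples of a
  vector are not definable, but a closed set of invariances with arbitrarily small nonzero elements
  contains a line near the origin.\<close>

definition nonsing :: "nat set \<Rightarrow> (nat \<Rightarrow> real) \<Rightarrow> bool" where
  "nonsing J x \<longleftrightarrow> (\<exists>r>0. \<exists>s>0.
     (\<forall>e>0. \<exists>u\<in>supp_in J. u \<noteq> 0 \<and> near n u 0 e \<and> inv_by J x r u) \<and>
     (\<forall>w\<in>supp_in J. near n w 0 s \<and> \<not> inv_by J x r w \<longrightarrow>
        (\<exists>e>0. \<forall>u\<in>supp_in J. near n u w e \<longrightarrow> \<not> inv_by J x r u)))"

definition sing :: "nat set \<Rightarrow> (nat \<Rightarrow> real) set" where
  "sing J = {x \<in> supp_in J. \<not> nonsing J x}"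

text \<open>Balls are convex: if both ends of \<open>m + 1\<close> steps lie in the ball, so does
  the point after \<open>m\<close> steps, and the induction hypothesis reaches it.\<close>

lemma inv_by_mult:
  assumes "inv_by J x r u" "u \<in> supp_in J"
  shows "inv_by J x r (real m *\<^sub>R u)"
proof (induction m)
  case 0
  have "real 0 *\<^sub>R u = 0" by (simp only: of_nat_0 scaleR_zero_left)
  then show ?case unfolding inv_by_def by (simp only: add_0_right) blast
next
  case (Suc m)
  show ?case unfolding inv_by_def
  proof (intro ballI impI)
    fix y assume y: "y \<in> supp_in J" "near n y x r \<and> near n (y + real (Suc m) *\<^sub>R u) x r"
    have "near n (y + (real m / real (Suc m)) *\<^sub>R (real (Suc m) *\<^sub>R u)) x r"
      by (rule near_convex) (use y in auto)
    then have n: "near n (y + real m *\<^sub>R u) x r" by simp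
    then have "X y = X (y + real m *\<^sub>R u)" using Suc.IH y(1,2) unfolding inv_by_def by blast
    also have "\<dots> = X ((y + real m *\<^sub>R u) + u)"
    proof (rule assms(1)[unfolded inv_by_def, rule_format])
      show "y + real m *\<^sub>R u \<in> supp_in J" using y(1) assms(2) by (intro supp_in_add supp_in_scale)
      have "(y + real m *\<^sub>R u) + u = y + real (Suc m) *\<^sub>R u" by (simp add: algebra_simps)
      then show "near n (y + real m *\<^sub>R u) x r \<and> near n (y + real m *\<^sub>R u + u) x r" using n y(2) by metis
    qed
    finally show "X y = X (y + real (Suc m) *\<^sub>R u)"
      by (simp add: algebra_simps)
  qed
qed

lemma inv_by_uminus:
  assumes "inv_by J x r u" "u \<in> supp_in J"
  shows "inv_by J x r (- u)"
  unfolding inv_by_def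
proof (intro ballI impI)
  fix y assume y: "y \<in> supp_in J" "near n y x r \<and> near n (y + - u) x r"
  then have "y - u \<in> supp_in J" using assms by (intro supp_in_diff)
  then show "X y = X (y + - u)" using assms(1) y by (auto simp: inv_by_def)
qed

text \<open>Normalise ever smaller invariances to norm 1 and let \<open>v\<close> be a limit of
  these unit vectors. Integer multiples of small invariances approximate every nonnegative multiple
  of \<open>v\<close>, and closedness passes invariance to the limit.\<close>

lemma small_invariances_limit:
  assumes J: "J \<subseteq> {..<n}" and "0 < r" "0 < s"
    and small: "\<forall>e>0. \<exists>u\<in>supp_in J. u \<noteq> 0 \<and> near n u 0 e \<and> inv_by J x r u"
    and closed: "\<forall>w\<in>supp_in J. near n w 0 s \<and> \<not> inv_by J x r w \<longrightarrow>
        (\<exists>e>0. \<forall>u\<in>supp_in J. near n u w e \<longrightarrow> \<not> inv_by J x r u)"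
  shows "\<exists>v\<in>supp_in J. v \<noteq> 0 \<and> (\<forall>t. 0 \<le> t \<and> near n (t *\<^sub>R v) 0 s \<longrightarrow> inv_by J x r (t *\<^sub>R v))"
proof -
  have "\<forall>k. \<exists>u\<in>supp_in J. u \<noteq> 0 \<and> near n u 0 (1 / real (Suc k)) \<and> inv_by J x r u"
    using small by simp
  then obtain u where u: "\<And>k. u k \<in> supp_in J" "\<And>k. u k \<noteq> 0"
    "\<And>k. near n (u k) 0 (1 / real (Suc k))" "\<And>k. inv_by J x r (u k)" by metis
  define N where "N k = Max ((\<lambda>i. \<bar>u k i\<bar>) ` {..<n})" for k
  have ex: "\<exists>i<n. u k i \<noteq> 0" for k
  proof -
    obtain i where "u k i \<noteq> 0" using u(2)[of k] by (auto simp: fun_eq_iff)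
    then show ?thesis using u(1)[of k] J by (auto simp: supp_in_def)
  qed
  have Nge: "\<bar>u k i\<bar> \<le> N k" if "i < n" for k i
    unfolding N_def by (rule Max_ge) (use that in auto)
  have Nin: "\<exists>i<n. \<bar>u k i\<bar> = N k" for k
  proof -
    have "N k \<in> (\<lambda>i. \<bar>u k i\<bar>) ` {..<n}" unfolding N_def by (rule Max_in) (use ex[of k] in auto)
    then show ?thesis by auto
  qed
  have Npos: "0 < N k" for k
  proof -
    obtain i where "i < n" "u k i \<noteq> 0" using ex by blast
    then have "0 < \<bar>u k i\<bar>" "\<bar>u k i\<bar> \<le> N k" using Nge by auto
    then show ?thesis by linarith
  qed
  have Nlt: "N k < 1 / real (Suc k)" for k
    using Nin[of k] u(3)[of k] by (auto simp: near_def)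
  have N0: "N \<longlonglongrightarrow> 0"
    by (rule tendsto_sandwich[OF _ _ tendsto_const LIMSEQ_inverse_real_of_nat])
      (use Npos Nlt in \<open>auto intro!: always_eventually less_imp_le simp: inverse_eq_divide\<close>)
  define v where "v k = (1 / N k) *\<^sub>R u k" for k
  have vb: "\<bar>v k i\<bar> \<le> 1" if "i < n" for k i
    using Nge[OF that, of k] Npos[of k] by (simp add: v_def)
  obtain \<sigma> l where l: "strict_mono \<sigma>" "\<forall>i<n. (\<lambda>k. v (\<sigma> k) i) \<longlonglongrightarrow> l i"
    using convergent_subseq_coord[of n v 1] vb by blast
  define w where "w i = (if i < n then l i else 0)" for i
  have lim: "\<forall>i<n. (\<lambda>k. v (\<sigma> k) i) \<longlonglongrightarrow> w i" using l(2) by (simp add: w_def)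
  have wJ: "w \<in> supp_in J"
    unfolding supp_in_def
  proof (intro CollectI allI impI)
    fix i assume i: "i \<notin> J"
    show "w i = 0"
    proof (cases "i < n")
      case True
      have "v k i = 0" for k using u(1)[of k] i by (simp add: v_def supp_in_def)
      then have "(\<lambda>k. 0) \<longlonglongrightarrow> w i" using lim True by auto
      then show ?thesis by (simp add: LIMSEQ_const_iff)
    qed (simp add: w_def)
  qed
  have w0: "w \<noteq> 0"
  proof
    assume "w = 0"
    then have "\<forall>\<^sub>F k in sequentially. near n (v (\<sigma> k)) 0 1"
      using near_eventually[of n "\<lambda>k. v (\<sigma> k)" w 1] lim by auto
    then obtain k where k: "near n (v (\<sigma> k)) 0 1" using eventually_happens by fastforce
    obtain i where "i < n" "\<bar>u (\<sigma> k) i\<bar> = N (\<sigma> k)" using Nin by blast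
    then have "\<bar>v (\<sigma> k) i\<bar> = 1" using Npos[of "\<sigma> k"] by (simp add: v_def)
    then show False using k \<open>i < n\<close> by (auto simp: near_def)
  qed
  have "inv_by J x r (t *\<^sub>R w)" if t: "0 \<le> t" "near n (t *\<^sub>R w) 0 s" for t
  proof (rule ccontr)
    assume "\<not> inv_by J x r (t *\<^sub>R w)"
    then obtain e where e: "e > 0" "\<forall>u\<in>supp_in J. near n u (t *\<^sub>R w) e \<longrightarrow> \<not> inv_by J x r u"
      using closed t wJ supp_in_scale by blast
    \<comment> \<open>The integer part makes \<open>m k * N k\<close> differ from \<open>t\<close>
      by at most \<open>N k\<close>, which tends to 0. So the invariances \<open>m k\<close> times
      \<open>u k\<close> converge along the subsequence to \<open>t\<close> times
      \<open>w\<close>.\<close>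
    define m where "m k = nat \<lfloor>t / N k\<rfloor>" for k
    have mN: "\<bar>real (m k) * N k - t\<bar> \<le> N k" for k
    proof -
      have "real (m k) \<le> t / N k" "t / N k < real (m k) + 1"
        using t Npos[of k] by (auto simp: m_def floor_less_iff intro: of_int_floor_le)
      then show ?thesis using Npos[of k] by (simp add: field_simps abs_if)
    qed
    have "(\<lambda>k. real (m k) * N k - t) \<longlonglongrightarrow> 0"
      by (rule tendsto_0_le[OF N0, of _ 1]) (use mN Npos in \<open>auto intro!: always_eventually simp: less_imp_le\<close>)
    then have "(\<lambda>k. real (m k) * N k) \<longlonglongrightarrow> t" by (simp add: LIM_zero_iff)
    then have ms: "(\<lambda>k. real (m (\<sigma> k)) * N (\<sigma> k)) \<longlonglongrightarrow> t"
      using LIMSEQ_subseq_LIMSEQ[OF _ l(1)] by (force simp: o_def)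
    have "(\<lambda>k. (real (m (\<sigma> k)) *\<^sub>R u (\<sigma> k)) i) \<longlonglongrightarrow> (t *\<^sub>R w) i" if "i < n" for i
    proof -
      have "(\<lambda>k. (real (m (\<sigma> k)) * N (\<sigma> k)) * v (\<sigma> k) i) \<longlonglongrightarrow> t * w i"
        using ms lim that by (intro tendsto_mult) auto
      moreover have "(real (m (\<sigma> k)) * N (\<sigma> k)) * v (\<sigma> k) i = (real (m (\<sigma> k)) *\<^sub>R u (\<sigma> k)) i" for k
        using Npos[of "\<sigma> k"] by (simp add: v_def)
      ultimately show ?thesis by simp
    qed
    then have "\<forall>\<^sub>F k in sequentially. near n (real (m (\<sigma> k)) *\<^sub>R u (\<sigma> k)) (t *\<^sub>R w) e"
      by (intro near_eventually e(1)) blast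
    then obtain k where k: "near n (real (m (\<sigma> k)) *\<^sub>R u (\<sigma> k)) (t *\<^sub>R w) e"
      using eventually_happens by fastforce
    then show False using e(2) inv_by_mult[OF u(4) u(1)] u(1) supp_in_scale by blast
  qed
  then show ?thesis using wJ w0 by blast
qed

text \<open>The limit vector gives invariance for nonnegative multiples, and
  \<open>inv_by_uminus\<close> adds the negative ones. No assumption on \<open>X\<close> enters, so
  this half is available before any tameness is known.\<close>

lemma nonsing_imp_inv:
  assumes J: "J \<subseteq> {..<n}" and ns: "nonsing J x"
  shows "\<exists>v\<in>inv_space J x. v \<noteq> 0"
proof -
  obtain r s where rs: "0 < r" "0 < s"
    and c: "\<forall>e>0. \<exists>u\<in>supp_in J. u \<noteq> 0 \<and> near n u 0 e \<and> inv_by J x r u"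
     "\<forall>w\<in>supp_in J. near n w 0 s \<and> \<not> inv_by J x r w \<longrightarrow>
        (\<exists>e>0. \<forall>u\<in>supp_in J. near n u w e \<longrightarrow> \<not> inv_by J x r u)"
    using ns unfolding nonsing_def by blast
  obtain v where v: "v \<in> supp_in J" "v \<noteq> 0" "\<And>t. 0 \<le> t \<Longrightarrow> near n (t *\<^sub>R v) 0 s \<Longrightarrow> inv_by J x r (t *\<^sub>R v)"
    using small_invariances_limit[OF J rs c] by blast
  have v': "inv_by J x r (t *\<^sub>R v)" if "near n (t *\<^sub>R v) 0 s" for t
  proof (cases "0 \<le> t")
    case False
    have "near n ((- t) *\<^sub>R v) 0 s" using that by (simp add: near_def)
    then have "inv_by J x r ((- t) *\<^sub>R v)" by (intro v(3)) (use False in auto)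
    from inv_by_uminus[OF this] have "inv_by J x r (- ((- t) *\<^sub>R v))" using v(1) supp_in_scale by blast
    then show ?thesis by (simp only: scaleR_minus_left minus_minus)
  qed (use that v in auto)
  obtain d where d: "0 < d" "\<And>t. \<bar>t\<bar> < d \<Longrightarrow> near n (t *\<^sub>R v) 0 (min s (r/2))"
    using near_scale_ex[of "min s (r/2)" n v] rs by auto
  have "v \<in> inv_space J x"
  proof (rule inv_spaceI[OF v(1)])
    show "0 < min (r/2) d" using rs d by simp
    fix y t assume y: "y \<in> supp_in J" "near n y x (min (r/2) d)" "\<bar>t\<bar> < min (r/2) d"
    have nt: "near n (t *\<^sub>R v) 0 (min s (r/2))" using d(2) y by simp
    have "near n (t *\<^sub>R v) 0 s" "near n (t *\<^sub>R v) 0 (r/2)" "near n y x (r/2)"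
      by (rule near_mono[OF nt] near_mono[OF y(2)]; simp)+
    note nn = this
    have "near n y x r" by (rule near_mono[OF nn(3)]) (use rs in simp)
    moreover have "near n (y + t *\<^sub>R v) y (r/2)" using nn(2) by simp
    then have "near n (y + t *\<^sub>R v) x r" by (rule near_trans'[OF _ nn(3)]) simp
    ultimately show "X y = X (y + t *\<^sub>R v)" using v'[OF nn(1)] y(1) unfolding inv_by_def by blast
  qed
  then show ?thesis using v by blast
qed

text \<open>A point is moved along its directions. If its germ never changes, the whole flat has this germ,
  and the flat meets a complementary coordinate subspace in a singular point of that section;
  otherwise the first change of germ occurs at a point with fewer directions.\<close>

lemma trace_to_singular:
  assumes "x \<in> points"
  shows "\<exists>J p. J \<subseteq> {..<n} \<and> p \<in> supp_in J \<and> inv_space J p = {0} \<and> x - p \<in> dirs x \<and>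
    (\<forall>e>0. \<exists>y\<in>points. near n y p e \<and> x - y \<in> dirs x \<and> germ x y)"
  using assms
proof (induction "rank n (dirs x)" arbitrary: x rule: less_induct)
  case less
  note xp = less.prems
  let ?L = "dirs x"
  note sL = subspace_inv_space[of "{..<n}" x]
  show ?case
  proof (cases "\<forall>v\<in>?L. germ x (x + v)")
    case True
    obtain I w where w: "basis_of n ?L I w" using basis_exists[OF sL dirs_points] by blast
    then have I: "I \<subseteq> {..<n}" and ech: "echelon n ?L I w" by (auto simp: basis_of_def echelon_def)
    \<comment> \<open>The direction \<open>s\<close> agrees with \<open>x\<close> at all pivots.
      Hence \<open>p = x - s\<close> vanishes there: it is where the flat of \<open>x\<close> meets
      the coordinate subspace complementary to the pivots.\<close>
    define s where "s = (\<Sum>i\<in>I. x i *\<^sub>R w i)"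
    define p where "p = x - s"
    have sum_in: "(\<Sum>i\<in>I. c i *\<^sub>R w i) \<in> ?L" for c
      using ech sL by (intro subspace_sum subspace_scale) (auto simp: echelon_def)
    have s: "s \<in> ?L" unfolding s_def by (rule sum_in)
    have sum_coord: "(\<Sum>i\<in>I. c i *\<^sub>R w i) j = c j" if "j \<in> I" for c j
    proof -
      have "(\<Sum>i\<in>I. c i *\<^sub>R w i) j = (\<Sum>i\<in>I. if j = i then c i else 0)"
        unfolding sum_fun_apply using ech that by (intro sum.cong) (auto simp: echelon_def)
      then show ?thesis using basis_finite[OF w] that by simp
    qed
    define J where "J = {..<n} - I"
    have pp: "p \<in> points" using xp s dirs_points by (auto simp: p_def intro: supp_in_diff)
    have pI: "p i = 0" if "i \<in> I" for i
      using sum_coord[OF that, of x] by (simp add: p_def s_def)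
    have pJ: "p \<in> supp_in J" using pp pI by (auto simp: supp_in_def J_def)
    have "- s \<in> ?L" using sL s by (rule subspace_neg)
    then have "germ x (x + (- s))" using True by blast
    then have g: "germ x p" by (simp add: p_def)
    have Lp: "dirs p = ?L" using germ_dirs[OF g xp pp] by simp
    \<comment> \<open>A direction of the section at \<open>p\<close> is a direction of
      \<open>X\<close>: slide a nearby point along the flat into the section, move along
      \<open>v\<close>, and slide back. Then \<open>v\<close> lies in \<open>dirs p\<close> and
      vanishes at all pivots, so it is 0.\<close>
    have "inv_space J p \<subseteq> {0}"
    proof
      fix v assume v: "v \<in> inv_space J p"
      then have vJ: "v \<in> supp_in J" using inv_space_supp by blast
      then have vp: "v \<in> points" using supp_in_mono[of J "{..<n}"] by (auto simp: J_def)
      obtain r where r: "0 < r" "\<And>y t. y \<in> supp_in J \<Longrightarrow> near n y p r \<Longrightarrow> \<bar>t\<bar> < r \<Longrightarrow> X y = X (y + t *\<^sub>R v)"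
        using inv_spaceE[OF v] by blast
      obtain q where q: "0 < q" "\<forall>y\<in>points. near n y p q \<longrightarrow> (\<forall>v\<in>dirs p. near n v 0 q \<longrightarrow> X y = X (y + v))"
        using uniform_radius by blast
      obtain m' where m': "0 < m'" "\<And>u. near n u 0 m' \<Longrightarrow> near n (\<Sum>i\<in>I. u i *\<^sub>R w i) 0 (min r q / 2)"
        using near_combination[OF I, of "min r q / 2" w] r(1) q(1) by auto
      define m where "m = min m' (min r q / 2)"
      have m: "0 < m" "m \<le> m'" "m \<le> r / 2" "m \<le> q / 2" using r(1) q(1) m'(1) by (auto simp: m_def)
      obtain d where d: "0 < d" "\<And>t. \<bar>t\<bar> < d \<Longrightarrow> near n (t *\<^sub>R v) 0 m"
        using near_scale_ex[of m n v] m(1) by auto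
      have "v \<in> dirs p"
      proof (rule inv_spaceI[OF vp])
        show "0 < min m d" using m d by simp
        fix y t assume y: "y \<in> points" "near n y p (min m d)" "\<bar>t\<bar> < min m d"
        have ym: "near n y p m" by (rule near_mono[OF y(2)]) simp
        define l where "l = (\<Sum>i\<in>I. y i *\<^sub>R w i)"
        have lL: "l \<in> ?L" unfolding l_def by (rule sum_in)
        have "near n (y - p) 0 m'" using near_mono[OF ym m(2)] by (simp add: near_def)
        moreover have "(\<Sum>i\<in>I. (y - p) i *\<^sub>R w i) = l"
          unfolding l_def by (rule sum.cong) (simp_all add: pI)
        ultimately have nl: "near n l 0 (min r q / 2)" using m'(2) by metis
        have nlq: "near n l 0 (q/2)" and nlr: "near n l 0 (r/2)" by (rule near_mono[OF nl]; simp)+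
        have nml: "near n (- l) 0 q" using nlq q by (auto simp: near_def)
        have lp: "l \<in> points" using lL dirs_points by blast
        have yl: "y - l \<in> supp_in J"
        proof -
          have "y - l \<in> points" using y lp by (intro supp_in_diff)
          moreover have "(y - l) i = 0" if "i \<in> I" for i using sum_coord[OF that, of y] by (simp add: l_def)
          ultimately show ?thesis by (auto simp: supp_in_def J_def)
        qed
        have "near n (y - l) y (r/2)" using nlr by (simp add: near_def)
        moreover have "near n y p (r/2)" using near_mono[OF ym m(3)] .
        ultimately have nylr: "near n (y - l) p r" by (rule near_trans') simp
        have yq: "near n y p q" by (rule near_mono[OF ym]) (use m q in simp)
        have ml: "- l \<in> dirs p" using lL Lp sL subspace_neg by blast
        have "X y = X (y + (- l))" using q(2) y yq ml nml by blast
        also have "\<dots> = X ((y - l) + t *\<^sub>R v)"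
          using r(2)[OF yl nylr] y m r by simp
        also have "\<dots> = X ((y + t *\<^sub>R v) + (- l))" by (simp add: algebra_simps)
        also have "\<dots> = X (y + t *\<^sub>R v)"
        proof (rule q(2)[rule_format, symmetric])
          show "y + t *\<^sub>R v \<in> points" using y vp by (intro supp_in_add supp_in_scale)
          have "near n (y + t *\<^sub>R v) y m" using d(2)[of t] y by simp
          from near_trans'[OF this ym] m show "near n (y + t *\<^sub>R v) p q" by simp
        qed (use ml nml in auto)
        finally show "X y = X (y + t *\<^sub>R v)" .
      qed
      then have "v = (\<Sum>i\<in>I. v i *\<^sub>R w i)" using w Lp by (auto simp: basis_of_def)
      moreover have "v i = 0" if "i \<in> I" for i using vJ that by (auto simp: supp_in_def J_def)
      then have "(\<Sum>i\<in>I. v i *\<^sub>R w i) = 0" by simp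
      ultimately show "v \<in> {0}" by (metis singletonI)
    qed
    then have "inv_space J p = {0}" using subspace_0[OF subspace_inv_space] by blast
    moreover have "x - p \<in> ?L" using s by (simp add: p_def)
    moreover have "J \<subseteq> {..<n}" by (auto simp: J_def)
    moreover have "\<forall>e>0. \<exists>y\<in>points. near n y p e \<and> x - y \<in> ?L \<and> germ x y"
      using g pp near_refl \<open>x - p \<in> ?L\<close> by blast
    ultimately show ?thesis using pJ by blast
  next
    case False
    then obtain v where v: "v \<in> ?L" "\<not> germ x (x + v)" by blast
    have vp: "v \<in> points" using v dirs_points by blast
    define G where "G t = germ x (x + t *\<^sub>R v)" for t :: real
    have xt: "x + t *\<^sub>R v \<in> points" for t using xp vp by (intro supp_in_add supp_in_scale)
    have open_G: "\<exists>d>0. \<forall>t'. \<bar>t' - t\<bar> < d \<longrightarrow> germ (x + t *\<^sub>R v) (x + t' *\<^sub>R v)"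
      if "v \<in> dirs (x + t *\<^sub>R v)" for t
    proof -
      obtain r where r: "0 < r" "\<forall>u\<in>dirs (x + t *\<^sub>R v). near n u 0 r \<longrightarrow> germ (x + t *\<^sub>R v) (x + t *\<^sub>R v + u)"
        using germ_along[OF xt] by blast
      obtain d where d: "0 < d" "\<And>t. \<bar>t\<bar> < d \<Longrightarrow> near n (t *\<^sub>R v) 0 r"
        using near_scale_ex[OF r(1), of n v] by auto
      show ?thesis
      proof (intro exI[of _ d] conjI allI impI d(1))
        fix t' assume "\<bar>t' - t\<bar> < d"
        then have "near n ((t' - t) *\<^sub>R v) 0 r" by (rule d(2))
        then have "germ (x + t *\<^sub>R v) (x + t *\<^sub>R v + (t' - t) *\<^sub>R v)"
          using r(2) that dirs_scale by blast
        then show "germ (x + t *\<^sub>R v) (x + t' *\<^sub>R v)" by (simp add: algebra_simps)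
      qed
    qed
    have GL: "dirs (x + t *\<^sub>R v) = ?L" if "G t" for t
      using germ_dirs[OF that[unfolded G_def] xp xt] by simp
    have "G 0" by (simp add: G_def germ_refl)
    have "\<not> G 1" using v by (simp add: G_def)
    \<comment> \<open>The infimum \<open>\<tau>\<close> of \<open>T\<close> is the first change of
      germ. The germ at \<open>\<tau>\<close> itself differs, because a germ persists for a while
      wherever \<open>v\<close> is still a direction.\<close>
    define T where "T = {t. 0 \<le> t \<and> \<not> G t}"
    have T: "1 \<in> T" "bdd_below T" using \<open>\<not> G 1\<close> by (auto simp: T_def intro: bdd_belowI[of _ 0])
    define \<tau> where "\<tau> = Inf T"
    have \<tau>0: "0 \<le> \<tau>" unfolding \<tau>_def by (rule cInf_greatest) (use T(1) in blast, simp add: T_def)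
    have below: "G t" if "0 \<le> t" "t < \<tau>" for t
      using that cInf_lower[OF _ T(2), of t] by (auto simp: T_def \<tau>_def)
    have "\<not> G \<tau>"
    proof
      assume g: "G \<tau>"
      then obtain d where d: "0 < d" "\<forall>t'. \<bar>t' - \<tau>\<bar> < d \<longrightarrow> germ (x + \<tau> *\<^sub>R v) (x + t' *\<^sub>R v)"
        using open_G[of \<tau>] GL v by blast
      have "G t'" if "0 \<le> t'" "t' < \<tau> + d" for t'
      proof (cases "t' < \<tau>")
        case False
        then have "\<bar>t' - \<tau>\<bar> < d" using that by auto
        then show ?thesis using d g germ_trans unfolding G_def by blast
      qed (use below that in auto)
      then have "\<tau> + d \<le> t" if "t \<in> T" for t using that unfolding T_def by force
      then have "\<tau> + d \<le> \<tau>" unfolding \<tau>_def using T(1) by (intro cInf_greatest) auto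
      then show False using d by simp
    qed
    then have \<tau>: "0 < \<tau>" using \<open>G 0\<close> \<tau>0 by (cases "\<tau> = 0") auto
    define z where "z = x + \<tau> *\<^sub>R v"
    have zp: "z \<in> points" unfolding z_def by (rule xt)
    obtain r where r: "0 < r" "\<forall>y\<in>points. near n y z r \<longrightarrow> dirs z \<subseteq> dirs y"
      using inv_space_near_mono by blast
    have near_z: "\<exists>d>0. \<forall>t. \<bar>t\<bar> < d \<longrightarrow> near n (z - t *\<^sub>R v) z r" if pos: "0 < r" for r
    proof -
      obtain d where "0 < d" "\<And>t. \<bar>t\<bar> < d \<Longrightarrow> near n (t *\<^sub>R v) 0 r"
        using near_scale_ex[OF pos, of n v] by auto
      then show ?thesis by (intro exI[of _ d]) (auto simp: near_def)
    qed
    have zt: "z - t *\<^sub>R v = x + (\<tau> - t) *\<^sub>R v" for t by (simp add: z_def algebra_simps)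
    obtain d where d: "0 < d" "\<forall>t. \<bar>t\<bar> < d \<longrightarrow> near n (z - t *\<^sub>R v) z r" using near_z[OF r(1)] by blast
    \<comment> \<open>Just before \<open>\<tau>\<close> the direction space is still
      \<open>dirs x\<close>, and by semicontinuity it contains that of the limit point
      \<open>z\<close>.\<close>
    have sub: "dirs z \<subseteq> ?L"
    proof -
      let ?t = "min (d/2) \<tau>"
      have "G (\<tau> - ?t)" using below d(1) \<tau> by auto
      then have "dirs (z - ?t *\<^sub>R v) = ?L" using GL zt by simp
      moreover have "near n (z - ?t *\<^sub>R v) z r" using d \<tau> by auto
      ultimately show ?thesis using r(2) xt zt by metis
    qed
    \<comment> \<open>If no direction were lost, \<open>v\<close> would be a direction at
      \<open>z\<close>, and the germ would be the same at \<open>z\<close> and slightly before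
      it.\<close>
    have "dirs z \<noteq> ?L"
    proof
      assume "dirs z = ?L"
      then obtain d where d: "0 < d" "\<forall>t'. \<bar>t' - \<tau>\<bar> < d \<longrightarrow> germ z (x + t' *\<^sub>R v)"
        using open_G[of \<tau>] v by (auto simp: z_def)
      let ?t = "\<tau> - min (d/2) \<tau>"
      have "germ z (x + ?t *\<^sub>R v)" using d \<tau> by auto
      moreover have "G ?t" using below d(1) \<tau> by auto
      ultimately have "germ x z" unfolding G_def using germ_trans germ_sym by blast
      then show False using \<open>\<not> G \<tau>\<close> by (simp add: G_def z_def)
    qed
    then have "rank n (dirs z) < rank n ?L"
      using rank_strict[OF subspace_inv_space sL dirs_points] sub by blast
    from less.hyps[OF this zp] obtain J p where p: "J \<subseteq> {..<n}" "p \<in> supp_in J" "inv_space J p = {0}"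
      "z - p \<in> dirs z" "\<And>e. e > 0 \<Longrightarrow> \<exists>y\<in>points. near n y p e \<and> z - y \<in> dirs z \<and> germ z y" by blast
    have xz: "x - z \<in> ?L" using dirs_scale[OF v(1), of "- \<tau>"] by (simp add: z_def)
    have "x - p \<in> ?L" using subspace_add[OF sL xz, of "z - p"] p(4) sub by auto
    \<comment> \<open>The points near \<open>p\<close> given by induction have the germ of
      \<open>z\<close>, not that of \<open>x\<close>. Moving both \<open>z\<close> and such a point
      back by a small \<open>t\<close> times \<open>v\<close> repairs this: \<open>z\<close> moved
      back has the germ of \<open>x\<close>, and \<open>germ_shift\<close> moves the pair together.
      This is why \<open>p\<close> is only a limit of points with the right germ.\<close>
    moreover have "\<exists>y\<in>points. near n y p e \<and> x - y \<in> ?L \<and> germ x y" if e: "e > 0" for e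
    proof -
      obtain y where y: "y \<in> points" "near n y p (e/2)" "z - y \<in> dirs z" "germ z y"
        using p(5)[of "e/2"] e by auto
      obtain q where q: "0 < q" "\<forall>u\<in>points. near n u 0 q \<longrightarrow> germ (z + u) (y + u)"
        using germ_shift[OF y(4)] by blast
      obtain d where d: "0 < d" "\<And>t. \<bar>t\<bar> < d \<Longrightarrow> near n (t *\<^sub>R v) 0 (min q (e/2))"
        using near_scale_ex[of "min q (e/2)" n v] q(1) e by auto
      define t where "t = min (d/2) \<tau>"
      have t: "0 < t" "t < d" "t \<le> \<tau>" using d \<tau> by (auto simp: t_def)
      have "near n ((- t) *\<^sub>R v) 0 (min q (e/2))" using d(2)[of "- t"] t by simp
      then have nq: "near n ((- t) *\<^sub>R v) 0 q" and ne: "near n ((- t) *\<^sub>R v) 0 (e/2)"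
        by (rule near_mono; simp)+
      let ?y = "y + (- t) *\<^sub>R v"
      have yp: "?y \<in> points" using y vp by (intro supp_in_add supp_in_scale)
      have "germ (z + (- t) *\<^sub>R v) ?y" using q(2) nq vp supp_in_scale by blast
      moreover have "G (\<tau> - t)" using below t by auto
      then have "germ x (z + (- t) *\<^sub>R v)" using zt[of t] by (simp add: G_def)
      ultimately have gy: "germ x ?y" using germ_trans by blast
      have "near n ?y y (e/2)" using ne by (simp only: near_add_left)
      then have ny: "near n ?y p e" by (rule near_trans'[OF _ y(2)]) simp
      have "x - ?y = (x - z) + (z - y) + t *\<^sub>R v" by simp
      moreover have "(x - z) + (z - y) + t *\<^sub>R v \<in> ?L"
        using xz y(3) sub dirs_scale[OF v(1), of t] by (intro subspace_add[OF sL]) auto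
      ultimately have "x - ?y \<in> ?L" by metis
      then show ?thesis using yp gy ny by blast
    qed
    ultimately show ?thesis using p by blast
  qed
qed

lemma segment_const:
  assumes "x \<in> points" "y \<in> points"
    and "\<And>t. 0 \<le> t \<Longrightarrow> t \<le> 1 \<Longrightarrow> y - x \<in> dirs (x + t *\<^sub>R (y - x))"
  shows "X x = X y"
proof -
  define P where "P t = X (x + t *\<^sub>R (y - x))" for t
  have "P 0 = P 1"
  proof (rule locally_const_segment)
    fix t :: real assume t: "0 \<le> t" "t \<le> 1"
    let ?z = "x + t *\<^sub>R (y - x)"
    have z: "?z \<in> points" using assms by (intro supp_in_add supp_in_scale supp_in_diff)
    obtain r where r: "0 < r" "\<forall>q t. q \<in> points \<longrightarrow> near n q ?z r \<longrightarrow> \<bar>t\<bar> < r \<longrightarrow> X q = X (q + t *\<^sub>R (y - x))"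
      using inv_spaceE[OF assms(3)[OF t]] by blast
    have "P s = P t" if "\<bar>s - t\<bar> < r" for s
    proof -
      have "X ?z = X (?z + (s - t) *\<^sub>R (y - x))"
        using r(2) z near_refl[OF r(1)] that by blast
      moreover have "?z + (s - t) *\<^sub>R (y - x) = x + s *\<^sub>R (y - x)" by (simp add: algebra_simps)
      ultimately show ?thesis unfolding P_def by metis
    qed
    then show "\<exists>d>0. \<forall>s. 0 \<le> s \<and> s \<le> 1 \<and> \<bar>s - t\<bar> < d \<longrightarrow> P s = P t" using r(1) by blast
  qed
  then show ?thesis by (simp add: P_def)
qed

text \<open>Conical sets are invariant under all multiples of a vector as soon as they are invariant under
  that one vector on a ball: scale the invariance to two nearby multiples and subtract.\<close>

lemma conical_inv:
  assumes J: "J \<subseteq> {..<n}" and x: "x \<in> supp_in J" and u: "u \<in> supp_in J"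
    and cone: "\<And>y t. y \<in> supp_in J \<Longrightarrow> near n y x \<rho> \<Longrightarrow> 0 < t \<Longrightarrow> t \<le> 1 \<Longrightarrow> X y = X (x + t *\<^sub>R (y - x))"
    and inv: "\<And>y. y \<in> supp_in J \<Longrightarrow> near n y x \<eta> \<Longrightarrow> X y = X (y + u)"
    and "0 < \<eta>" "0 < \<eta>'" "near n u 0 \<eta>'" "\<eta> + \<eta>' \<le> \<rho>"
  shows "u \<in> inv_space J x"
proof -
  \<comment> \<open>Enlarge by \<open>1 / s\<close> about \<open>x\<close>, use the invariance under
    \<open>u\<close>, and shrink back by the cone property: the result is invariance under
    \<open>s\<close> times \<open>u\<close> on a ball of radius \<open>s * \<eta>\<close>.\<close>
  have scaled: "X q = X (q + s *\<^sub>R u)" if q: "q \<in> supp_in J" "near n q x (s * \<eta>)" and s: "0 < s" "s \<le> 1" for q s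
  proof -
    define Y where "Y = x + (1 / s) *\<^sub>R (q - x)"
    have Yq: "x + s *\<^sub>R (Y - x) = q" "x + s *\<^sub>R (Y + u - x) = q + s *\<^sub>R u"
      using s by (simp_all add: Y_def scaleR_add_right add.commute add_diff_eq[symmetric])
    have Y: "Y \<in> supp_in J" using q x by (auto simp: Y_def intro!: supp_in_add supp_in_scale supp_in_diff)
    have "near n (q - x) 0 (s * \<eta>)" using q by (simp add: near_def)
    from near_scaleI[OF this, of "1 / s"] have "near n ((1/s) *\<^sub>R (q - x)) 0 \<eta>" using s by simp
    then have nY: "near n Y x \<eta>" by (simp only: Y_def near_add_left)
    have Yu: "Y + u \<in> supp_in J" using Y u by (rule supp_in_add)
    have "near n (Y + u) Y \<eta>'" using assms by (simp only: near_add_left)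
    then have "near n (Y + u) x \<rho>" by (rule near_trans'[OF _ nY]) (use assms in simp)
    then have "X (Y + u) = X (q + s *\<^sub>R u)" using cone[OF Yu _ s] Yq by metis
    moreover have "X Y = X q" using cone[OF Y near_mono[OF nY] s] Yq assms by simp
    ultimately show ?thesis using inv[OF Y nY] by simp
  qed
  obtain d where d: "0 < d" "\<And>t. \<bar>t\<bar> < d \<Longrightarrow> near n (t *\<^sub>R u) 0 (\<eta>/4)"
    using near_scale_ex[of "\<eta>/4" n u] assms by auto
  show ?thesis
  proof (rule inv_spaceI[OF u])
    show "0 < min (min (1/4) (\<eta>/4)) d" using assms d by simp
    fix q t assume q: "q \<in> supp_in J" "near n q x (min (min (1/4) (\<eta>/4)) d)" "\<bar>t\<bar> < min (min (1/4) (\<eta>/4)) d"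
    have qn: "near n q x (\<eta>/4)" by (rule near_mono[OF q(2)]) simp
    have t: "- 1/4 < t" "t < 1/4" using q(3) by auto
    \<comment> \<open>Going forward by \<open>1/2 + t\<close> and back by \<open>1/2\<close>
      realises a shift of either sign. As \<open>t\<close> stays below 1/4 in absolute value,
      \<open>1/2 + t\<close> remains between 1/4 and 1, so a ball of radius \<open>\<eta>/4\<close>
      suffices.\<close>
    have "X q = X (q + (1/2 + t) *\<^sub>R u)"
    proof (rule scaled[OF q(1)])
      have "\<eta>/4 \<le> (1/2 + t) * \<eta>" using mult_right_mono[of "1/4" "1/2 + t" \<eta>] t assms by simp
      then show "near n q x ((1/2 + t) * \<eta>)" by (rule near_mono[OF qn])
    qed (use t in auto)
    also have "q + (1/2 + t) *\<^sub>R u = (q + t *\<^sub>R u) + (1/2) *\<^sub>R u" by (simp add: algebra_simps)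
    also have "X \<dots> = X (q + t *\<^sub>R u)"
    proof (rule scaled[symmetric])
      show "q + t *\<^sub>R u \<in> supp_in J" using q u by (intro supp_in_add supp_in_scale)
      have "near n (q + t *\<^sub>R u) q (\<eta>/4)" using d(2)[of t] q(3) by (simp only: near_add_left)
      then show "near n (q + t *\<^sub>R u) x (1/2 * \<eta>)" by (rule near_trans'[OF _ qn]) simp
    qed auto
    finally show "X q = X (q + t *\<^sub>R u)" .
  qed
qed

text \<open>The points through which all flats pass. The empty \<open>J\<close> is included and
  contributes the origin, which serves flats that fill the whole space.\<close>

definition apex :: "(nat \<Rightarrow> real) set" where
  "apex = {p. \<exists>J\<subseteq>{..<n}. p \<in> supp_in J \<and> inv_space J p = {0}}"

lemma apex_points: "apex \<subseteq> points"
  using supp_in_mono by (auto simp: apex_def)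

lemma flat_apex:
  assumes "x \<in> points" shows "\<exists>p\<in>apex. x - p \<in> dirs x"
  using trace_to_singular[OF assms] unfolding apex_def by blast

lemma germ_uniform:
  assumes "z \<in> points"
  shows "\<exists>r>0. \<forall>y\<in>points. near n y z r \<longrightarrow> (\<forall>v\<in>dirs z. near n v 0 r \<longrightarrow> germ y (y + v))"
proof -
  obtain r where r: "0 < r" "\<forall>y\<in>points. near n y z r \<longrightarrow> (\<forall>v\<in>dirs z. near n v 0 r \<longrightarrow> X y = X (y + v))"
    using uniform_radius by blast
  have "germ y (y + v)" if y: "y \<in> points" "near n y z (r/2)" and v: "v \<in> dirs z" "near n v 0 (r/2)" for y v
    unfolding germ_def
  proof (intro exI[of _ "r/2"] conjI ballI impI)
    fix u assume u: "u \<in> points" "near n u 0 (r/2)"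
    have p: "y + u \<in> points" using y u by (intro supp_in_add)
    have "near n (y + u) y (r/2)" using u by (simp only: near_add_left)
    then have "near n (y + u) z r" by (rule near_trans'[OF _ y(2)]) simp
    moreover have "near n v 0 r" by (rule near_mono[OF v(2)]) (use r in simp)
    ultimately have "X (y + u) = X ((y + u) + v)" using r(2) p v by blast
    then show "X (y + u) = X (y + v + u)" by (simp add: ac_simps)
  qed (use r in simp)
  then show ?thesis using r(1) by (intro exI[of _ "r/2"]) auto
qed

end

locale tame_relation = relation +
  assumes finite_apex: "finite apex"
    and halving: "z \<in> points \<Longrightarrow> \<exists>r>0. \<forall>y\<in>points. near n y z r \<longrightarrow> X y = X (z + (1/2) *\<^sub>R (y - z))"
begin

text \<open>Each flat \<open>p + L\<close> is closed and there are finitely many \<open>p\<close>,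
  so a small ball around \<open>x\<close> meets only those flats parallel to \<open>L\<close> that
  contain \<open>x\<close>.\<close>

lemma flats_near:
  assumes "subspace L" "L \<subseteq> points" "x \<in> points"
  shows "\<exists>e>0. \<forall>p\<in>apex. \<forall>y. near n y x e \<longrightarrow> y - p \<in> L \<longrightarrow> x - p \<in> L"
proof (rule finite_radius[OF finite_apex])
  fix p assume p: "p \<in> apex"
  show "\<exists>e>0. \<forall>y. near n y x e \<longrightarrow> y - p \<in> L \<longrightarrow> x - p \<in> L"
  proof (cases "x - p \<in> L")
    case False
    have "x - p \<in> points" using p apex_points assms by (blast intro: supp_in_diff)
    from subspace_complement_open[OF assms(1,2) this False]
    obtain e where e: "e > 0" "\<forall>y\<in>L. \<not> near n y (x - p) e" by blast
    have "y - p \<notin> L" if "near n y x e" for y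
      using e(2) that by (auto simp: near_def)
    then show ?thesis using e(1) by blast
  qed (auto intro: exI[of _ 1])
next
  fix p e e' assume "\<forall>y. near n y x e \<longrightarrow> y - p \<in> L \<longrightarrow> x - p \<in> L" "e' \<le> e"
  then show "\<forall>y. near n y x e' \<longrightarrow> y - p \<in> L \<longrightarrow> x - p \<in> L" using near_mono by blast
qed

text \<open>The flat of \<open>y\<close> passes through an apex and is parallel to
  \<open>dirs z\<close>; being close to \<open>z\<close>, it must contain \<open>z\<close>. Hence
  points near \<open>z\<close> with the same direction space lie on the flat of
  \<open>z\<close>.\<close>

lemma same_dirs_isolated:
  assumes "z \<in> points"
  shows "\<exists>r>0. \<forall>y\<in>points. near n y z r \<longrightarrow> dirs y = dirs z \<longrightarrow> y - z \<in> dirs z"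
proof -
  obtain e where e: "e > 0" "\<forall>p\<in>apex. \<forall>y. near n y z e \<longrightarrow> y - p \<in> dirs z \<longrightarrow> z - p \<in> dirs z"
    using flats_near[OF subspace_inv_space dirs_points assms] by blast
  have "y - z \<in> dirs z" if y: "y \<in> points" "near n y z e" "dirs y = dirs z" for y
  proof -
    obtain p where p: "p \<in> apex" "y - p \<in> dirs z" using flat_apex[OF y(1)] y(3) by auto
    then have "z - p \<in> dirs z" using e(2) y(2) by blast
    from subspace_diff[OF subspace_inv_space p(2) this] show ?thesis by simp
  qed
  then show ?thesis using e(1) by blast
qed

text \<open>Halving carries the germ at \<open>y\<close> to a rescaled germ at the image point; the
  two inclusions use the ratios 1/2 and 2.\<close>

lemma half_dirs:
  assumes z: "z \<in> points"
  shows "\<exists>r>0. \<forall>y\<in>points. near n y z r \<longrightarrow> dirs (z + (1/2) *\<^sub>R (y - z)) = dirs y"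
proof -
  define h where "h y = z + (1/2) *\<^sub>R (y - z)" for y
  obtain r where r: "0 < r" "\<forall>y\<in>points. near n y z r \<longrightarrow> X y = X (h y)"
    using halving[OF z] unfolding h_def by blast
  have hadd: "h (y + u) = h y + (1/2) *\<^sub>R u" for y u by (simp add: h_def algebra_simps)
  have hp: "h y \<in> points" if "y \<in> points" for y
    unfolding h_def using z that by (intro supp_in_add supp_in_scale supp_in_diff)
  have Xh: "X (y + u) = X (h y + (1/2) *\<^sub>R u)"
    if "y \<in> points" "near n y z (r/2)" "u \<in> points" "near n u 0 (r/2)" for y u
  proof -
    have "near n (y + u) y (r/2)" using that by (simp only: near_add_left)
    then have "near n (y + u) z r" by (rule near_trans'[OF _ that(2)]) simp
    then have "X (y + u) = X (h (y + u))" using r(2) that supp_in_add by blast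
    then show ?thesis by (simp add: hadd)
  qed
  have "dirs (h y) = dirs y" if y: "y \<in> points" "near n y z (r/2)" for y
  proof
    show "dirs y \<subseteq> dirs (h y)"
      by (rule scaled_germ_dirs[OF y(1) hp[OF y(1)], of "1/2" "r/2"]) (use r(1) Xh[OF y] in auto)
    show "dirs (h y) \<subseteq> dirs y"
    proof (rule scaled_germ_dirs[OF hp[OF y(1)] y(1), of 2 "r/4"])
      fix u assume u: "u \<in> points" "near n u 0 (r/4)"
      have "near n (2 *\<^sub>R u) 0 (r/2)" using near_scaleI[OF u(2), of 2] by (simp add: near_def)
      then have "X (y + 2 *\<^sub>R u) = X (h y + (1/2) *\<^sub>R (2 *\<^sub>R u))"
        using u by (intro Xh[OF y] supp_in_scale)
      then show "X (h y + u) = X (y + 2 *\<^sub>R u)" by simp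
    qed (use r(1) in auto)
  qed
  then show ?thesis using r(1) unfolding h_def by (intro exI[of _ "r/2"]) auto
qed

section \<open>Finiteness of the direction spaces\<close>

text \<open>Infinitely many distinct direction spaces on a bounded closed set would accumulate at
  one of its points, where only finitely many occur nearby.\<close>

lemma locally_finite_dirs_compact:
  assumes A: "A \<subseteq> points" "\<And>y i. y \<in> A \<Longrightarrow> i < n \<Longrightarrow> \<bar>y i\<bar> \<le> B"
    and closed: "\<And>f l. (\<And>k. f k \<in> A) \<Longrightarrow> l \<in> points \<Longrightarrow> \<forall>i<n. (\<lambda>k. f k i) \<longlonglongrightarrow> l i \<Longrightarrow> l \<in> A"
    and fin: "\<And>y. y \<in> A \<Longrightarrow> \<exists>r>0. finite (dirs ` {q \<in> points. near n q y r})"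
  shows "finite (dirs ` A)"
proof (rule ccontr)
  assume "infinite (dirs ` A)"
  then obtain D :: "nat \<Rightarrow> _" where D: "inj D" "range D \<subseteq> dirs ` A"
    using infinite_countable_subset by blast
  then have "\<forall>k. \<exists>y\<in>A. D k = dirs y" by blast
  then obtain f where f: "\<And>k. f k \<in> A" "\<And>k. D k = dirs (f k)" by metis
  obtain \<sigma> l where l: "strict_mono (\<sigma> :: nat \<Rightarrow> nat)" "\<forall>i<n. (\<lambda>k. f (\<sigma> k) i) \<longlonglongrightarrow> l i"
    using convergent_subseq_coord[of n f B] A(2) f(1) by blast
  define z where "z i = (if i < n then l i else 0)" for i
  have lim: "\<forall>i<n. (\<lambda>k. f (\<sigma> k) i) \<longlonglongrightarrow> z i" using l(2) by (simp add: z_def)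
  have zp: "z \<in> points" by (simp add: z_def supp_in_def)
  have "z \<in> A" by (rule closed[OF _ zp lim]) (rule f(1))
  from fin[OF this] obtain r where r: "r > 0" "finite (dirs ` {q \<in> points. near n q z r})" by blast
  have "\<forall>\<^sub>F k in sequentially. near n (f (\<sigma> k)) z r"
    by (rule near_eventually[OF _ r(1)]) (use lim in simp)
  then obtain K where K: "\<And>k. K \<le> k \<Longrightarrow> near n (f (\<sigma> k)) z r"
    by (auto simp: eventually_sequentially)
  have "(\<lambda>k. D (\<sigma> k)) ` {K..} \<subseteq> dirs ` {q \<in> points. near n q z r}"
    using K A(1) by (auto simp: f(2) subset_iff intro!: imageI f(1))
  then have "finite ((\<lambda>k. D (\<sigma> k)) ` {K..})" using r(2) finite_subset by blast
  moreover have "inj_on (\<lambda>k. D (\<sigma> k)) {K..}"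
    using inj_compose[OF D(1) strict_mono_imp_inj_on[OF l(1)]]
    by (auto simp: o_def intro: inj_on_subset)
  ultimately have "finite {K..}" using finite_imageD by blast
  then show False using infinite_Ici by blast
qed

text \<open>Induction on the codimension of \<open>dirs z\<close>. In a slice through
  \<open>z\<close> transversal to this space all other nearby points have more directions, so the
  induction hypothesis covers the shell \<open>A\<close>. Doubling about \<open>z\<close> takes the
  remaining points of the slice into the shell, and points off the slice slide into it along
  \<open>dirs z\<close>.\<close>

lemma locally_finite_dirs:
  assumes "z \<in> points"
  shows "\<exists>r>0. finite (dirs ` {y \<in> points. near n y z r})"
  using assms
proof (induction "n - rank n (dirs z)" arbitrary: z rule: less_induct)
  case less
  note zp = less.prems
  let ?L = "dirs z"
  note sL = subspace_inv_space[of "{..<n}" z]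
  obtain I w where w: "basis_of n ?L I w" using basis_exists[OF sL dirs_points] by blast
  then have I: "I \<subseteq> {..<n}" and ech: "echelon n ?L I w" by (auto simp: basis_of_def echelon_def)
  \<comment> \<open>Fixing the pivot coordinates gives an affine space that meets
    \<open>z + dirs z\<close> only in \<open>z\<close>.\<close>
  define S where "S = {y \<in> points. \<forall>i\<in>I. y i = z i}"
  have zS: "z \<in> S" using zp by (simp add: S_def)
  obtain r1 where r1: "0 < r1" "\<forall>y\<in>points. near n y z r1 \<longrightarrow> ?L \<subseteq> dirs y"
    using inv_space_near_mono by blast
  obtain r2 where r2: "0 < r2" "\<forall>y\<in>points. near n y z r2 \<longrightarrow> dirs y = ?L \<longrightarrow> y - z \<in> ?L"
    using same_dirs_isolated[OF zp] by blast
  obtain r3 where r3: "0 < r3" "\<forall>y\<in>points. near n y z r3 \<longrightarrow> dirs (z + (1/2) *\<^sub>R (y - z)) = dirs y"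
    using half_dirs[OF zp] by blast
  obtain r4 where r4: "0 < r4" "\<forall>y\<in>points. near n y z r4 \<longrightarrow> (\<forall>v\<in>?L. near n v 0 r4 \<longrightarrow> germ y (y + v))"
    using germ_uniform[OF zp] by blast
  define \<rho> where "\<rho> = min (min r1 r2) r3 / 2"
  have \<rho>: "0 < \<rho>" "\<rho> < r1" "\<rho> < r2" "\<rho> < r3" using r1 r2 r3 by (auto simp: \<rho>_def)
  \<comment> \<open>Equal spaces would put \<open>y - z\<close> into \<open>dirs z\<close>; but it
    vanishes at all pivots, so it would be 0.\<close>
  have larger: "?L \<subset> dirs y" if y: "y \<in> S" "near n y z r1" "near n y z r2" "y \<noteq> z" for y
  proof -
    have yp: "y \<in> points" using y by (simp add: S_def)
    have "dirs y \<noteq> ?L"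
    proof
      assume "dirs y = ?L"
      then have "y - z \<in> ?L" using r2 yp y by blast
      then have "y - z = (\<Sum>i\<in>I. (y - z) i *\<^sub>R w i)" using w by (auto simp: basis_of_def)
      also have "\<dots> = 0" by (rule sum.neutral) (use y(1) in \<open>auto simp: S_def\<close>)
      finally show False using y(4) by (metis eq_iff_diff_eq_0)
    qed
    then show ?thesis using r1 yp y by blast
  qed
  define A where "A = {y \<in> S. (\<exists>i<n. \<rho> / 2 \<le> \<bar>y i - z i\<bar>) \<and> (\<forall>i<n. \<bar>y i - z i\<bar> \<le> \<rho>)}"
  have finA: "finite (dirs ` A)"
  proof (rule locally_finite_dirs_compact)
    show "A \<subseteq> points" by (auto simp: A_def S_def)
    show "\<bar>y i\<bar> \<le> \<rho> + (\<Sum>i<n. \<bar>z i\<bar>)" if "y \<in> A" "i < n" for y i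
    proof -
      have "\<bar>y i - z i\<bar> \<le> \<rho>" using that by (auto simp: A_def)
      then show ?thesis using abs_le_absum[OF that(2), of z] unfolding absum_def by linarith
    qed
    fix f l assume f: "\<And>k. f k \<in> A" and lp: "l \<in> points" and lim: "\<forall>i<n. (\<lambda>k. f k i) \<longlonglongrightarrow> l i"
    have "l i = z i" if "i \<in> I" for i
    proof -
      have "f k i = z i" for k using f[of k] that by (simp add: A_def S_def)
      then have "(\<lambda>k. z i) \<longlonglongrightarrow> l i" using lim that I by auto
      then show ?thesis by (simp add: LIMSEQ_const_iff)
    qed
    then have "l \<in> S" using lp by (simp add: S_def)
    moreover have "\<bar>l i - z i\<bar> \<le> \<rho>" if "i < n" for i
    proof (rule LIMSEQ_le_const2)
      show "(\<lambda>k. \<bar>f k i - z i\<bar>) \<longlonglongrightarrow> \<bar>l i - z i\<bar>" using lim that by (intro tendsto_intros) auto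
      show "\<exists>N. \<forall>k\<ge>N. \<bar>f k i - z i\<bar> \<le> \<rho>" using f that by (auto simp: A_def)
    qed
    moreover have "\<exists>i<n. \<rho> / 2 \<le> \<bar>l i - z i\<bar>"
    proof (rule ccontr)
      assume "\<not> (\<exists>i<n. \<rho> / 2 \<le> \<bar>l i - z i\<bar>)"
      then have a: "\<forall>i\<in>{..<n}. \<bar>l i - z i\<bar> < \<rho> / 2" by auto
      have "\<forall>i\<in>{..<n}. \<forall>\<^sub>F k in sequentially. \<bar>f k i - z i\<bar> < \<rho> / 2"
      proof
        fix i assume i: "i \<in> {..<n}"
        have "(\<lambda>k. \<bar>f k i - z i\<bar>) \<longlonglongrightarrow> \<bar>l i - z i\<bar>" using lim i by (intro tendsto_intros) auto
        then show "\<forall>\<^sub>F k in sequentially. \<bar>f k i - z i\<bar> < \<rho> / 2"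
          by (rule order_tendstoD(2)) (use a i in auto)
      qed
      then have "\<forall>\<^sub>F k in sequentially. \<forall>i\<in>{..<n}. \<bar>f k i - z i\<bar> < \<rho> / 2"
        by (intro eventually_ball_finite) auto
      then obtain k where "\<forall>i\<in>{..<n}. \<bar>f k i - z i\<bar> < \<rho> / 2" using eventually_happens by fastforce
      then show False using f[of k] by (force simp: A_def)
    qed
    ultimately show "l \<in> A" by (auto simp: A_def)
  next
    fix y assume y: "y \<in> A"
    then have yS: "y \<in> S" and yp: "y \<in> points" by (auto simp: A_def S_def)
    have "near n y z r1" "near n y z r2" using y \<rho> by (auto simp: A_def near_def intro: le_less_trans)
    moreover have "y \<noteq> z" using y \<rho> by (auto simp: A_def)
    ultimately have "?L \<subset> dirs y" using larger yS by blast
    then have "rank n ?L < rank n (dirs y)"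
      using rank_strict[OF sL subspace_inv_space dirs_points] by blast
    moreover have "rank n (dirs y) \<le> n" by (rule rank_le)
    ultimately have "n - rank n (dirs y) < n - rank n ?L" by linarith
    then show "\<exists>r>0. finite (dirs ` {q \<in> points. near n q y r})" using less.hyps yp by blast
  qed
  have dbl: "dirs y \<in> insert ?L (dirs ` A)" if y: "y \<in> S" "near n y z \<rho>" for y
  proof (cases "y = z")
    case False
    have yp: "y \<in> points" using y by (simp add: S_def)
    define D where "D = Max ((\<lambda>i. \<bar>y i - z i\<bar>) ` {..<n})"
    obtain i where "y i \<noteq> z i" using False by auto
    then have i: "i < n" "y i \<noteq> z i" using yp zp by (auto simp: supp_in_def) (metis not_less)
    have Dge: "\<bar>y i - z i\<bar> \<le> D" if "i < n" for i unfolding D_def by (rule Max_ge) (use that in auto)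
    have "D \<in> (\<lambda>i. \<bar>y i - z i\<bar>) ` {..<n}" unfolding D_def by (rule Max_in) (use i in auto)
    then obtain j where j: "j < n" "D = \<bar>y j - z j\<bar>" by auto
    have D: "0 < D" using Dge[OF i(1)] i(2) by linarith
    have D\<rho>: "D < \<rho>" using j y(2) by (simp add: near_def)
    \<comment> \<open>The least number of doublings that brings the distance to at least
      \<open>\<rho> / 2\<close> keeps it below \<open>\<rho>\<close>, so the doubled point lands in
      the shell.\<close>
    have "\<exists>k. \<rho> / 2 \<le> 2 ^ k * D"
    proof -
      obtain k where "(\<rho> / 2) / D < 2 ^ k" using real_arch_pow[of 2] by auto
      then show ?thesis using D by (intro exI[of _ k]) (simp add: divide_less_eq)
    qed
    then obtain k where k: "\<rho> / 2 \<le> 2 ^ k * D" "\<forall>m<k. \<not> \<rho> / 2 \<le> 2 ^ m * D"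
      using exists_least_iff[of "\<lambda>k. \<rho> / 2 \<le> 2 ^ k * D"] by blast
    have k\<rho>: "2 ^ k * D < \<rho>"
    proof (cases k)
      case (Suc m)
      then have "2 ^ m * D < \<rho> / 2" using k(2) by force
      then show ?thesis using Suc by simp
    qed (use D\<rho> in simp)
    define Y where "Y m = z + (2 ^ m) *\<^sub>R (y - z)" for m :: nat
    have Yp: "Y m \<in> points" for m unfolding Y_def using yp zp by (intro supp_in_add supp_in_scale supp_in_diff)
    have Yd: "\<bar>Y m i - z i\<bar> = 2 ^ m * \<bar>y i - z i\<bar>" for m i by (simp add: Y_def abs_mult)
    have "dirs (Y m) = dirs y" if "m \<le> k" for m
      using that
    proof (induction m)
      case 0
      then show ?case by (simp add: Y_def)
    next
      case (Suc m)
      have "near n (Y (Suc m)) z r3"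
        unfolding near_def Yd
      proof (intro allI impI)
        fix i assume "i < n"
        then have "2 ^ Suc m * \<bar>y i - z i\<bar> \<le> 2 ^ k * D"
          using Suc.prems by (intro mult_mono Dge power_increasing) auto
        then show "2 ^ Suc m * \<bar>y i - z i\<bar> < r3" using k\<rho> \<rho> by linarith
      qed
      then have "dirs (z + (1/2) *\<^sub>R (Y (Suc m) - z)) = dirs (Y (Suc m))" using r3(2) Yp by blast
      moreover have "z + (1/2) *\<^sub>R (Y (Suc m) - z) = Y m" by (simp add: Y_def)
      ultimately show ?case using Suc by simp
    qed
    moreover have "Y k \<in> A"
    proof -
      have "Y k \<in> S" using Yp y(1) by (simp add: S_def Y_def)
      moreover have "\<rho> / 2 \<le> \<bar>Y k j - z j\<bar>" using k(1) j Yd by simp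
      moreover have "\<bar>Y k i - z i\<bar> \<le> \<rho>" if "i < n" for i
      proof -
        have "2 ^ k * \<bar>y i - z i\<bar> \<le> 2 ^ k * D" using Dge[OF that] by simp
        then show ?thesis unfolding Yd using k\<rho> by linarith
      qed
      ultimately show ?thesis using j(1) unfolding A_def by blast
    qed
    ultimately show ?thesis by blast
  qed simp
  obtain d where d: "0 < d" "\<And>u. near n u 0 d \<Longrightarrow> near n (\<Sum>i\<in>I. u i *\<^sub>R w i) 0 (min r4 (\<rho>/2))"
    using near_combination[OF I, of "min r4 (\<rho>/2)" w] r4(1) \<rho>(1) by auto
  have "dirs y \<in> insert ?L (dirs ` A)" if y: "y \<in> points" "near n y z (min (min d r4) (\<rho>/2))" for y
  proof -
    \<comment> \<open>The vector of \<open>dirs z\<close> with the pivot coordinates of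
      \<open>y - z\<close>. Subtracting it moves \<open>y\<close> into the slice without changing
      the germ.\<close>
    define s where "s = (\<Sum>i\<in>I. (y - z) i *\<^sub>R w i)"
    have sL': "s \<in> ?L" unfolding s_def
      using ech sL by (intro subspace_sum subspace_scale) (auto simp: echelon_def)
    have "near n (y - z) 0 d" using near_mono[OF y(2), of d] by (simp add: near_def)
    from d(2)[OF this] have ns: "near n s 0 (min r4 (\<rho>/2))" by (simp only: s_def)
    have ns4: "near n (- s) 0 r4" and ns2: "near n (- s) 0 (\<rho>/2)"
      using near_mono[OF ns, of r4] near_mono[OF ns, of "\<rho>/2"] by (auto simp: near_def)
    have ms: "- s \<in> ?L" using sL sL' by (rule subspace_neg)
    have y4: "near n y z r4" and y2: "near n y z (\<rho>/2)" by (rule near_mono[OF y(2)]; simp)+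
    have g: "germ y (y + (- s))" using r4(2) y(1) y4 ms ns4 by blast
    have yp': "y + (- s) \<in> points" using y ms dirs_points by (blast intro: supp_in_add)
    have "s i = y i - z i" if i: "i \<in> I" for i
    proof -
      have "s i = (\<Sum>j\<in>I. if i = j then (y - z) j else 0)"
        unfolding s_def sum_fun_apply using ech i by (intro sum.cong) (auto simp: echelon_def)
      then show ?thesis using basis_finite[OF w] i by simp
    qed
    then have "y + (- s) \<in> S" using yp' by (simp add: S_def)
    moreover have "near n (y + (- s)) y (\<rho>/2)" using ns2 by (simp only: near_add_left)
    then have "near n (y + (- s)) z \<rho>" by (rule near_trans'[OF _ y2]) simp
    ultimately have "dirs (y + (- s)) \<in> insert ?L (dirs ` A)" by (rule dbl)
    then show ?thesis using germ_dirs[OF g y(1) yp'] by simp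
  qed
  then have "dirs ` {y \<in> points. near n y z (min (min d r4) (\<rho>/2))} \<subseteq> insert ?L (dirs ` A)" by blast
  then have "finite (dirs ` {y \<in> points. near n y z (min (min d r4) (\<rho>/2))})"
    using finA finite_subset by blast
  then show ?case using d r4 \<rho> by (intro exI[of _ "min (min d r4) (\<rho>/2)"]) auto
qed

text \<open>No compactness of the whole space is needed: every point shares its germ with points
  arbitrarily close to some apex, so the neighbourhoods of the finitely many apexes already show all
  direction spaces.\<close>

lemma finite_dirs: "finite (dirs ` points)"
proof -
  have "\<forall>p\<in>apex. \<exists>r>0. finite (dirs ` {y \<in> points. near n y p r})"
    using locally_finite_dirs apex_points by blast
  then obtain r where r: "\<And>p. p \<in> apex \<Longrightarrow> r p > 0 \<and> finite (dirs ` {y \<in> points. near n y p (r p)})" by metis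
  have "dirs ` points \<subseteq> (\<Union>p\<in>apex. dirs ` {y \<in> points. near n y p (r p)})"
  proof
    fix L assume "L \<in> dirs ` points"
    then obtain x where x: "x \<in> points" "L = dirs x" by blast
    obtain J p where q: "J \<subseteq> {..<n}" "p \<in> supp_in J" "inv_space J p = {0}"
      "\<forall>e>0. \<exists>y\<in>points. near n y p e \<and> x - y \<in> dirs x \<and> germ x y"
      using trace_to_singular[OF x(1)] by blast
    have p: "p \<in> apex" using q(1-3) unfolding apex_def by blast
    then obtain y where y: "y \<in> points" "near n y p (r p)" "germ x y" using q(4) r by blast
    have "dirs y = L" using germ_dirs[OF y(3) x(1) y(1)] x(2) by simp
    then show "L \<in> (\<Union>p\<in>apex. dirs ` {y \<in> points. near n y p (r p)})"
      using p y by blast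
  qed
  then show ?thesis using r finite_apex finite_subset by (metis (no_types, lifting) finite_UN_I)
qed

text \<open>With finitely many spaces and apexes, one ball around \<open>x\<close> meets only flats
  through \<open>x\<close>. A segment leaving \<open>x\<close> then runs inside the flat of each of
  its points, so \<open>X\<close> is constant on it away from \<open>x\<close>.\<close>

lemma conical:
  assumes x: "x \<in> points"
  shows "\<exists>r>0. \<forall>y\<in>points. near n y x r \<longrightarrow> (\<forall>t. 0 < t \<and> t \<le> 1 \<longrightarrow> X y = X (x + t *\<^sub>R (y - x)))"
proof -
  have "\<exists>e>0. \<forall>L\<in>dirs ` points. \<forall>p\<in>apex. \<forall>y. near n y x e \<longrightarrow> y - p \<in> L \<longrightarrow> x - p \<in> L"
  proof (rule finite_radius[OF finite_dirs])
    fix L assume "L \<in> dirs ` points"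
    then show "\<exists>e>0. \<forall>p\<in>apex. \<forall>y. near n y x e \<longrightarrow> y - p \<in> L \<longrightarrow> x - p \<in> L"
      using flats_near[OF _ _ x, of L] subspace_inv_space dirs_points by auto
  qed (use near_mono in blast)
  then obtain e where e: "e > 0" "\<And>L p y. L \<in> dirs ` points \<Longrightarrow> p \<in> apex \<Longrightarrow> near n y x e \<Longrightarrow> y - p \<in> L \<Longrightarrow> x - p \<in> L"
    by blast
  have "X y = X (x + t *\<^sub>R (y - x))" if y: "y \<in> points" "near n y x e" and t: "0 < t" "t \<le> 1" for y t
  proof -
    let ?y = "\<lambda>s. x + s *\<^sub>R (y - x)"
    have yp: "?y s \<in> points" for s using x y by (intro supp_in_add supp_in_scale supp_in_diff)
    \<comment> \<open>Both the point and \<open>x\<close> lie on the flat of the point, so their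
      difference, \<open>s\<close> times \<open>y - x\<close>, is a direction. This fails for
      \<open>s = 0\<close>, where the germ may change.\<close>
    have dir: "y - x \<in> dirs (?y s)" if s: "0 < s" "s \<le> 1" for s
    proof -
      obtain p where p: "p \<in> apex" "?y s - p \<in> dirs (?y s)" using flat_apex[OF yp] by blast
      have "near n (?y s) x e"
        by (rule near_convex) (use s e y in \<open>auto simp: near_refl\<close>)
      then have "x - p \<in> dirs (?y s)" using e(2)[of "dirs (?y s)" p "?y s"] p yp by blast
      from subspace_diff[OF subspace_inv_space p(2) this]
      have "s *\<^sub>R (y - x) \<in> dirs (?y s)" by simp
      from dirs_scale[OF this, of "1 / s"] show ?thesis using s by simp
    qed
    have "X (?y t) = X y"
    proof (rule segment_const[OF yp y(1)])
      fix s :: real assume s: "0 \<le> s" "s \<le> 1"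
      have eq2: "y - ?y t = (1 - t) *\<^sub>R (y - x)" by (simp add: algebra_simps)
      have eq: "?y t + s *\<^sub>R (y - ?y t) = ?y (t + s * (1 - t))"
        unfolding eq2 by (simp add: scaleR_add_left add.assoc)
      have "0 \<le> s * (1 - t)" "s * (1 - t) \<le> 1 * (1 - t)" using s t mult_right_mono[of s 1 "1 - t"] by auto
      then have "y - x \<in> dirs (?y (t + s * (1 - t)))" using t by (intro dir) auto
      from dirs_scale[OF this, of "1 - t"] show "y - ?y t \<in> dirs (?y t + s *\<^sub>R (y - ?y t))"
        unfolding eq unfolding eq2 .
    qed
    then show ?thesis by simp
  qed
  then show ?thesis using e(1) by blast
qed

end

section \<open>Sets determined by signs of affine functions\<close>

text \<open>Discreteness is demanded at every point of the space, not just at those of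
  \<open>A\<close>. This excludes limit points outside \<open>A\<close>, and Bolzano-Weierstrass
  does the rest.\<close>

lemma finite_iff_bounded_discrete:
  assumes A: "A \<subseteq> supp_in {..<n}"
  shows "finite A \<longleftrightarrow> (\<exists>R. \<forall>x\<in>A. near n x 0 R) \<and>
    (\<forall>z\<in>supp_in {..<n}. \<exists>e>0. \<forall>x\<in>A. x \<noteq> z \<longrightarrow> \<not> near n x z e)"
proof (intro iffI conjI ballI)
  assume fin: "finite A"
  show "\<exists>R. \<forall>x\<in>A. near n x 0 R"
  proof (intro exI ballI)
    fix x assume x: "x \<in> A"
    have "\<bar>x i\<bar> < 1 + (\<Sum>y\<in>A. absum n y)" if "i < n" for i
      using abs_le_absum[OF that, of x] member_le_sum[OF x _ fin, of "absum n"] absum_nonneg by force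
    then show "near n x 0 (1 + (\<Sum>y\<in>A. absum n y))" by (simp add: near_def)
  qed
  fix z assume z: "z \<in> supp_in {..<n}"
  show "\<exists>e>0. \<forall>x\<in>A. x \<noteq> z \<longrightarrow> \<not> near n x z e"
  proof (rule finite_radius[OF fin])
    fix x assume x: "x \<in> A"
    show "\<exists>e>0. x \<noteq> z \<longrightarrow> \<not> near n x z e"
    proof (cases "x = z")
      case False
      then obtain i where "x i \<noteq> z i" by auto
      moreover from this have "i < n" using A x z by (force simp: supp_in_def)
      ultimately show ?thesis by (intro exI[of _ "\<bar>x i - z i\<bar>"]) (auto simp: near_def)
    qed (auto intro: exI[of _ 1])
  qed (use near_mono in blast)
next
  assume a: "(\<exists>R. \<forall>x\<in>A. near n x 0 R) \<and>
    (\<forall>z\<in>supp_in {..<n}. \<exists>e>0. \<forall>x\<in>A. x \<noteq> z \<longrightarrow> \<not> near n x z e)"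
  then obtain R where R: "\<forall>x\<in>A. near n x 0 R" by blast
  show "finite A"
  proof (rule ccontr)
    assume "infinite A"
    then obtain f :: "nat \<Rightarrow> _" where f: "inj f" "range f \<subseteq> A" using infinite_countable_subset by blast
    have "near n (f k) 0 R" for k using f(2) R by blast
    then have "\<forall>k. \<forall>i<n. \<bar>f k i\<bar> \<le> R" by (auto simp: near_def less_imp_le)
    from convergent_subseq_coord[OF this]
    obtain \<sigma> l where l: "strict_mono (\<sigma> :: nat \<Rightarrow> nat)" "\<forall>i<n. (\<lambda>k. f (\<sigma> k) i) \<longlonglongrightarrow> l i"
      by blast
    define z where "z i = (if i < n then l i else 0)" for i
    have lim: "\<forall>i<n. (\<lambda>k. f (\<sigma> k) i) \<longlonglongrightarrow> z i" using l(2) by (simp add: z_def)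
    have "z \<in> supp_in {..<n}" by (simp add: z_def supp_in_def)
    then obtain e where e: "e > 0" "\<forall>x\<in>A. x \<noteq> z \<longrightarrow> \<not> near n x z e" using a by blast
    have "\<forall>\<^sub>F k in sequentially. near n (f (\<sigma> k)) z e"
      by (rule near_eventually[OF _ e(1)]) (use lim in simp)
    then obtain K where "\<And>k. K \<le> k \<Longrightarrow> near n (f (\<sigma> k)) z e"
      by (auto simp: eventually_sequentially)
    then have "f (\<sigma> k) = z" if "K \<le> k" for k using that e(2) f(2) by blast
    then have "f (\<sigma> K) = f (\<sigma> (Suc K))" by simp
    then have "\<sigma> K = \<sigma> (Suc K)" using f(1) by (simp add: inj_eq)
    then show False using l(1) by (simp add: strict_mono_eq)
  qed
qed

lemma linear_small:
  fixes g :: "(nat \<Rightarrow> real) \<Rightarrow> real"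
  assumes "linear g" "0 < e"
  shows "\<exists>d>0. \<forall>u\<in>supp_in {..<n}. near n u 0 d \<longrightarrow> \<bar>g u\<bar> < e"
proof -
  define E where "E i = (\<lambda>j. if j = i then 1 else 0 :: real)" for i :: nat
  define b where "b = 1 + (\<Sum>i<n. \<bar>g (E i)\<bar>)"
  have b: "1 \<le> b" by (simp add: b_def sum_nonneg)
  show ?thesis
  proof (intro exI[of _ "e / b"] conjI ballI impI)
    show eb: "0 < e / b" using assms b by simp
    fix u assume u: "u \<in> supp_in {..<n}" "near n u 0 (e / b)"
    have uj: "u j = (\<Sum>i<n. u i * E i j)" for j
    proof -
      have "(\<Sum>i<n. u i * E i j) = (\<Sum>i<n. if j = i then u i else 0)"
        by (rule sum.cong) (auto simp: E_def)
      then show ?thesis using u(1) by (auto simp: supp_in_def)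
    qed
    have ueq: "u = (\<Sum>i<n. u i *\<^sub>R E i)"
      by (rule ext, unfold sum_fun_apply scaleR_fun_apply real_scaleR_def) (rule uj)
    have "g (\<Sum>i<n. u i *\<^sub>R E i) = (\<Sum>i<n. u i * g (E i))"
      using assms(1) by (simp add: linear_sum linear_scale del: sum_fun_apply)
    then have "\<bar>g u\<bar> = \<bar>\<Sum>i<n. u i * g (E i)\<bar>" using ueq by metis
    also have "\<dots> \<le> (\<Sum>i<n. \<bar>u i\<bar> * \<bar>g (E i)\<bar>)"
      using sum_abs[of "\<lambda>i. u i * g (E i)" "{..<n}"] by (simp add: abs_mult)
    also have "\<dots> \<le> (\<Sum>i<n. e / b * \<bar>g (E i)\<bar>)"
      using u(2) by (intro sum_mono mult_right_mono) (auto simp: near_def less_imp_le)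
    also have "\<dots> = e / b * (b - 1)" by (simp add: b_def sum_distrib_left)
    also have "\<dots> < e / b * b" using eb by (intro mult_strict_left_mono) auto
    also have "\<dots> = e" using b by simp
    finally show "\<bar>g u\<bar> < e" .
  qed
qed

section \<open>Local structure of sets determined by the signs of finitely many affine
  functions\<close>

context relation
begin

context
  fixes H :: "(((nat \<Rightarrow> real) \<Rightarrow> real) \<times> real) set"
  assumes fin: "finite H" and lin: "\<And>g d. (g, d) \<in> H \<Longrightarrow> linear g"
    and det: "\<And>x y. x \<in> points \<Longrightarrow> y \<in> points \<Longrightarrow>
      (\<And>g d. (g, d) \<in> H \<Longrightarrow> sgn (g x + d) = sgn (g y + d)) \<Longrightarrow> X x = X y"
begin

lemma sgn_stable:
  assumes x: "x \<in> points"
  shows "\<exists>r>0. \<forall>y\<in>points. near n y x r \<longrightarrow>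
    (\<forall>g d. (g, d) \<in> H \<longrightarrow> g x + d \<noteq> 0 \<longrightarrow> sgn (g y + d) = sgn (g x + d))"
proof -
  have "\<exists>r>0. \<forall>h\<in>H. \<forall>y\<in>points. near n y x r \<longrightarrow> fst h x + snd h \<noteq> 0 \<longrightarrow>
      sgn (fst h y + snd h) = sgn (fst h x + snd h)"
  proof (rule finite_radius[OF fin])
    fix h assume h: "h \<in> H"
    obtain g d where hd: "h = (g, d)" by (cases h)
    have l: "linear g" using lin h hd by simp
    show "\<exists>r>0. \<forall>y\<in>points. near n y x r \<longrightarrow> fst h x + snd h \<noteq> 0 \<longrightarrow>
      sgn (fst h y + snd h) = sgn (fst h x + snd h)"
    proof (cases "g x + d = 0")
      case False
      then obtain r where r: "r > 0" "\<forall>u\<in>points. near n u 0 r \<longrightarrow> \<bar>g u\<bar> < \<bar>g x + d\<bar>"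
        using linear_small[OF l, of "\<bar>g x + d\<bar>" n] by auto
      have "sgn (g y + d) = sgn (g x + d)" if y: "y \<in> points" "near n y x r" for y
      proof -
        have "y - x \<in> points" "near n (y - x) 0 r" using x y by (auto simp: near_def intro: supp_in_diff)
        then have "\<bar>g (y - x)\<bar> < \<bar>g x + d\<bar>" using r by blast
        moreover have "g (y - x) = g y - g x" using l by (rule linear_diff)
        ultimately show ?thesis by (auto simp: sgn_if split: if_splits)
      qed
      then show ?thesis using r(1) hd by auto
    qed (auto simp: hd intro: exI[of _ 1])
  qed (use near_mono in blast)
  then show ?thesis by (metis fst_conv snd_conv)
qed

text \<open>An affine function vanishing at \<open>x\<close> is multiplied by \<open>t > 0\<close>
  under the homothety, and any other one keeps its sign near \<open>x\<close>.\<close>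

lemma sgn_det_conical:
  assumes x: "x \<in> points"
  shows "\<exists>r>0. \<forall>y\<in>points. near n y x r \<longrightarrow> (\<forall>t. 0 < t \<and> t \<le> 1 \<longrightarrow> X y = X (x + t *\<^sub>R (y - x)))"
proof -
  obtain r where r: "r > 0" "\<And>y g d. y \<in> points \<Longrightarrow> near n y x r \<Longrightarrow> (g, d) \<in> H \<Longrightarrow>
    g x + d \<noteq> 0 \<Longrightarrow> sgn (g y + d) = sgn (g x + d)" using sgn_stable[OF x] by blast
  have "X y = X (x + t *\<^sub>R (y - x))" if y: "y \<in> points" "near n y x r" and t: "0 < t" "t \<le> 1" for y t
  proof (rule det[OF y(1)])
    show p: "x + t *\<^sub>R (y - x) \<in> points" using x y by (intro supp_in_add supp_in_scale supp_in_diff)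
    fix g d assume h: "(g, d) \<in> H"
    show "sgn (g y + d) = sgn (g (x + t *\<^sub>R (y - x)) + d)"
    proof (cases "g x + d = 0")
      case True
      have "g (x + t *\<^sub>R (y - x)) = g x + t * (g y - g x)"
        using lin[OF h] by (simp add: linear_add linear_scale linear_diff)
      moreover have "d = - g x" using True by simp
      ultimately have "g (x + t *\<^sub>R (y - x)) + d = t * (g y + d)"
        by (simp only:) (simp add: algebra_simps)
      then show ?thesis using t by (simp add: sgn_mult)
    next
      case False
      have "near n (x + t *\<^sub>R (y - x)) x r"
        by (rule near_convex) (use t r y in \<open>auto simp: near_refl\<close>)
      then show ?thesis using r(2)[OF _ _ h False] y p by simp
    qed
  qed
  then show ?thesis using r(1) by blast
qed

lemma sgn_det_halving:
  "z \<in> points \<Longrightarrow> \<exists>r>0. \<forall>y\<in>points. near n y z r \<longrightarrow> X y = X (z + (1/2) *\<^sub>R (y - z))"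
proof -
  assume "z \<in> points"
  then obtain r where "r > 0"
    "\<And>y t. y \<in> points \<Longrightarrow> near n y z r \<Longrightarrow> 0 < t \<and> t \<le> 1 \<Longrightarrow> X y = X (z + t *\<^sub>R (y - z))"
    using sgn_det_conical[of z] by blast
  then show ?thesis by (intro exI[of _ r]) simp
qed

text \<open>The converse of \<open>nonsing_imp_inv\<close>. By \<open>conical_inv\<close> the small
  single-vector invariances are exactly the small vectors of \<open>inv_space J x\<close>, and a
  subspace is closed.\<close>

lemma sgn_det_nonsing:
  assumes J: "J \<subseteq> {..<n}" and x: "x \<in> supp_in J" and v: "v \<in> inv_space J x" "v \<noteq> 0"
  shows "nonsing J x"
proof -
  have xp: "x \<in> points" using x supp_in_mono[OF J] by blast
  obtain \<rho> where \<rho>: "\<rho> > 0" "\<forall>y\<in>points. near n y x \<rho> \<longrightarrow> (\<forall>t. 0 < t \<and> t \<le> 1 \<longrightarrow> X y = X (x + t *\<^sub>R (y - x)))"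
    using sgn_det_conical[OF xp] by blast
  obtain q where q: "q > 0" "\<forall>y\<in>supp_in J. near n y x q \<longrightarrow> (\<forall>v\<in>inv_space J x. near n v 0 q \<longrightarrow> X y = X (y + v))"
    using uniform_radius[OF J] by blast
  define r where "r = min \<rho> q"
  have r: "0 < r" "r \<le> \<rho>" "r \<le> q" using \<rho> q by (auto simp: r_def)
  \<comment> \<open>Invariance on the ball of radius \<open>r\<close> acts on base points within
    \<open>r/2\<close>, since a shift shorter than \<open>r/2\<close> does not leave the
    ball.\<close>
  have inv1: "u \<in> inv_space J x" if u: "u \<in> supp_in J" "near n u 0 (r/2)" "inv_by J x r u" for u
  proof (rule conical_inv[OF J x u(1), of \<rho> "r/2" "r/2"])
    fix y t assume "y \<in> supp_in J" "near n y x \<rho>" "0 < t" "t \<le> (1::real)"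
    then show "X y = X (x + t *\<^sub>R (y - x))" using \<rho>(2) supp_in_mono[OF J] by blast
  next
    fix y assume y: "y \<in> supp_in J" "near n y x (r/2)"
    have "near n (y + u) y (r/2)" using u(2) by (simp only: near_add_left)
    then have "near n (y + u) x r" by (rule near_trans'[OF _ y(2)]) simp
    moreover have "near n y x r" by (rule near_mono[OF y(2)]) (use r in simp)
    ultimately show "X y = X (y + u)" using u(3) y(1) unfolding inv_by_def by blast
  qed (use r u in auto)
  have inv2: "inv_by J x r u" if u: "u \<in> inv_space J x" "near n u 0 r" for u
    unfolding inv_by_def using q(2) near_mono[OF _ r(3)] u by blast
  show ?thesis unfolding nonsing_def
  \<comment> \<open>The second radius is \<open>r/4\<close>: a vector within \<open>r/4\<close> of
    such a \<open>w\<close> is shorter than \<open>r/2\<close>, so \<open>inv1\<close> applies to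
    it.\<close>
  proof (rule exI[of _ r], intro conjI, rule r(1), rule exI[of _ "r/4"], intro conjI allI impI ballI)
    fix e :: real assume e: "0 < e"
    obtain d where d: "0 < d" "\<And>t. \<bar>t\<bar> < d \<Longrightarrow> near n (t *\<^sub>R v) 0 (min e r)"
      using near_scale_ex[of "min e r" n v] r e by auto
    have nn: "near n ((d/2) *\<^sub>R v) 0 (min e r)" using d by simp
    have "near n ((d/2) *\<^sub>R v) 0 e" "near n ((d/2) *\<^sub>R v) 0 r" by (rule near_mono[OF nn]; simp)+
    moreover have m: "(d/2) *\<^sub>R v \<in> inv_space J x" using subspace_inv_space v by (intro subspace_scale)
    moreover have "(d/2) *\<^sub>R v \<noteq> 0" using v(2) d(1) by (metis divide_eq_0_iff less_irrefl scaleR_eq_0_iff zero_neq_numeral)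
    ultimately show "\<exists>u\<in>supp_in J. u \<noteq> 0 \<and> near n u 0 e \<and> inv_by J x r u"
      using inv2 inv_space_supp by blast
  next
    fix w assume w: "w \<in> supp_in J" and nw: "near n w 0 (r/4) \<and> \<not> inv_by J x r w"
    have "near n w 0 r" using nw near_mono[of n w 0 "r/4" r] r by simp
    then have "w \<notin> inv_space J x" using inv2 nw by blast
    moreover have "inv_space J x \<subseteq> points" "w \<in> points" using inv_space_supp supp_in_mono[OF J] w by blast+
    ultimately obtain e where e: "e > 0" "\<forall>y\<in>inv_space J x. \<not> near n y w e"
      using subspace_complement_open[OF subspace_inv_space] by blast
    show "\<exists>e>0. \<forall>u\<in>supp_in J. near n u w e \<longrightarrow> \<not> inv_by J x r u"
    proof (intro exI[of _ "min e (r/4)"] conjI ballI impI notI)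
      fix u assume u: "u \<in> supp_in J" "near n u w (min e (r/4))" "inv_by J x r u"
      have "near n u w (r/4)" "near n u w e" by (rule near_mono[OF u(2)]; simp)+
      moreover from this have "near n u 0 (r/2)" using nw near_trans'[of n u w "r/4" 0 "r/4" "r/2"] by simp
      ultimately show False using inv1 u e by blast
    qed (use e r in auto)
  qed (use r in auto)
qed

text \<open>A singular point is determined by the set of functions vanishing at it: if
  \<open>x\<close> and \<open>x'\<close> have the same set, all these functions are constant along
  \<open>x' - x\<close>, which is then a direction at \<open>x\<close> and so 0.\<close>

lemma sgn_det_finite_sing:
  assumes J: "J \<subseteq> {..<n}"
  shows "finite (sing J)"
proof (rule inj_on_finite)
  show "(\<lambda>x. {h \<in> H. fst h x + snd h = 0}) ` sing J \<subseteq> Pow H" by auto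
  show "finite (Pow H)" using fin by simp
  show "inj_on (\<lambda>x. {h \<in> H. fst h x + snd h = 0}) (sing J)"
  proof (rule inj_onI)
    fix x x' assume x: "x \<in> sing J" and x': "x' \<in> sing J"
      and eq: "{h \<in> H. fst h x + snd h = 0} = {h \<in> H. fst h x' + snd h = 0}"
    let ?v = "x' - x"
    have xJ: "x \<in> supp_in J" "x' \<in> supp_in J" using x x' by (auto simp: sing_def)
    then have xp: "x \<in> points" "x' \<in> points" using supp_in_mono[OF J] by blast+
    have vJ: "?v \<in> supp_in J" using xJ by (intro supp_in_diff)
    obtain r where r: "r > 0" "\<And>y g d. y \<in> points \<Longrightarrow> near n y x r \<Longrightarrow> (g, d) \<in> H \<Longrightarrow>
      g x + d \<noteq> 0 \<Longrightarrow> sgn (g y + d) = sgn (g x + d)" using sgn_stable[OF xp(1)] by blast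
    obtain d where d: "0 < d" "\<And>t. \<bar>t\<bar> < d \<Longrightarrow> near n (t *\<^sub>R ?v) 0 (r/2)"
      using near_scale_ex[of "r/2" n ?v] r by auto
    have "?v \<in> inv_space J x"
    proof (rule inv_spaceI[OF vJ, of "min (r/2) d"])
      fix y t assume y: "y \<in> supp_in J" "near n y x (min (r/2) d)" "\<bar>t\<bar> < min (r/2) d"
      have yp: "y \<in> points" "y + t *\<^sub>R ?v \<in> points"
        using y vJ supp_in_mono[OF J] by (auto intro!: supp_in_add supp_in_scale)
      have y2: "near n y x (r/2)" by (rule near_mono[OF y(2)]) simp
      have y1: "near n y x r" by (rule near_mono[OF y2]) (use r in simp)
      have "near n (y + t *\<^sub>R ?v) y (r/2)" using d(2)[of t] y(3) by simp
      then have y3: "near n (y + t *\<^sub>R ?v) x r" by (rule near_trans'[OF _ y2]) simp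
      show "X y = X (y + t *\<^sub>R ?v)"
      proof (rule det[OF yp])
        fix g d assume h: "(g, d) \<in> H"
        show "sgn (g y + d) = sgn (g (y + t *\<^sub>R ?v) + d)"
        proof (cases "g x + d = 0")
          case True
          then have "(g, d) \<in> {h \<in> H. fst h x + snd h = 0}" using h by simp
          then have "(g, d) \<in> {h \<in> H. fst h x' + snd h = 0}" unfolding eq .
          then have "g x' = g x" using True by simp
          then show ?thesis using lin[OF h] by (simp add: linear_add linear_scale linear_diff)
        next
          case False
          then show ?thesis using r(2)[OF _ _ h] yp y1 y3 by simp
        qed
      qed
    qed (use r d in simp)
    then have "?v = 0" using sgn_det_nonsing[OF J xJ(1), of ?v] x unfolding sing_def by blast
    then show "x = x'" by simp
  qed
qed

end

end

section \<open>Expansions and valuations\<close>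

lemma expansion_real_add:
  assumes "expansion M real_add"
  shows "fun_ar M 0 = Some 2" "fun_ar M (Suc 0) = Some 0" "rel_ar M 0 = Some 2"
    "fun_int M 0 [a, b] = a + b" "fun_int M (Suc 0) [] = 1" "rel_int M 0 [a, b] \<longleftrightarrow> a < b"
proof -
  have f: "fun_ar real_add \<subseteq>\<^sub>m fun_ar M" "rel_ar real_add \<subseteq>\<^sub>m rel_ar M"
    and i: "\<And>f xs. fun_ar real_add f = Some (length xs) \<Longrightarrow> fun_int M f xs = fun_int real_add f xs"
      "\<And>r xs. rel_ar real_add r = Some (length xs) \<Longrightarrow> rel_int M r xs = rel_int real_add r xs"
    using assms by (auto simp: expansion_def)
  show "fun_ar M 0 = Some 2" "fun_ar M (Suc 0) = Some 0"
    using f(1) unfolding map_le_def by (force simp: real_add_def)+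
  show "rel_ar M 0 = Some 2"
    using f(2) unfolding map_le_def by (force simp: real_add_def)
  show "fun_int M 0 [a, b] = a + b" "fun_int M (Suc 0) [] = 1" "rel_int M 0 [a, b] \<longleftrightarrow> a < b"
    using i(1)[of 0 "[a, b]"] i(1)[of "Suc 0" "[]"] i(2)[of 0 "[a, b]"] by (simp_all add: real_add_def)
qed

lemma expansion_refl: "expansion M M"
  by (simp add: expansion_def)

lemma tm_val_cong: "(\<And>i. i \<in> fv_tm t \<Longrightarrow> v i = v' i) \<Longrightarrow> tm_val M v t = tm_val M v' t"
proof (induction t)
  case (Fun f ts)
  then have "map (tm_val M v) ts = map (tm_val M v') ts" by auto
  then show ?case by (simp only: tm_val.simps)
qed simp

lemma sat_cong: "(\<And>i. i \<in> fv p \<Longrightarrow> v i = v' i) \<Longrightarrow> sat M v p = sat M v' p"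
proof (induction p arbitrary: v v')
  case (Eq s t)
  then show ?case using tm_val_cong[of s v v' M] tm_val_cong[of t v v' M] by simp
next
  case (Rel r ts)
  have "tm_val M v t = tm_val M v' t" if "t \<in> set ts" for t
    by (rule tm_val_cong, rule Rel) (use that in auto)
  then have "map (tm_val M v) ts = map (tm_val M v') ts" by simp
  then show ?case by (simp only: sat.simps)
next
  case (Conj p q)
  have "sat M v p = sat M v' p" by (rule Conj.IH, rule Conj.prems) simp
  moreover have "sat M v q = sat M v' q" by (rule Conj.IH, rule Conj.prems) simp
  ultimately show ?case by simp
next
  case (Exi i p)
  have "sat M (v(i := a)) p = sat M (v'(i := a)) p" for a
    by (rule Exi.IH) (use Exi.prems in auto)
  then show ?case by simp
next
  case (Neg p)
  have "sat M v p = sat M v' p" by (rule Neg.IH, rule Neg.prems) simp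
  then show ?case by simp
qed

section \<open>Quantifier elimination for real addition\<close>

text \<open>The order has no endpoints and is dense, so the position of \<open>a\<close> among
  finitely many thresholds can be copied to any thresholds in the same order.\<close>

lemma same_position:
  fixes r r' :: "'a \<Rightarrow> real"
  assumes fin: "finite A" and ord: "\<And>i k. i \<in> A \<Longrightarrow> k \<in> A \<Longrightarrow> sgn (r i - r k) = sgn (r' i - r' k)"
  shows "\<exists>a'. \<forall>i\<in>A. sgn (a - r i) = sgn (a' - r' i)"
proof (cases "\<exists>k\<in>A. a = r k")
  case True
  then show ?thesis using ord by blast
next
  case False
  have lt: "r i < r k \<longleftrightarrow> r' i < r' k" if "i \<in> A" "k \<in> A" for i k
    using ord[OF that] by (auto simp: sgn_if split: if_splits)
  define Lo where "Lo = r' ` {i \<in> A. r i < a}"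
  define Up where "Up = r' ` {i \<in> A. a < r i}"
  have f: "finite Lo" "finite Up" using fin by (auto simp: Lo_def Up_def)
  have sep: "x < y" if "x \<in> Lo" "y \<in> Up" for x y
    using that lt by (fastforce simp: Lo_def Up_def)
  have "\<exists>a'. (\<forall>x\<in>Lo. x < a') \<and> (\<forall>y\<in>Up. a' < y)"
  proof (cases "Lo = {}")
    case True
    show ?thesis
    proof (cases "Up = {}")
      case False
      have "Min Up - 1 < y" if "y \<in> Up" for y using Min_le[OF f(2) that] by simp
      then show ?thesis using True by blast
    qed (use True in auto)
  next
    case L: False
    show ?thesis
    proof (cases "Up = {}")
      case True
      have "x < Max Lo + 1" if "x \<in> Lo" for x using Max_ge[OF f(1) that] by simp
      then show ?thesis using True by blast
    next
      case False
      have "Max Lo < Min Up" using sep Max_in[OF f(1) L] Min_in[OF f(2) False] by blast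
      then obtain c where c: "Max Lo < c" "c < Min Up" using dense by blast
      have "x < c" if "x \<in> Lo" for x using Max_ge[OF f(1) that] c by simp
      moreover have "c < y" if "y \<in> Up" for y using Min_le[OF f(2) that] c by simp
      ultimately show ?thesis by blast
    qed
  qed
  then obtain a' where a': "\<And>x. x \<in> Lo \<Longrightarrow> x < a'" "\<And>y. y \<in> Up \<Longrightarrow> a' < y" by blast
  have "sgn (a - r i) = sgn (a' - r' i)" if "i \<in> A" for i
  proof (cases "r i < a")
    case True
    then have "r' i < a'" using that by (intro a') (auto simp: Lo_def)
    then show ?thesis using True by (simp add: sgn_if)
  next
    case F: False
    then have "a < r i" using False that by force
    then have "a' < r' i" using that by (intro a') (auto simp: Up_def)
    then show ?thesis using \<open>a < r i\<close> by (simp add: sgn_if)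
  qed
  then show ?thesis by blast
qed

text \<open>A semantic stand-in for quantifier-free formulas: truth depends only on the signs of
  finitely many affine functions. Their coefficients may be arbitrary reals, because only the shape
  of the set is used.\<close>

definition sgn_det_by :: "(((nat \<Rightarrow> real) \<Rightarrow> real) \<times> real) set \<Rightarrow> ((nat \<Rightarrow> real) \<Rightarrow> bool) \<Rightarrow> bool" where
  "sgn_det_by H D \<longleftrightarrow> finite H \<and> (\<forall>h\<in>H. linear (fst h)) \<and>
     (\<forall>v v'. (\<forall>h\<in>H. sgn (fst h v + snd h) = sgn (fst h v' + snd h)) \<longrightarrow> D v = D v')"

definition sgn_determined :: "((nat \<Rightarrow> real) \<Rightarrow> bool) \<Rightarrow> bool" where
  "sgn_determined D \<longleftrightarrow> (\<exists>H. sgn_det_by H D)"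

lemma sgn_det_byI:
  assumes "finite H" "\<And>h. h \<in> H \<Longrightarrow> linear (fst h)"
    "\<And>v v'. (\<And>h. h \<in> H \<Longrightarrow> sgn (fst h v + snd h) = sgn (fst h v' + snd h)) \<Longrightarrow> D v = D v'"
  shows "sgn_det_by H D"
  using assms unfolding sgn_det_by_def by blast

lemma sgn_det_byD:
  assumes "sgn_det_by H D"
  shows "finite H" "h \<in> H \<Longrightarrow> linear (fst h)"
    "(\<And>h. h \<in> H \<Longrightarrow> sgn (fst h v + snd h) = sgn (fst h v' + snd h)) \<Longrightarrow> D v = D v'"
  using assms unfolding sgn_det_by_def by blast+

lemma linear_coord: "linear (\<lambda>v :: nat \<Rightarrow> real. v i)"
  by (rule linearI) simp_all

text \<open>Fourier-Motzkin elimination. The functions that involve the variable \<open>j\<close>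
  have roots in that variable, and the order of these roots, which is a matter of signs of their
  differences, decides which positions the witness can take.\<close>

lemma sgn_determined_ex:
  assumes "sgn_determined D"
  shows "sgn_determined (\<lambda>v. \<exists>a. D (v(j := a)))"
proof -
  obtain H where "sgn_det_by H D" using assms unfolding sgn_determined_def by (rule exE)
  note H = sgn_det_byD[OF this]
  \<comment> \<open>\<open>c g\<close> is the coefficient of variable \<open>j\<close>, and
    \<open>\<rho> h v\<close> is the value of that variable at which \<open>h\<close> vanishes, the
    other variables being those of \<open>v\<close>.\<close>
  define c where "c g = g (\<lambda>i. if i = j then 1 else 0)" for g :: "(nat \<Rightarrow> real) \<Rightarrow> real"
  define \<rho> where "\<rho> h v = v j - (fst h v + snd h) / c (fst h)" for h v
  \<comment> \<open>The difference of two roots as a pair of linear part and constant. Both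
    occurrences of \<open>v j\<close> cancel; they keep the linear part a difference of two visibly
    linear maps. A coefficient 0 is harmless, since division by it yields 0.\<close>
  define F where "F = (\<lambda>(h, k). (\<lambda>v. (v j - fst h v / c (fst h)) - (v j - fst k v / c (fst k)),
      - snd h / c (fst h) + snd k / c (fst k)))"
  define H' where "H' = {h \<in> H. c (fst h) = 0} \<union> F ` (H \<times> H)"
  have Fv: "fst (F (h, k)) v + snd (F (h, k)) = \<rho> h v - \<rho> k v" for h k v
    by (simp add: F_def \<rho>_def add_divide_distrib)
  have upd: "g (v(j := a)) = g v + (a - v j) * c g" if "linear g" for g v a
  proof -
    have "v(j := a) = v + (a - v j) *\<^sub>R (\<lambda>i. if i = j then 1 else 0)" by auto
    then show ?thesis using that by (simp add: c_def linear_add linear_scale)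
  qed
  have one: "\<exists>a'. D (v'(j := a'))"
    if eq: "\<And>h. h \<in> H' \<Longrightarrow> sgn (fst h v + snd h) = sgn (fst h v' + snd h)" and D: "D (v(j := a))"
    for v v' a
  proof -
    have "\<exists>a'. \<forall>h\<in>{h \<in> H. c (fst h) \<noteq> 0}. sgn (a - \<rho> h v) = sgn (a' - \<rho> h v')"
    proof (rule same_position)
      fix h k assume "h \<in> {h \<in> H. c (fst h) \<noteq> 0}" "k \<in> {h \<in> H. c (fst h) \<noteq> 0}"
      then have "F (h, k) \<in> H'" by (auto simp: H'_def)
      from eq[OF this] show "sgn (\<rho> h v - \<rho> k v) = sgn (\<rho> h v' - \<rho> k v')" unfolding Fv .
    qed (use H(1) in simp)
    then obtain a' where a': "\<And>h. h \<in> H \<Longrightarrow> c (fst h) \<noteq> 0 \<Longrightarrow> sgn (a - \<rho> h v) = sgn (a' - \<rho> h v')" by blast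
    have "D (v(j := a)) = D (v'(j := a'))"
    proof (rule H(3))
      fix h assume h: "h \<in> H"
      note u = upd[OF H(2)[OF h]]
      show "sgn (fst h (v(j := a)) + snd h) = sgn (fst h (v'(j := a')) + snd h)"
      proof (cases "c (fst h) = 0")
        case True
        then have "h \<in> H'" using h by (simp add: H'_def)
        from eq[OF this] show ?thesis unfolding u True by (simp only: mult_zero_right add_0_right)
      next
        case False
        have e: "fst h (v(j := a)) + snd h = c (fst h) * (a - \<rho> h v)" for v a
          using False by (simp add: u \<rho>_def field_simps)
        show ?thesis unfolding e sgn_mult using a'[OF h False] by (simp only:)
      qed
    qed
    then show ?thesis using D by blast
  qed
  have "sgn_det_by H' (\<lambda>v. \<exists>a. D (v(j := a)))"
  proof (rule sgn_det_byI)
    show "finite H'" using H(1) by (simp add: H'_def)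
    fix h assume "h \<in> H'"
    moreover have "linear (fst (F (h, k)))" if "h \<in> H" "k \<in> H" for h k
    proof -
      have "linear (\<lambda>v. fst h v / c (fst h))" "linear (\<lambda>v. fst k v / c (fst k))"
        using H(2)[OF that(1)] H(2)[OF that(2)]
        by (auto intro!: linearI simp: linear_add linear_scale add_divide_distrib)
      then show ?thesis unfolding F_def by (auto intro!: linear_compose_sub linear_coord)
    qed
    ultimately show "linear (fst h)" using H(2) unfolding H'_def by blast
  next
    fix v v' assume eq: "\<And>h. h \<in> H' \<Longrightarrow> sgn (fst h v + snd h) = sgn (fst h v' + snd h)"
    show "(\<exists>a. D (v(j := a))) = (\<exists>a. D (v'(j := a)))"
      using one[of v v'] one[of v' v] eq by metis
  qed
  then show ?thesis unfolding sgn_determined_def by blast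
qed

lemma tm_val_affine:
  "wf_tm real_add t \<Longrightarrow> \<exists>g d. linear g \<and> (\<forall>v. tm_val real_add v t = g v + d)"
proof (induction t)
  case (Var i)
  show ?case by (intro exI[of _ "\<lambda>v. v i"] exI[of _ 0]) (simp add: linear_coord)
next
  case (Fun f ts)
  then consider "f = 0" "length ts = 2" | "f = 1" "length ts = 0"
    by (auto simp: real_add_def split: if_splits)
  then show ?case
  proof cases
    case 1
    then obtain a b where ab: "ts = [a, b]" by (auto simp: length_Suc_conv numeral_2_eq_2)
    then have "\<exists>g d. linear g \<and> (\<forall>v. tm_val real_add v a = g v + d)"
      "\<exists>g d. linear g \<and> (\<forall>v. tm_val real_add v b = g v + d)"
      using Fun.prems by (intro Fun.IH; simp)+
    then obtain g d g' d' where h: "linear g" "\<And>v. tm_val real_add v a = g v + d"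
      "linear g'" "\<And>v. tm_val real_add v b = g' v + d'"
      by blast
    have "tm_val real_add v (Fun f ts) = (g v + g' v) + (d + d')" for v
      using 1 ab h(2,4) by (simp add: real_add_def)
    then show ?thesis using linear_compose_add[OF h(1,3)] by blast
  next
    case 2
    then show ?thesis
      by (intro exI[of _ "\<lambda>v. 0"] exI[of _ 1]) (simp add: real_add_def linear_zero)
  qed
qed

lemma sgn_determined_affine:
  assumes "linear g" "\<And>v v'. sgn (g v + d) = sgn (g v' + d :: real) \<Longrightarrow> D v = D v'"
  shows "sgn_determined D"
proof -
  have "sgn_det_by {(g, d)} D"
  proof (rule sgn_det_byI)
    fix v v' assume "\<And>h. h \<in> {(g, d)} \<Longrightarrow> sgn (fst h v + snd h) = sgn (fst h v' + snd h)"
    from this[of "(g, d)"] show "D v = D v'" by (intro assms(2)) simp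
  qed (use assms(1) in auto)
  then show ?thesis unfolding sgn_determined_def by blast
qed

lemma sgn_eqD:
  fixes x y :: real
  assumes "sgn x = sgn y"
  shows "x = 0 \<longleftrightarrow> y = 0" "x < 0 \<longleftrightarrow> y < 0"
  using assms by (auto simp: sgn_if split: if_splits)

theorem real_add_sgn_determined:
  "wf_fm real_add p \<Longrightarrow> sgn_determined (\<lambda>v. sat real_add v p)"
proof (induction p)
  case (Eq s t)
  then obtain g d g' d' where h: "linear g" "\<forall>v. tm_val real_add v s = g v + d"
      "linear g'" "\<forall>v. tm_val real_add v t = g' v + d'"
    using tm_val_affine by (metis wf_fm.simps(1))
  have e: "sat real_add v (Eq s t) \<longleftrightarrow> g v - g' v + (d - d') = 0" for v
    unfolding sat.simps h(2)[rule_format] h(4)[rule_format] by linarith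
  show ?case unfolding e
    by (rule sgn_determined_affine[OF linear_compose_sub[OF h(1,3)] sgn_eqD(1)])
next
  case (Rel r ts)
  then have r: "r = 0" "length ts = 2" by (auto simp: real_add_def split: if_splits)
  then obtain a b where ab: "ts = [a, b]" by (auto simp: length_Suc_conv numeral_2_eq_2)
  then have "wf_tm real_add a" "wf_tm real_add b" using Rel by auto
  then obtain g d g' d' where h: "linear g" "\<forall>v. tm_val real_add v a = g v + d"
      "linear g'" "\<forall>v. tm_val real_add v b = g' v + d'"
    using tm_val_affine by metis
  have e: "sat real_add v (Rel r ts) \<longleftrightarrow> g v - g' v + (d - d') < 0" for v
  proof -
    have "sat real_add v (Rel r ts) \<longleftrightarrow> tm_val real_add v a < tm_val real_add v b"
      using r ab by (simp add: real_add_def)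
    also have "\<dots> \<longleftrightarrow> g v - g' v + (d - d') < 0"
      unfolding h(2)[rule_format] h(4)[rule_format] by linarith
    finally show ?thesis .
  qed
  show ?case unfolding e
    by (rule sgn_determined_affine[OF linear_compose_sub[OF h(1,3)] sgn_eqD(2)])
next
  case (Neg p)
  then show ?case unfolding sgn_determined_def sgn_det_by_def by simp
next
  case (Conj p q)
  then have "sgn_determined (\<lambda>v. sat real_add v p)" "sgn_determined (\<lambda>v. sat real_add v q)" by auto
  then obtain H H' where "sgn_det_by H (\<lambda>v. sat real_add v p)" "sgn_det_by H' (\<lambda>v. sat real_add v q)"
    unfolding sgn_determined_def by blast
  note H = sgn_det_byD[OF this(1)] and H' = sgn_det_byD[OF this(2)]
  have "sgn_det_by (H \<union> H') (\<lambda>v. sat real_add v (Conj p q))"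
  proof (rule sgn_det_byI)
    fix v v' assume eq: "\<And>h. h \<in> H \<union> H' \<Longrightarrow> sgn (fst h v + snd h) = sgn (fst h v' + snd h)"
    have "sat real_add v p = sat real_add v' p" by (rule H(3), rule eq) simp
    moreover have "sat real_add v q = sat real_add v' q" by (rule H'(3), rule eq) simp
    ultimately show "sat real_add v (Conj p q) = sat real_add v' (Conj p q)" by simp
  qed (use H(1,2) H'(1,2) in blast)+
  then show ?case unfolding sgn_determined_def by blast
next
  case (Exi i p)
  then show ?case using sgn_determined_ex by simp
qed

section \<open>The criterion as a sentence\<close>

text \<open>Formulas are built on the level of codes and for arbitrary numbers, so that the
  criterion is a computable function of the code. The code of a function symbol is shifted by one:
  addition gets the tag 1, the constant one gets 2.\<close>

definition "cVar i = prod_encode (0, i)"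
definition "cAdd s t = prod_encode (1, list_encode [s, t])"
definition "cOne = prod_encode (2, list_encode [])"
definition "cEq s t = prod_encode (0, prod_encode (s, t))"
definition "cLess s t = prod_encode (1, prod_encode (0, list_encode [s, t]))"
definition "cNeg c = prod_encode (2, c)"
definition "cConj c d = prod_encode (3, prod_encode (c, d))"
definition "cExi i c = prod_encode (4, prod_encode (i, c))"
definition "cImp c d = cNeg (cConj c (cNeg d))"
definition "cIff c d = cConj (cImp c d) (cImp d c)"

definition cExs :: "nat \<Rightarrow> nat \<Rightarrow> nat \<Rightarrow> nat" where
  "cExs b m c = rec_nat c (\<lambda>i. cExi (b + i)) m"

definition cAlls :: "nat \<Rightarrow> (nat \<Rightarrow> nat) \<Rightarrow> nat" where
  "cAlls m F = rec_nat (cEq cOne cOne) (\<lambda>i. cConj (F i)) m"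

text \<open>Renaming the variables below \<open>m\<close> to those from \<open>b\<close> on.
  Quantifying and equating instead of substituting avoids any capture by bound variables of the
  formula, because the values are copied outside it.\<close>

definition cSub :: "nat \<Rightarrow> nat \<Rightarrow> nat \<Rightarrow> nat" where
  "cSub b m c = rec_nat c (\<lambda>i d. cExi i (cConj (cEq (cVar i) (cVar (b + i))) d)) m"

text \<open>The variables are divided into blocks of length \<open>n\<close>, each holding a vector; block \<open>0\<close> consists of
  the free variables of the given formula. A scalar is the first component of a block.\<close>

definition cV :: "nat \<Rightarrow> nat \<Rightarrow> nat \<Rightarrow> nat" where
  "cV n k i = cVar (k * n + i)"

definition "cExV n k c = cExs (k * n) n c"
definition "cAllV n k c = cNeg (cExV n k (cNeg c))"
definition "cX n c k = cSub (k * n) n c"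
text \<open>Without a constant for zero, \<open>x + x = x\<close> expresses that a coordinate
  vanishes.\<close>

definition "cSec n a x = cAlls n (\<lambda>i. cImp (cNeg (cEq (cAdd (cV n a i) (cV n a i)) (cV n a i)))
   (cEq (cAdd (cV n x i) (cV n x i)) (cV n x i)))"
definition "cNear n x y r = cAlls n (\<lambda>i. cConj (cLess (cV n x i) (cAdd (cV n y i) (cV n r 0)))
   (cLess (cV n y i) (cAdd (cV n x i) (cV n r 0))))"
definition "cZero n x = cAlls n (\<lambda>i. cEq (cAdd (cV n x i) (cV n x i)) (cV n x i))"
definition "cSame n x y = cAlls n (\<lambda>i. cEq (cV n x i) (cV n y i))"
definition "cSum n x y z = cAlls n (\<lambda>i. cEq (cV n x i) (cAdd (cV n y i) (cV n z i)))"
definition "cHalf n x y z = cAlls n (\<lambda>i. cEq (cAdd (cV n x i) (cV n x i)) (cAdd (cV n y i) (cV n z i)))"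
definition "cPos n r = cLess (cV n r 0) (cAdd (cV n r 0) (cV n r 0))"
text \<open>Block 11 is scratch space for the zero vector.\<close>

definition "cSmall n x r = cExV n 11 (cConj (cZero n 11) (cNear n x 11 r))"

text \<open>In the formulas below, block \<open>0\<close> holds the point under consideration, block \<open>2\<close> the radius of
  the ball around it, and block \<open>1\<close> a vector \<open>a\<close> coding the coordinate subspace of all \<open>x\<close> with \<open>x\<^sub>i = 0\<close>
  whenever \<open>a\<^sub>i \<noteq> 0\<close>, so that all these subspaces are treated by one quantifier.\<close>

definition "cInv n c u = cAllV n 7 (cAllV n 8 (cImp
   (cConj (cSec n 1 7) (cConj (cSum n 8 7 u) (cConj (cNear n 7 0 2) (cNear n 8 0 2))))
   (cIff (cX n c 7) (cX n c 8))))"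

definition "cNonsing n c = cExV n 2 (cConj (cPos n 2) (cExV n 3 (cConj (cPos n 3) (cConj
   (cAllV n 4 (cImp (cPos n 4) (cExV n 5 (cConj (cConj (cSec n 1 5) (cNeg (cZero n 5)))
     (cConj (cSmall n 5 4) (cInv n c 5))))))
   (cAllV n 6 (cImp (cConj (cSec n 1 6) (cConj (cSmall n 6 3) (cNeg (cInv n c 6))))
     (cExV n 4 (cConj (cPos n 4) (cAllV n 5 (cImp (cConj (cSec n 1 5) (cNear n 5 6 4)) (cNeg (cInv n c 5))))))))))))"

definition "cSing n c = cConj (cSec n 1 0) (cNeg (cNonsing n c))"

text \<open>Finiteness of the set of singular points of the section coded by block 1, in the form of
  \<open>finite_iff_bounded_discrete\<close>.\<close>

definition "cTame n c = cConj
   (cExV n 9 (cAllV n 0 (cImp (cSing n c) (cSmall n 0 9))))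
   (cAllV n 10 (cExV n 9 (cConj (cPos n 9) (cAllV n 0 (cImp
     (cConj (cSing n c) (cNeg (cSame n 0 10))) (cNeg (cNear n 0 10 9)))))))"

text \<open>Block 8 is the midpoint of blocks 7 and 10, that is, the image of block 7 under halving
  towards block 10.\<close>

definition "cHalving n c = cAllV n 10 (cExV n 9 (cConj (cPos n 9) (cAllV n 7 (cAllV n 8 (cImp
   (cConj (cNear n 7 10 9) (cHalf n 8 7 10)) (cIff (cX n c 7) (cX n c 8)))))))"

definition "cCrit n c = cConj (cAllV n 1 (cTame n c)) (cHalving n c)"

text \<open>A tautology, which is a true sentence iff \<open>c\<close> codes a formula of the signature whose free variables are
  below \<open>n\<close>.\<close>

definition "cClosed n c = cExs 0 n (cNeg (cConj c (cNeg c)))"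

lemma prod_encode_fm_code:
  shows cNeg_fm_code: "fm_code p = cNeg c \<Longrightarrow> \<exists>q. p = Neg q \<and> c = fm_code q"
    and cConj_fm_code: "fm_code p = cConj c d \<Longrightarrow> \<exists>q r. p = Conj q r \<and> c = fm_code q \<and> d = fm_code r"
    and cExi_fm_code: "fm_code p = cExi i c \<Longrightarrow> \<exists>q. p = Exi i q \<and> c = fm_code q"
  by (cases p; auto simp: cNeg_def cConj_def cExi_def)+

section \<open>Correctness of the codes, with formulas read through blocks of variables\<close>

locale coded =
  fixes M :: "real struct" and n :: nat
  assumes expansion: "expansion M real_add" and n_pos: "1 \<le> n"
begin

abbreviation pts :: "(nat \<Rightarrow> real) set" where
  "pts \<equiv> supp_in {..<n}"

definition block :: "(nat \<Rightarrow> real) \<Rightarrow> nat \<Rightarrow> nat \<Rightarrow> real" where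
  "block v k = (\<lambda>i. if i < n then v (k * n + i) else 0)"

definition vars :: "nat set \<Rightarrow> nat set" where
  "vars S = (\<Union>k\<in>S. {k * n..<k * n + n})"

text \<open>Well-formedness, free variables and meaning are carried together, so that correctness
  follows the construction of the code. The blocks in \<open>S\<close> may occur free; the empty
  \<open>S\<close> yields a sentence.\<close>

definition repr :: "nat set \<Rightarrow> nat \<Rightarrow> ((nat \<Rightarrow> nat \<Rightarrow> real) \<Rightarrow> bool) \<Rightarrow> bool" where
  "repr S c Q \<longleftrightarrow> (\<exists>p. c = fm_code p \<and> wf_fm M p \<and> fv p \<subseteq> vars S \<and> (\<forall>v. sat M v p = Q (block v)))"

definition trepr :: "nat set \<Rightarrow> nat \<Rightarrow> ((nat \<Rightarrow> nat \<Rightarrow> real) \<Rightarrow> real) \<Rightarrow> bool" where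
  "trepr S c f \<longleftrightarrow> (\<exists>t. c = tm_code t \<and> wf_tm M t \<and> fv_tm t \<subseteq> vars S \<and> (\<forall>v. tm_val M v t = f (block v)))"

lemma block_points: "block v k \<in> pts"
  by (simp add: block_def supp_in_def)

text \<open>Only environments of genuine points matter, since \<open>block\<close> pads with
  zeros.\<close>

lemma repr_cong: "repr S c Q \<Longrightarrow> (\<And>e. (\<And>k. e k \<in> pts) \<Longrightarrow> Q e = Q' e) \<Longrightarrow> repr S c Q'"
  unfolding repr_def using block_points by metis

lemma trepr_V: "k \<in> S \<Longrightarrow> i < n \<Longrightarrow> trepr S (cV n k i) (\<lambda>e. e k i)"
  unfolding trepr_def
  by (intro exI[of _ "Var (k * n + i)"])
    (auto simp: cV_def cVar_def vars_def block_def intro!: bexI[of _ k])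

lemma trepr_Add: "trepr S s f \<Longrightarrow> trepr S t g \<Longrightarrow> trepr S (cAdd s t) (\<lambda>e. f e + g e)"
proof -
  assume "trepr S s f" "trepr S t g"
  then obtain s' t' where "s = tm_code s'" "wf_tm M s'" "fv_tm s' \<subseteq> vars S" "\<forall>v. tm_val M v s' = f (block v)"
    "t = tm_code t'" "wf_tm M t'" "fv_tm t' \<subseteq> vars S" "\<forall>v. tm_val M v t' = g (block v)"
    unfolding trepr_def by blast
  then show ?thesis unfolding trepr_def
    by (intro exI[of _ "Fun 0 [s', t']"]) (simp add: cAdd_def expansion_real_add[OF expansion])
qed

lemma trepr_One: "trepr S cOne (\<lambda>e. 1)"
  unfolding trepr_def
  by (intro exI[of _ "Fun (Suc 0) []"]) (simp add: cOne_def expansion_real_add[OF expansion] numeral_2_eq_2)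

lemma repr_Eq: "trepr S s f \<Longrightarrow> trepr S t g \<Longrightarrow> repr S (cEq s t) (\<lambda>e. f e = g e)"
proof -
  assume "trepr S s f" "trepr S t g"
  then obtain s' t' where "s = tm_code s'" "wf_tm M s'" "fv_tm s' \<subseteq> vars S" "\<forall>v. tm_val M v s' = f (block v)"
    "t = tm_code t'" "wf_tm M t'" "fv_tm t' \<subseteq> vars S" "\<forall>v. tm_val M v t' = g (block v)"
    unfolding trepr_def by blast
  then show ?thesis unfolding repr_def
    by (intro exI[of _ "Eq s' t'"]) (simp add: cEq_def)
qed

lemma repr_Less: "trepr S s f \<Longrightarrow> trepr S t g \<Longrightarrow> repr S (cLess s t) (\<lambda>e. f e < g e)"
proof -
  assume "trepr S s f" "trepr S t g"
  then obtain s' t' where "s = tm_code s'" "wf_tm M s'" "fv_tm s' \<subseteq> vars S" "\<forall>v. tm_val M v s' = f (block v)"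
    "t = tm_code t'" "wf_tm M t'" "fv_tm t' \<subseteq> vars S" "\<forall>v. tm_val M v t' = g (block v)"
    unfolding trepr_def by blast
  then show ?thesis unfolding repr_def
    by (intro exI[of _ "Rel 0 [s', t']"]) (simp add: cLess_def expansion_real_add[OF expansion])
qed

lemma repr_Neg: "repr S c Q \<Longrightarrow> repr S (cNeg c) (\<lambda>e. \<not> Q e)"
proof -
  assume "repr S c Q"
  then obtain p where "c = fm_code p" "wf_fm M p" "fv p \<subseteq> vars S" "\<forall>v. sat M v p = Q (block v)"
    unfolding repr_def by blast
  then show ?thesis unfolding repr_def by (intro exI[of _ "Neg p"]) (simp add: cNeg_def)
qed

lemma repr_Conj: "repr S c Q \<Longrightarrow> repr S d R \<Longrightarrow> repr S (cConj c d) (\<lambda>e. Q e \<and> R e)"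
proof -
  assume "repr S c Q" "repr S d R"
  then obtain p q where "c = fm_code p" "wf_fm M p" "fv p \<subseteq> vars S" "\<forall>v. sat M v p = Q (block v)"
    "d = fm_code q" "wf_fm M q" "fv q \<subseteq> vars S" "\<forall>v. sat M v q = R (block v)"
    unfolding repr_def by blast
  then show ?thesis unfolding repr_def by (intro exI[of _ "Conj p q"]) (simp add: cConj_def)
qed

lemma repr_Imp: "repr S c Q \<Longrightarrow> repr S d R \<Longrightarrow> repr S (cImp c d) (\<lambda>e. Q e \<longrightarrow> R e)"
  unfolding cImp_def by (rule repr_cong[OF repr_Neg[OF repr_Conj[OF _ repr_Neg]]]) auto

lemma repr_Iff: "repr S c Q \<Longrightarrow> repr S d R \<Longrightarrow> repr S (cIff c d) (\<lambda>e. Q e = R e)"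
  unfolding cIff_def by (rule repr_cong[OF repr_Conj[OF repr_Imp repr_Imp]]) auto

lemma repr_Alls:
  assumes "\<And>i. i < m \<Longrightarrow> repr S (F i) (P i)"
  shows "repr S (cAlls m F) (\<lambda>e. \<forall>i<m. P i e)"
  using assms
proof (induction m)
  case 0
  have "repr S (cEq cOne cOne) (\<lambda>e. (1::real) = 1)" by (intro repr_Eq trepr_One)
  then show ?case by (simp add: cAlls_def)
next
  case (Suc m)
  then have "repr S (cConj (F m) (cAlls m F)) (\<lambda>e. P m e \<and> (\<forall>i<m. P i e))" by (intro repr_Conj) auto
  then have "repr S (cConj (F m) (cAlls m F)) (\<lambda>e. \<forall>i<Suc m. P i e)"
    by (rule repr_cong) (auto simp: less_Suc_eq)
  then show ?case by (simp add: cAlls_def)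
qed

lemma cExs_fm:
  "\<exists>q. cExs b m (fm_code p) = fm_code q \<and> (wf_fm M q \<longleftrightarrow> wf_fm M p) \<and> fv q = fv p - {b..<b + m} \<and>
    (\<forall>v. sat M v q \<longleftrightarrow> (\<exists>x. sat M (\<lambda>j. if b \<le> j \<and> j < b + m then x (j - b) else v j) p))"
proof (induction m)
  case 0
  have "(\<lambda>j. if b \<le> j \<and> j < b + 0 then x (j - b) else v j) = v" for x v :: "nat \<Rightarrow> real" by auto
  then show ?case by (intro exI[of _ p]) (simp add: cExs_def)
next
  case (Suc m)
  then obtain q where q: "cExs b m (fm_code p) = fm_code q" "wf_fm M q \<longleftrightarrow> wf_fm M p" "fv q = fv p - {b..<b + m}"
    "\<And>v. sat M v q \<longleftrightarrow> (\<exists>x. sat M (\<lambda>j. if b \<le> j \<and> j < b + m then x (j - b) else v j) p)" by blast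
  have e: "(\<exists>a x. sat M (\<lambda>j. if b \<le> j \<and> j < b + m then x (j - b) else (v(b + m := a)) j) p) \<longleftrightarrow>
     (\<exists>x. sat M (\<lambda>j. if b \<le> j \<and> j < b + Suc m then x (j - b) else v j) p)" for v
  proof
    assume "\<exists>a x. sat M (\<lambda>j. if b \<le> j \<and> j < b + m then x (j - b) else (v(b + m := a)) j) p"
    then obtain a x where ax: "sat M (\<lambda>j. if b \<le> j \<and> j < b + m then x (j - b) else (v(b + m := a)) j) p" by blast
    have "(\<lambda>j. if b \<le> j \<and> j < b + m then x (j - b) else (v(b + m := a)) j) =
      (\<lambda>j. if b \<le> j \<and> j < b + Suc m then (x(m := a)) (j - b) else v j)" by (rule ext) auto
    then have "sat M (\<lambda>j. if b \<le> j \<and> j < b + Suc m then (x(m := a)) (j - b) else v j) p" using ax by simp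
    then show "\<exists>x. sat M (\<lambda>j. if b \<le> j \<and> j < b + Suc m then x (j - b) else v j) p" by blast
  next
    assume "\<exists>x. sat M (\<lambda>j. if b \<le> j \<and> j < b + Suc m then x (j - b) else v j) p"
    then obtain x where x: "sat M (\<lambda>j. if b \<le> j \<and> j < b + Suc m then x (j - b) else v j) p" by blast
    have "(\<lambda>j. if b \<le> j \<and> j < b + Suc m then x (j - b) else v j) =
      (\<lambda>j. if b \<le> j \<and> j < b + m then x (j - b) else (v(b + m := x m)) j)" by (rule ext) auto
    then have "sat M (\<lambda>j. if b \<le> j \<and> j < b + m then x (j - b) else (v(b + m := x m)) j) p" using x by simp
    then show "\<exists>a x. sat M (\<lambda>j. if b \<le> j \<and> j < b + m then x (j - b) else (v(b + m := a)) j) p" by blast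
  qed
  have "cExs b (Suc m) (fm_code p) = fm_code (Exi (b + m) q)"
    using q(1) by (simp add: cExs_def cExi_def)
  moreover have "{b..<b + Suc m} = insert (b + m) {b..<b + m}" by auto
  then have "fv (Exi (b + m) q) = fv p - {b..<b + Suc m}" using q(3) by (simp only: fv.simps) blast
  moreover have "sat M v (Exi (b + m) q) \<longleftrightarrow> (\<exists>x. sat M (\<lambda>j. if b \<le> j \<and> j < b + Suc m then x (j - b) else v j) p)" for v
    using e[of v] q(4) by (simp only: sat.simps)
  moreover have "wf_fm M (Exi (b + m) q) \<longleftrightarrow> wf_fm M p" using q(2) by simp
  ultimately show ?case by blast
qed

text \<open>Blocks are disjoint: division by \<open>n\<close> recovers the block from a
  variable.\<close>

lemma block_update:
  assumes "x \<in> pts"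
  shows "block (\<lambda>j. if k * n \<le> j \<and> j < k * n + n then x (j - k * n) else v j) = (block v)(k := x)"
proof (intro ext)
  fix l i
  show "block (\<lambda>j. if k * n \<le> j \<and> j < k * n + n then x (j - k * n) else v j) l i = ((block v)(k := x)) l i"
  proof (cases "l = k")
    case True
    then show ?thesis using assms by (auto simp: block_def supp_in_def)
  next
    case False
    have "\<not> (k * n \<le> l * n + i \<and> l * n + i < k * n + n)" if "i < n"
    proof
      assume a: "k * n \<le> l * n + i \<and> l * n + i < k * n + n"
      have "(l * n + i) div n = l" using that by simp
      moreover have "(l * n + i) div n = k" using a by (intro div_nat_eqI) (auto simp: algebra_simps)
      ultimately show False using False by simp
    qed
    then show ?thesis using False by (cases "i < n") (auto simp: block_def)
  qed
qed

lemma repr_ExV: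
  assumes "repr (insert k S) c Q"
  shows "repr S (cExV n k c) (\<lambda>e. \<exists>x\<in>pts. Q (e(k := x)))"
proof -
  obtain p where p: "c = fm_code p" "wf_fm M p" "fv p \<subseteq> vars (insert k S)" "\<And>v. sat M v p = Q (block v)"
    using assms unfolding repr_def by blast
  obtain q where q: "cExV n k c = fm_code q" "wf_fm M q \<longleftrightarrow> wf_fm M p" "fv q = fv p - {k * n..<k * n + n}"
    "\<And>v. sat M v q \<longleftrightarrow> (\<exists>x. sat M (\<lambda>j. if k * n \<le> j \<and> j < k * n + n then x (j - k * n) else v j) p)"
    using cExs_fm[of "k * n" n p] p(1) by (auto simp: cExV_def)
  have "sat M v q \<longleftrightarrow> (\<exists>x\<in>pts. Q ((block v)(k := x)))" for v
  proof
    assume "sat M v q"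
    then obtain x where x: "sat M (\<lambda>j. if k * n \<le> j \<and> j < k * n + n then x (j - k * n) else v j) p"
      using q(4) by blast
    let ?x = "\<lambda>i. if i < n then x i else 0"
    have "(\<lambda>j. if k * n \<le> j \<and> j < k * n + n then x (j - k * n) else v j) =
      (\<lambda>j. if k * n \<le> j \<and> j < k * n + n then ?x (j - k * n) else v j)" by (rule ext) auto
    then have "sat M (\<lambda>j. if k * n \<le> j \<and> j < k * n + n then ?x (j - k * n) else v j) p" using x by metis
    moreover have "?x \<in> pts" by (simp add: supp_in_def)
    ultimately show "\<exists>x\<in>pts. Q ((block v)(k := x))"
      using p(4) block_update[of ?x k v] by (intro bexI[of _ ?x]) simp_all
  next
    assume "\<exists>x\<in>pts. Q ((block v)(k := x))"
    then obtain x where "x \<in> pts" "Q ((block v)(k := x))" by blast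
    then show "sat M v q" unfolding q(4) using p(4) block_update[of x k v] by (intro exI[of _ x]) simp
  qed
  moreover have "fv q \<subseteq> vars S" using q(3) p(3) by (auto simp: vars_def)
  ultimately show ?thesis unfolding repr_def using q(1,2) p(2) by (intro exI[of _ q]) simp
qed

lemma repr_AllV:
  assumes "repr (insert k S) c Q"
  shows "repr S (cAllV n k c) (\<lambda>e. \<forall>x\<in>pts. Q (e(k := x)))"
  unfolding cAllV_def using repr_Neg[OF repr_ExV[OF repr_Neg[OF assms]]] by (rule repr_cong) blast

text \<open>Block 0 is excluded: for \<open>k \<noteq> 0\<close> the source variables are at least
  \<open>n\<close>, so none of them is overwritten while the variables below \<open>n\<close> are
  reassigned.\<close>

lemma repr_X:
  assumes p: "wf_fm M p" "fv p \<subseteq> {..<n}" and k: "k \<in> S" "k \<noteq> 0"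
  shows "repr S (cX n (fm_code p) k) (\<lambda>e. sat M (e k) p)"
proof -
  have kn: "n \<le> k * n" using k by simp
  have "\<exists>q. cSub (k * n) m (fm_code p) = fm_code q \<and> wf_fm M q \<and> fv q \<subseteq> (fv p - {..<m}) \<union> {k * n..<k * n + m} \<and>
    (\<forall>v. sat M v q = sat M (\<lambda>j. if j < m then v (k * n + j) else v j) p)" if "m \<le> n" for m
    using that
  proof (induction m)
    case 0
    then show ?case using p by (intro exI[of _ p]) (auto simp: cSub_def)
  next
    case (Suc m)
    then obtain q where q: "cSub (k * n) m (fm_code p) = fm_code q" "wf_fm M q"
      "fv q \<subseteq> (fv p - {..<m}) \<union> {k * n..<k * n + m}"
      "\<And>v. sat M v q = sat M (\<lambda>j. if j < m then v (k * n + j) else v j) p" by auto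
    let ?q = "Exi m (Conj (Eq (Var m) (Var (k * n + m))) q)"
    have "sat M v ?q = sat M (\<lambda>j. if j < Suc m then v (k * n + j) else v j) p" for v
    proof -
      have ne: "k * n + j \<noteq> m" for j using Suc.prems kn by linarith
      have "(\<lambda>j. if j < m then (v(m := v (k * n + m))) (k * n + j) else (v(m := v (k * n + m))) j) =
        (\<lambda>j. if j < Suc m then v (k * n + j) else v j)"
        using ne by (intro ext) (auto simp: less_Suc_eq)
      moreover have "sat M v ?q = sat M (v(m := v (k * n + m))) q" using ne[of m] by simp
      ultimately show ?thesis unfolding q(4) by metis
    qed
    moreover have "cSub (k * n) (Suc m) (fm_code p) = fm_code ?q"
      using q(1) by (simp add: cSub_def cExi_def cConj_def cEq_def cVar_def)
    moreover have "fv ?q \<subseteq> (fv p - {..<Suc m}) \<union> {k * n..<k * n + Suc m}"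
      using q(3) by (auto simp: less_Suc_eq)
    moreover have "wf_fm M ?q" using q(2) by simp
    ultimately show ?case by blast
  qed
  from this[OF order.refl] obtain q where q: "cX n (fm_code p) k = fm_code q" "wf_fm M q"
    "fv q \<subseteq> (fv p - {..<n}) \<union> {k * n..<k * n + n}"
    "\<And>v. sat M v q = sat M (\<lambda>j. if j < n then v (k * n + j) else v j) p" by (auto simp: cX_def)
  have "sat M v q = sat M (block v k) p" for v
    unfolding q(4) by (rule sat_cong) (use p in \<open>auto simp: block_def\<close>)
  moreover have "fv q \<subseteq> vars S" using q(3) p(2) k by (auto simp: vars_def)
  ultimately show ?thesis unfolding repr_def using q(1,2) by (intro exI[of _ q]) simp
qed

lemmas repr_rules = repr_Neg repr_Conj repr_Imp repr_Iff repr_Eq repr_Less trepr_Add trepr_V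

lemma points_eq_iff: "x \<in> pts \<Longrightarrow> y \<in> pts \<Longrightarrow> x = y \<longleftrightarrow> (\<forall>i<n. x i = y i)"
  by (auto simp: supp_in_def fun_eq_iff) (metis not_less)

lemma repr_Sec:
  assumes "a \<in> S" "x \<in> S"
  shows "repr S (cSec n a x) (\<lambda>e. \<forall>i<n. e a i \<noteq> 0 \<longrightarrow> e x i = 0)"
proof -
  have "repr S (cSec n a x) (\<lambda>e. \<forall>i<n. \<not> e a i + e a i = e a i \<longrightarrow> e x i + e x i = e x i)"
    unfolding cSec_def by (intro repr_Alls repr_rules assms)
  then show ?thesis by (rule repr_cong) simp
qed

lemma repr_Near:
  assumes "x \<in> S" "y \<in> S" "r \<in> S"
  shows "repr S (cNear n x y r) (\<lambda>e. near n (e x) (e y) (e r 0))"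
proof -
  have "0 < n" using n_pos by simp
  then have "repr S (cNear n x y r) (\<lambda>e. \<forall>i<n. e x i < e y i + e r 0 \<and> e y i < e x i + e r 0)"
    unfolding cNear_def by (intro repr_Alls repr_rules assms)
  moreover have "(s < t + d \<and> t < s + d) \<longleftrightarrow> \<bar>s - t\<bar> < d" for s t d :: real by linarith
  ultimately show ?thesis unfolding near_def by (simp only:)
qed

lemma repr_Zero:
  assumes "x \<in> S"
  shows "repr S (cZero n x) (\<lambda>e. e x = 0)"
proof -
  have "repr S (cZero n x) (\<lambda>e. \<forall>i<n. e x i + e x i = e x i)"
    unfolding cZero_def by (intro repr_Alls repr_rules assms)
  then show ?thesis by (rule repr_cong) (subst points_eq_iff, auto simp: supp_in_zero)
qed

lemma repr_Same:
  assumes "x \<in> S" "y \<in> S"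
  shows "repr S (cSame n x y) (\<lambda>e. e x = e y)"
proof -
  have "repr S (cSame n x y) (\<lambda>e. \<forall>i<n. e x i = e y i)"
    unfolding cSame_def by (intro repr_Alls repr_rules assms)
  then show ?thesis by (rule repr_cong) (subst points_eq_iff, auto)
qed

lemma repr_Sum:
  assumes "x \<in> S" "y \<in> S" "z \<in> S"
  shows "repr S (cSum n x y z) (\<lambda>e. e x = e y + e z)"
proof -
  have "repr S (cSum n x y z) (\<lambda>e. \<forall>i<n. e x i = e y i + e z i)"
    unfolding cSum_def by (intro repr_Alls repr_rules assms)
  then show ?thesis by (rule repr_cong) (subst points_eq_iff, auto intro: supp_in_add)
qed

lemma repr_Half:
  assumes "x \<in> S" "y \<in> S" "z \<in> S"
  shows "repr S (cHalf n x y z) (\<lambda>e. e x + e x = e y + e z)"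
proof -
  have "repr S (cHalf n x y z) (\<lambda>e. \<forall>i<n. e x i + e x i = e y i + e z i)"
    unfolding cHalf_def by (intro repr_Alls repr_rules assms)
  then show ?thesis by (rule repr_cong)
    (simp only: points_eq_iff[OF supp_in_add supp_in_add] plus_fun_apply)
qed

lemma repr_Pos:
  assumes "r \<in> S"
  shows "repr S (cPos n r) (\<lambda>e. 0 < e r 0)"
proof -
  have "0 < n" using n_pos by simp
  then have "repr S (cPos n r) (\<lambda>e. e r 0 < e r 0 + e r 0)"
    unfolding cPos_def by (intro repr_rules assms)
  then show ?thesis by simp
qed

lemma repr_Small:
  assumes "x \<in> S" "r \<in> S" "x \<noteq> 11" "r \<noteq> 11"
  shows "repr S (cSmall n x r) (\<lambda>e. near n (e x) 0 (e r 0))"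
proof -
  have "repr (insert 11 S) (cConj (cZero n 11) (cNear n x 11 r))
      (\<lambda>e. e 11 = 0 \<and> near n (e x) (e 11) (e r 0))"
    using assms by (intro repr_Conj repr_Zero repr_Near) auto
  from repr_ExV[OF this] show ?thesis unfolding cSmall_def
    by (rule repr_cong) (use assms in \<open>auto simp: supp_in_zero\<close>)
qed

end

section \<open>The criterion for a given formula\<close>

locale coded_formula = coded +
  fixes p :: fm
  assumes wf: "wf_fm M p" and fv: "fv p \<subseteq> {..<n}"
begin

sublocale relation n "\<lambda>x. sat M x p" .

definition sec :: "(nat \<Rightarrow> real) \<Rightarrow> nat set" where
  "sec a = {i. i < n \<and> a i = 0}"

lemma supp_in_sec: "x \<in> supp_in (sec a) \<longleftrightarrow> x \<in> points \<and> (\<forall>i<n. a i \<noteq> 0 \<longrightarrow> x i = 0)"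
  by (auto simp: supp_in_def sec_def)

lemma ball_sec: "(\<forall>x\<in>supp_in (sec a). P x) \<longleftrightarrow> (\<forall>x\<in>points. (\<forall>i<n. a i \<noteq> 0 \<longrightarrow> x i = 0) \<longrightarrow> P x)"
  and bex_sec: "(\<exists>x\<in>supp_in (sec a). P x) \<longleftrightarrow> (\<exists>x\<in>points. (\<forall>i<n. a i \<noteq> 0 \<longrightarrow> x i = 0) \<and> P x)"
  using supp_in_sec by blast+

lemma scalar_point: "(\<lambda>i. if i = 0 then c else 0) \<in> points" 
  using n_pos by (auto simp: supp_in_def)

text \<open>Quantifiers over radii become quantifiers over blocks; a first component exists because
  \<open>n\<close> is positive.\<close>

lemma all_scalar: "(\<forall>c::real. P c) \<longleftrightarrow> (\<forall>x\<in>points. P (x 0))"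
  and ex_scalar: "(\<exists>c::real. P c) \<longleftrightarrow> (\<exists>x\<in>points. P (x 0))"
proof -
  have "\<exists>x\<in>points. x 0 = c" for c using scalar_point[of c] by (intro bexI) auto
  then show "(\<forall>c. P c) \<longleftrightarrow> (\<forall>x\<in>points. P (x 0))" "(\<exists>c. P c) \<longleftrightarrow> (\<exists>x\<in>points. P (x 0))"
    by metis+
qed

lemma repr_formula: "k \<in> S \<Longrightarrow> k \<noteq> 0 \<Longrightarrow> repr S (cX n (fm_code p) k) (\<lambda>e. sat M (e k) p)"
  using repr_X[OF wf fv] by blast

lemma repr_Inv:
  assumes "0 \<in> S" "1 \<in> S" "2 \<in> S" "u \<in> S" "u \<noteq> 7" "u \<noteq> 8"
  shows "repr S (cInv n (fm_code p) u) (\<lambda>e. inv_by (sec (e 1)) (e 0) (e 2 0) (e u))"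
proof -
  have "repr S (cInv n (fm_code p) u) (\<lambda>e. \<forall>y\<in>points. \<forall>q\<in>points.
      (\<forall>i<n. e 1 i \<noteq> 0 \<longrightarrow> y i = 0) \<and> q = y + e u \<and> near n y (e 0) (e 2 0) \<and> near n q (e 0) (e 2 0) \<longrightarrow>
      sat M y p = sat M q p)"
    \<comment> \<open>Beginning with \<open>repr_cong\<close> leaves the predicate open. The rules
      synthesise it from the code, and the last goal identifies it with the stated one.\<close>
    unfolding cInv_def
    by (rule repr_cong, (rule repr_AllV repr_Imp repr_Conj repr_Sec repr_Sum repr_Near repr_Iff repr_formula
        | (simp add: assms del: One_nat_def; fail))+, (auto)?)
  then show ?thesis
  proof (rule repr_cong)
    fix e :: "nat \<Rightarrow> nat \<Rightarrow> real" assume e: "\<And>k. e k \<in> points"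
    show "(\<forall>y\<in>points. \<forall>q\<in>points.
      (\<forall>i<n. e 1 i \<noteq> 0 \<longrightarrow> y i = 0) \<and> q = y + e u \<and> near n y (e 0) (e 2 0) \<and> near n q (e 0) (e 2 0) \<longrightarrow>
      sat M y p = sat M q p) = inv_by (sec (e 1)) (e 0) (e 2 0) (e u)"
      unfolding inv_by_def ball_sec using supp_in_add e by blast
  qed
qed

lemma repr_Nonsing:
  assumes "0 \<in> S" "1 \<in> S"
  shows "repr S (cNonsing n (fm_code p)) (\<lambda>e. nonsing (sec (e 1)) (e 0))"
proof -
  have "repr S (cNonsing n (fm_code p)) (\<lambda>e. \<exists>r\<in>points. 0 < r 0 \<and> (\<exists>s\<in>points. 0 < s 0 \<and>
     (\<forall>d\<in>points. 0 < d 0 \<longrightarrow> (\<exists>u\<in>points. ((\<forall>i<n. e 1 i \<noteq> 0 \<longrightarrow> u i = 0) \<and> u \<noteq> 0) \<and>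
        near n u 0 (d 0) \<and> inv_by (sec (e 1)) (e 0) (r 0) u)) \<and>
     (\<forall>w\<in>points. (\<forall>i<n. e 1 i \<noteq> 0 \<longrightarrow> w i = 0) \<and> near n w 0 (s 0) \<and> \<not> inv_by (sec (e 1)) (e 0) (r 0) w \<longrightarrow>
        (\<exists>d\<in>points. 0 < d 0 \<and> (\<forall>u\<in>points. (\<forall>i<n. e 1 i \<noteq> 0 \<longrightarrow> u i = 0) \<and> near n u w (d 0) \<longrightarrow>
           \<not> inv_by (sec (e 1)) (e 0) (r 0) u)))))"
    unfolding cNonsing_def
    by (rule repr_cong, (rule repr_ExV repr_AllV repr_Imp repr_Conj repr_Neg repr_Sec repr_Near repr_Pos
        repr_Small repr_Zero repr_Inv | (simp add: assms del: One_nat_def; fail))+, (auto)?)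
  then show ?thesis
    unfolding nonsing_def ball_sec bex_sec ex_scalar all_scalar
    by (rule repr_cong) (simp only: conj_assoc imp_conjL)
qed

lemma repr_Sing:
  assumes "0 \<in> S" "1 \<in> S"
  shows "repr S (cSing n (fm_code p)) (\<lambda>e. e 0 \<in> sing (sec (e 1)))"
proof -
  have "repr S (cSing n (fm_code p)) (\<lambda>e. (\<forall>i<n. e 1 i \<noteq> 0 \<longrightarrow> e 0 i = 0) \<and> \<not> nonsing (sec (e 1)) (e 0))"
    unfolding cSing_def using assms by (intro repr_Conj repr_Neg repr_Sec repr_Nonsing)
  then show ?thesis by (rule repr_cong) (simp add: sing_def supp_in_sec)
qed

lemma sing_points: "sing (sec a) \<subseteq> points"
  by (auto simp: sing_def supp_in_sec)

lemma repr_Tame: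
  assumes "1 \<in> S"
  shows "repr S (cTame n (fm_code p)) (\<lambda>e. finite (sing (sec (e 1))))"
proof -
  have "repr S (cTame n (fm_code p)) (\<lambda>e.
     (\<exists>R\<in>points. \<forall>x\<in>points. x \<in> sing (sec (e 1)) \<longrightarrow> near n x 0 (R 0)) \<and>
     (\<forall>z\<in>points. \<exists>d\<in>points. 0 < d 0 \<and> (\<forall>x\<in>points. x \<in> sing (sec (e 1)) \<and> x \<noteq> z \<longrightarrow> \<not> near n x z (d 0))))"
    unfolding cTame_def
    by (rule repr_cong, (rule repr_ExV repr_AllV repr_Imp repr_Conj repr_Neg repr_Near repr_Pos
        repr_Small repr_Same repr_Sing | (simp add: assms del: One_nat_def; fail))+, (auto)?)
  then show ?thesis
    unfolding finite_iff_bounded_discrete[OF sing_points] ex_scalar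
    by (rule repr_cong) (use sing_points in blast)
qed

lemma repr_Halving:
  "repr S (cHalving n (fm_code p)) (\<lambda>e. \<forall>z\<in>points. \<exists>r>0. \<forall>y\<in>points. near n y z r \<longrightarrow>
     sat M y p = sat M (z + (1/2) *\<^sub>R (y - z)) p)"
proof -
  have "repr S (cHalving n (fm_code p)) (\<lambda>e. \<forall>z\<in>points. \<exists>r\<in>points. 0 < r 0 \<and>
     (\<forall>y\<in>points. \<forall>q\<in>points. near n y z (r 0) \<and> q + q = y + z \<longrightarrow> sat M y p = sat M q p))"
    unfolding cHalving_def
    by (rule repr_cong, (rule repr_ExV repr_AllV repr_Imp repr_Conj repr_Iff repr_Near repr_Pos
        repr_Half repr_formula | (simp; fail))+, (auto)?)
  moreover have "a + a = b + c \<longleftrightarrow> a = c + (1/2) * (b - c)" for a b c :: real by argo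
  then have "q + q = y + z \<longleftrightarrow> q = z + (1/2) *\<^sub>R (y - z)" for q y z :: "nat \<Rightarrow> real"
    by (simp only: fun_eq_iff plus_fun_apply scaleR_fun_apply minus_fun_apply' real_scaleR_def)
  ultimately have *: "repr S (cHalving n (fm_code p)) (\<lambda>e. \<forall>z\<in>points. \<exists>r\<in>points. 0 < r 0 \<and>
     (\<forall>y\<in>points. \<forall>q\<in>points. near n y z (r 0) \<and> q = z + (1/2) *\<^sub>R (y - z) \<longrightarrow> sat M y p = sat M q p))"
    by simp
  have mid: "z + (1/2) *\<^sub>R (y - z) \<in> points" if "y \<in> points" "z \<in> points" for y z
    using that by (intro supp_in_add supp_in_scale supp_in_diff)
  have "(\<forall>y\<in>points. \<forall>q\<in>points. near n y z r \<and> q = z + (1/2) *\<^sub>R (y - z) \<longrightarrow> sat M y p = sat M q p) \<longleftrightarrow>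
     (\<forall>y\<in>points. near n y z r \<longrightarrow> sat M y p = sat M (z + (1/2) *\<^sub>R (y - z)) p)" if "z \<in> points" for z r
    using mid[OF _ that] by blast
  then show ?thesis unfolding ex_scalar by (intro repr_cong[OF *]) (simp cong: ball_cong)
qed

lemma repr_Crit:
  "repr {} (cCrit n (fm_code p)) (\<lambda>e. (\<forall>J\<subseteq>{..<n}. finite (sing J)) \<and>
     (\<forall>z\<in>points. \<exists>r>0. \<forall>y\<in>points. near n y z r \<longrightarrow> sat M y p = sat M (z + (1/2) *\<^sub>R (y - z)) p))"
proof -
  have "repr {} (cCrit n (fm_code p)) (\<lambda>e. (\<forall>a\<in>points. finite (sing (sec a))) \<and>
     (\<forall>z\<in>points. \<exists>r>0. \<forall>y\<in>points. near n y z r \<longrightarrow> sat M y p = sat M (z + (1/2) *\<^sub>R (y - z)) p))"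
    unfolding cCrit_def
    by (rule repr_cong, (rule repr_AllV repr_Conj repr_Tame repr_Halving | (simp; fail))+, (auto)?)
  moreover have "(\<forall>a\<in>points. finite (sing (sec a))) \<longleftrightarrow> (\<forall>J\<subseteq>{..<n}. finite (sing J))"
  proof
    assume a: "\<forall>a\<in>points. finite (sing (sec a))"
    show "\<forall>J\<subseteq>{..<n}. finite (sing J)"
    proof (intro allI impI)
      fix J assume "J \<subseteq> {..<n}"
      then have "sec (\<lambda>i. if i < n \<and> i \<notin> J then 1 else 0) = J" by (auto simp: sec_def)
      moreover have "(\<lambda>i. if i < n \<and> i \<notin> J then 1 else 0) \<in> points" by (simp add: supp_in_def)
      ultimately show "finite (sing J)" using a by metis
    qed
  next
    assume "\<forall>J\<subseteq>{..<n}. finite (sing J)"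
    moreover have "sec a \<subseteq> {..<n}" for a by (auto simp: sec_def)
    ultimately show "\<forall>a\<in>points. finite (sing (sec a))" by blast
  qed
  ultimately show ?thesis by (simp only:)
qed

end

section \<open>Rationality and definability\<close>

context coded
begin

text \<open>From here on only the existence of a formula counts, not the way to compute it.\<close>

definition expr :: "nat set \<Rightarrow> ((nat \<Rightarrow> nat \<Rightarrow> real) \<Rightarrow> bool) \<Rightarrow> bool" where
  "expr S Q \<longleftrightarrow> (\<exists>c. repr S c Q)"

text \<open>Affine functions with rational coefficients. The language has neither subtraction nor
  fractions, so denominators are cleared by \<open>N\<close> and the function is split into a
  difference of two terms.\<close>

definition lin :: "nat set \<Rightarrow> ((nat \<Rightarrow> nat \<Rightarrow> real) \<Rightarrow> real) \<Rightarrow> bool" where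
  "lin S f \<longleftrightarrow> (\<exists>N>0. \<exists>s t g h. trepr S s g \<and> trepr S t h \<and> (\<forall>e. real N * f e = g e - h e))"

text \<open>Multiples start at one because there is no term for zero.\<close>

lemma trepr_mult: "trepr S s g \<Longrightarrow> \<exists>s'. trepr S s' (\<lambda>e. real (Suc m) * g e)"
proof (induction m)
  case (Suc m)
  then obtain s' where "trepr S s' (\<lambda>e. real (Suc m) * g e)" by blast
  from trepr_Add[OF this Suc.prems] have "trepr S (cAdd s' s) (\<lambda>e. real (Suc (Suc m)) * g e)"
    by (simp add: algebra_simps)
  then show ?case by blast
qed auto

lemma linI:
  assumes "0 < N" "trepr S s g" "trepr S t h" "\<And>e. real N * f e = g e - h e"
  shows "lin S f"
  unfolding lin_def using assms by blast

lemma lin_one: "lin S (\<lambda>e. 1)"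
  by (rule linI[OF zero_less_one trepr_Add[OF trepr_One trepr_One] trepr_One]) simp

lemma lin_zero: "lin S (\<lambda>e. 0)"
  by (rule linI[OF zero_less_one trepr_One trepr_One]) simp

lemma lin_coord: "k \<in> S \<Longrightarrow> i < n \<Longrightarrow> lin S (\<lambda>e. e k i)"
  by (rule linI[OF zero_less_one trepr_Add[OF trepr_V trepr_One] trepr_One]) simp_all

lemma lin_uminus: "lin S f \<Longrightarrow> lin S (\<lambda>e. - f e)"
proof -
  assume "lin S f"
  then obtain N s t g h where *: "0 < N" "trepr S s g" "trepr S t h" "\<And>e. real N * f e = g e - h e"
    unfolding lin_def by blast
  show ?thesis by (rule linI[OF *(1,3,2)]) (simp add: *(4))
qed

lemma lin_add:
  assumes "lin S f" "lin S f'"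
  shows "lin S (\<lambda>e. f e + f' e)"
proof -
  obtain N s t g h where 1: "0 < N" "trepr S s g" "trepr S t h" "\<And>e. real N * f e = g e - h e"
    using assms unfolding lin_def by blast
  obtain N' s' t' g' h' where 2: "0 < N'" "trepr S s' g'" "trepr S t' h'" "\<And>e. real N' * f' e = g' e - h' e"
    using assms unfolding lin_def by blast
  have m: "\<exists>s'. trepr S s' (\<lambda>e. real m * g e)" if "trepr S s g" "0 < m" for m s g
    using trepr_mult[OF that(1), of "m - 1"] that(2) by simp
  obtain a b a' b' where "trepr S a (\<lambda>e. real N' * g e)" "trepr S b (\<lambda>e. real N' * h e)"
    "trepr S a' (\<lambda>e. real N * g' e)" "trepr S b' (\<lambda>e. real N * h' e)"
    using m[OF 1(2) 2(1)] m[OF 1(3) 2(1)] m[OF 2(2) 1(1)] m[OF 2(3) 1(1)] by blast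
  note ab = this
  have sum: "trepr S (cAdd a a') (\<lambda>e. real N' * g e + real N * g' e)"
    "trepr S (cAdd b b') (\<lambda>e. real N' * h e + real N * h' e)"
    by (rule trepr_Add[OF ab(1,3)], rule trepr_Add[OF ab(2,4)])
  have "real (N * N') * (f e + f' e) = (real N' * g e + real N * g' e) - (real N' * h e + real N * h' e)" for e
  proof -
    have "real (N * N') * (f e + f' e) = real N' * (real N * f e) + real N * (real N' * f' e)"
      by (simp add: algebra_simps)
    then show ?thesis unfolding 1(4) 2(4) by (simp add: algebra_simps)
  qed
  moreover have "0 < N * N'" using 1 2 by simp
  ultimately show ?thesis using sum by (intro linI)
qed

lemma lin_scale:
  assumes "lin S f" "q \<in> \<rat>"
  shows "lin S (\<lambda>e. q * f e)"
proof -
  have nat: "lin S (\<lambda>e. real m * f e)" if "lin S f" for m f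
  proof (induction m)
    case (Suc m)
    from lin_add[OF that this] show ?case by (simp add: algebra_simps)
  qed (simp add: lin_zero)
  have divide: "lin S (\<lambda>e. f e / real m)" if f: "lin S f" and m: "0 < m" for m f
  proof -
    obtain N s t g h where *: "0 < N" "trepr S s g" "trepr S t h" "\<And>e. real N * f e = g e - h e"
      using f unfolding lin_def by blast
    have "real (N * m) * (f e / real m) = g e - h e" for e using *(4)[of e] m by simp
    moreover have "0 < N * m" using *(1) m by simp
    ultimately show ?thesis using *(2,3) by (intro linI)
  qed
  obtain m k where mk: "k \<noteq> 0" "\<bar>q\<bar> = real m / real k" using Rats_abs_nat_div_natE[OF assms(2)] by metis
  have abs: "lin S (\<lambda>e. \<bar>q\<bar> * f e)" using divide[OF nat[OF assms(1), of m], of k] mk by simp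
  show ?thesis
  proof (cases "0 \<le> q")
    case False
    with lin_uminus[OF abs] show ?thesis by simp
  qed (use abs in simp)
qed

lemma lin_diff: "lin S f \<Longrightarrow> lin S g \<Longrightarrow> lin S (\<lambda>e. f e - g e)"
  using lin_add[OF _ lin_uminus, of S f g] by simp

lemma lin_rat: "q \<in> \<rat> \<Longrightarrow> lin S (\<lambda>e. q)"
  using lin_scale[OF lin_one] by simp

lemma lin_sum: "finite I \<Longrightarrow> (\<And>i. i \<in> I \<Longrightarrow> lin S (f i)) \<Longrightarrow> lin S (\<lambda>e. \<Sum>i\<in>I. f i e)"
  by (induction I rule: finite_induct) (simp_all add: lin_zero lin_add)

lemma expr_pos: "lin S f \<Longrightarrow> expr S (\<lambda>e. 0 < f e)"
  and expr_zero: "lin S f \<Longrightarrow> expr S (\<lambda>e. f e = 0)"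
proof -
  assume "lin S f"
  then obtain N s t g h where *: "0 < N" "trepr S s g" "trepr S t h" "\<And>e. real N * f e = g e - h e"
    unfolding lin_def by blast
  have "repr S (cLess t s) (\<lambda>e. h e < g e)" "repr S (cEq s t) (\<lambda>e. g e = h e)"
    using * by (blast intro: repr_Less repr_Eq)+
  moreover have "h e < g e \<longleftrightarrow> 0 < f e" for e
  proof -
    have "h e < g e \<longleftrightarrow> 0 < real N * f e" unfolding *(4) by simp
    also have "\<dots> \<longleftrightarrow> 0 < f e" using *(1) by (simp add: zero_less_mult_iff)
    finally show ?thesis .
  qed
  moreover have "g e = h e \<longleftrightarrow> f e = 0" for e
  proof -
    have "g e = h e \<longleftrightarrow> real N * f e = 0" unfolding *(4) by simp
    then show ?thesis using *(1) by simp
  qed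
  ultimately show "expr S (\<lambda>e. 0 < f e)" "expr S (\<lambda>e. f e = 0)"
    unfolding expr_def by (simp_all only:) blast+
qed

lemma expr_not: "expr S Q \<Longrightarrow> expr S (\<lambda>e. \<not> Q e)"
  unfolding expr_def by (blast intro: repr_Neg)

lemma expr_and: "expr S Q \<Longrightarrow> expr S R \<Longrightarrow> expr S (\<lambda>e. Q e \<and> R e)"
  unfolding expr_def by (blast intro: repr_Conj)

lemma expr_imp: "expr S Q \<Longrightarrow> expr S R \<Longrightarrow> expr S (\<lambda>e. Q e \<longrightarrow> R e)"
  unfolding expr_def by (blast intro: repr_Imp)

lemma expr_iff: "expr S Q \<Longrightarrow> expr S R \<Longrightarrow> expr S (\<lambda>e. Q e = R e)"
  unfolding expr_def by (blast intro: repr_Iff)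

lemma expr_ex: "expr (insert k S) Q \<Longrightarrow> expr S (\<lambda>e. \<exists>x\<in>pts. Q (e(k := x)))"
  unfolding expr_def by (blast intro: repr_ExV)

lemma expr_all: "expr (insert k S) Q \<Longrightarrow> expr S (\<lambda>e. \<forall>x\<in>pts. Q (e(k := x)))"
  unfolding expr_def by (blast intro: repr_AllV)

lemma expr_cong: "expr S Q \<Longrightarrow> (\<And>e. (\<And>k. e k \<in> pts) \<Longrightarrow> Q e = Q' e) \<Longrightarrow> expr S Q'"
  unfolding expr_def using repr_cong by (elim exE) blast

lemma expr_const: "expr S (\<lambda>e. b)"
proof (cases b)
  case True
  show ?thesis by (rule expr_cong[OF expr_zero[OF lin_zero]]) (use True in simp)
next
  case False
  show ?thesis by (rule expr_cong[OF expr_zero[OF lin_one]]) (use False in simp)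
qed

lemma expr_or: "expr S Q \<Longrightarrow> expr S R \<Longrightarrow> expr S (\<lambda>e. Q e \<or> R e)"
  using expr_imp[OF expr_not, of S Q R] by (simp add: disj_imp)

lemma expr_alls:
  assumes "\<And>i. i < n \<Longrightarrow> expr S (P i)"
  shows "expr S (\<lambda>e. \<forall>i<n. P i e)"
proof -
  have "\<forall>i. \<exists>c. i < n \<longrightarrow> repr S c (P i)" using assms unfolding expr_def by blast
  then obtain F where "\<And>i. i < n \<Longrightarrow> repr S (F i) (P i)" by metis
  then have "repr S (cAlls n F) (\<lambda>e. \<forall>i<n. P i e)" by (rule repr_Alls)
  then show ?thesis unfolding expr_def by blast
qed

text \<open>A property that depends only on the truth values of finitely many expressible ones is a
  Boolean combination of them. This turns a statement about sign patterns into a formula without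
  exhibiting it.\<close>

lemma expr_determined:
  assumes "finite A" "\<And>Q. Q \<in> A \<Longrightarrow> expr S Q"
    and "\<And>e e'. (\<And>k. e k \<in> pts) \<Longrightarrow> (\<And>k. e' k \<in> pts) \<Longrightarrow> (\<And>Q. Q \<in> A \<Longrightarrow> Q e = Q e') \<Longrightarrow> D e = D e'"
  shows "expr S D"
  using assms
proof (induction A arbitrary: D)
  case empty
  define z :: "nat \<Rightarrow> nat \<Rightarrow> real" where "z k = 0" for k
  have "z k \<in> pts" for k by (simp add: z_def supp_in_zero)
  then have *: "D z = D e" if "\<And>k. e k \<in> pts" for e
    using that by (intro empty.prems(2)) auto
  show ?case by (rule expr_cong[OF expr_const[of S "D z"]]) (rule *)
next
  case (insert P A)
  \<comment> \<open>Can \<open>D\<close> hold when \<open>P\<close> has the value \<open>b\<close>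
    and the properties in \<open>A\<close> have their values at \<open>e\<close>? This depends on
    \<open>A\<close> alone, so the induction hypothesis applies, and for \<open>b = P e\<close> it
    is equivalent to \<open>D e\<close>.\<close>
  define D' where "D' b e = (\<exists>e'. (\<forall>k. e' k \<in> pts) \<and> P e' = b \<and> (\<forall>Q\<in>A. Q e' = Q e) \<and> D e')" for b e
  have D': "expr S (D' b)" for b
  proof (rule insert.IH)
    fix e e' :: "nat \<Rightarrow> nat \<Rightarrow> real" assume "\<And>Q. Q \<in> A \<Longrightarrow> Q e = Q e'"
    then have "(\<forall>Q\<in>A. Q e'' = Q e) \<longleftrightarrow> (\<forall>Q\<in>A. Q e'' = Q e')" for e'' by blast
    then show "D' b e = D' b e'" unfolding D'_def by (simp only:)
  qed (use insert.prems(1) in simp)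
  have P: "expr S P" using insert.prems(1) by simp
  have "expr S (\<lambda>e. (P e \<and> D' True e) \<or> (\<not> P e \<and> D' False e))"
    by (intro expr_or expr_and expr_not P D')
  then show ?case
  proof (rule expr_cong)
    fix e :: "nat \<Rightarrow> nat \<Rightarrow> real" assume e: "\<And>k. e k \<in> pts"
    have "D' (P e) e = D e"
    proof
      assume "D' (P e) e"
      then obtain e' where e': "\<forall>k. e' k \<in> pts" "P e' = P e" "\<forall>Q\<in>A. Q e' = Q e" "D e'"
        unfolding D'_def by blast
      have "D e = D e'" by (rule insert.prems(2)) (use e e' in auto)
      then show "D e" using e'(4) by simp
    qed (use e in \<open>auto simp: D'_def\<close>)
    then show "((P e \<and> D' True e) \<or> (\<not> P e \<and> D' False e)) = D e" by (cases "P e") simp_all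
  qed
qed

lemma expr_box:
  assumes "k \<in> S" "\<And>i. a i \<in> \<rat>" "\<And>i. b i \<in> \<rat>"
  shows "expr S (\<lambda>e. \<forall>i<n. a i < e k i \<and> e k i < b i)"
proof (rule expr_alls)
  fix i assume i: "i < n"
  have "expr S (\<lambda>e. 0 < e k i - a i \<and> 0 < b i - e k i)"
    by (intro expr_and expr_pos lin_diff lin_coord lin_rat assms i)
  then show "expr S (\<lambda>e. a i < e k i \<and> e k i < b i)" by simp
qed

lemma expr_definable:
  assumes "expr {0} (\<lambda>e. Q (e 0))"
  shows "definable M n {xs. length xs = n \<and> Q (\<lambda>i. if i < n then xs ! i else 0)}"
proof -
  obtain p where p: "wf_fm M p" "fv p \<subseteq> vars {0}" "\<And>v. sat M v p = Q (block v 0)"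
    using assms unfolding expr_def repr_def by blast
  have "formula_in M n p" using p(1,2) by (auto simp: formula_in_def vars_def)
  moreover have "{xs. length xs = n \<and> Q (\<lambda>i. if i < n then xs ! i else 0)} = defined_rel M n p"
  proof -
    have "block (\<lambda>i. xs ! i) 0 = (\<lambda>i. if i < n then xs ! i else 0)" for xs
      by (rule ext) (simp add: block_def)
    then show ?thesis by (simp add: defined_rel_def p(3))
  qed
  ultimately show ?thesis using n_pos unfolding definable_def by blast
qed

end

lemma rational_box:
  assumes "x \<in> supp_in {..<n}" "0 < e"
  shows "\<exists>a b. (\<forall>i. a i \<in> \<rat> \<and> b i \<in> \<rat>) \<and> (\<forall>i<n. a i < x i \<and> x i < b i) \<and>
    (\<forall>y. (\<forall>i<n. a i < y i \<and> y i < b i) \<longrightarrow> near n y x e)"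
proof -
  have "\<exists>a\<in>\<rat>. x i - e < a \<and> a < x i" "\<exists>b\<in>\<rat>. x i < b \<and> b < x i + e" for i
    using Rats_dense_in_real[of "x i - e" "x i"] Rats_dense_in_real[of "x i" "x i + e"] assms by auto
  then obtain a b where ab: "\<And>i. a i \<in> \<rat>" "\<And>i. x i - e < a i" "\<And>i. a i < x i"
    "\<And>i. b i \<in> \<rat>" "\<And>i. x i < b i" "\<And>i. b i < x i + e" by metis
  have "near n y x e" if "\<forall>i<n. a i < y i \<and> y i < b i" for y
    unfolding near_def
  proof (intro allI impI)
    fix i assume "i < n"
    then show "\<bar>y i - x i\<bar> < e" using that ab(2)[of i] ab(6)[of i] by force
  qed
  then show ?thesis using ab by blast
qed

lemma box_open:
  assumes "\<forall>i<n. a i < x i \<and> x i < (b i :: real)"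
  shows "\<exists>d>0. \<forall>y. near n y x d \<longrightarrow> (\<forall>i<n. a i < y i \<and> y i < b i)"
proof -
  have "\<exists>d>0. \<forall>i\<in>{..<n}. \<forall>y. \<bar>y i - x i\<bar> < d \<longrightarrow> a i < y i \<and> y i < b i"
  proof (rule finite_radius)
    fix i assume "i \<in> {..<n}"
    then show "\<exists>d>0. \<forall>y. \<bar>y i - x i\<bar> < d \<longrightarrow> a i < y i \<and> y i < b i"
      using assms by (intro exI[of _ "min (x i - a i) (b i - x i)"]) (auto simp: abs_less_iff)
  qed (simp, meson order_less_le_trans)
  then show ?thesis by (auto simp: near_def)
qed

section \<open>Sufficiency of the criterion through rational flats\<close>

locale criterion = coded_formula +
  assumes rational: "\<And>m Y. definable M m Y \<Longrightarrow> Y \<noteq> {} \<Longrightarrow> \<exists>xs\<in>Y. set xs \<subseteq> \<rat>"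
    and finite_sing: "J \<subseteq> {..<n} \<Longrightarrow> finite (sing J)"
    and half: "z \<in> points \<Longrightarrow> \<exists>r>0. \<forall>y\<in>points. near n y z r \<longrightarrow> sat M y p = sat M (z + (1/2) *\<^sub>R (y - z)) p"
begin

text \<open>Only the unconditional implication \<open>nonsing_imp_inv\<close> is used, so finiteness
  of the first-order sets \<open>sing J\<close> transfers to the geometric set
  \<open>apex\<close>.\<close>

lemma apex_subset_sing: "apex \<subseteq> (\<Union>J\<in>Pow {..<n}. sing J)"
proof
  fix x assume "x \<in> apex"
  then obtain J where J: "J \<subseteq> {..<n}" "x \<in> supp_in J" "inv_space J x = {0}" unfolding apex_def by blast
  then have "\<not> nonsing J x" using nonsing_imp_inv[OF J(1)] by blast
  then show "x \<in> (\<Union>J\<in>Pow {..<n}. sing J)" using J unfolding sing_def by blast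
qed

sublocale tame_relation n "\<lambda>x. sat M x p"
proof
  show "finite apex"
    using finite_subset[OF apex_subset_sing] finite_sing by blast
qed (rule half)

lemma rational_point:
  assumes "expr {0} (\<lambda>e. Q (e 0))" "x \<in> points" "Q x"
  shows "\<exists>y\<in>points. Q y \<and> (\<forall>i. y i \<in> \<rat>)"
proof -
  let ?Y = "{xs. length xs = n \<and> Q (\<lambda>i. if i < n then xs ! i else 0)}"
  have "(\<lambda>i. if i < n then map x [0..<n] ! i else 0) = x"
    using assms(2) by (auto simp: supp_in_def)
  then have "map x [0..<n] \<in> ?Y" using assms(3) by simp
  then obtain xs where xs: "length xs = n" "Q (\<lambda>i. if i < n then xs ! i else 0)" "set xs \<subseteq> \<rat>"
    using rational[OF expr_definable[OF assms(1)]] by blast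
  let ?y = "\<lambda>i. if i < n then xs ! i else 0"
  have "?y \<in> points" by (simp add: supp_in_def)
  moreover have "?y i \<in> \<rat>" for i using xs(1,3) nth_mem by auto
  ultimately show ?thesis using xs(2) by blast
qed

lemma expr_formula: "k \<in> S \<Longrightarrow> k \<noteq> 0 \<Longrightarrow> expr S (\<lambda>e. sat M (e k) p)"
  using repr_formula unfolding expr_def by blast

text \<open>An apex is isolated in the finite set \<open>sing J\<close>. A small box with rational
  corners cuts out just this point, and the resulting definable set must contain a rational
  point.\<close>

lemma apex_rational:
  assumes "x \<in> apex" shows "x i \<in> \<rat>"
proof -
  obtain J where J: "J \<subseteq> {..<n}" "x \<in> sing J" using apex_subset_sing assms by blast
  have sp: "sing J \<subseteq> points" using supp_in_mono[OF J(1)] by (auto simp: sing_def)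
  then have xp: "x \<in> points" using J by blast
  obtain d where d: "d > 0" "\<forall>y\<in>sing J. y \<noteq> x \<longrightarrow> \<not> near n y x d"
    using finite_iff_bounded_discrete[OF sp] finite_sing[OF J(1)] xp by blast
  obtain a b where ab: "\<And>i. a i \<in> \<rat>" "\<And>i. b i \<in> \<rat>" "\<forall>i<n. a i < x i \<and> x i < b i"
    "\<And>y. \<forall>i<n. a i < y i \<and> y i < b i \<Longrightarrow> near n y x d"
    using rational_box[OF xp d(1)] by blast
  \<comment> \<open>The vector coding \<open>J\<close>. Its entries are 0 and 1, so it can be pinned
    down without parameters.\<close>
  define \<chi> :: "nat \<Rightarrow> real" where "\<chi> i = (if i < n \<and> i \<notin> J then 1 else 0)" for i
  have \<chi>: "\<chi> \<in> points" "sec \<chi> = J" using J(1) by (auto simp: \<chi>_def supp_in_def sec_def)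
  have "expr {1, 0} (\<lambda>e. \<forall>i<n. e 1 i - \<chi> i = 0)"
    by (intro expr_alls expr_zero lin_diff lin_coord lin_rat) (auto simp: \<chi>_def)
  moreover have "expr {1, 0} (\<lambda>e. e 0 \<in> sing (sec (e 1)))"
    using repr_Sing[of "{1, 0}"] unfolding expr_def by blast
  ultimately have "expr {0} (\<lambda>e. \<exists>c\<in>pts. (\<forall>i<n. (e(1 := c)) 1 i - \<chi> i = 0) \<and> (e(1 := c)) 0 \<in> sing (sec ((e(1 := c)) 1)))"
    by (intro expr_ex expr_and)
  moreover have "(\<exists>c\<in>pts. (\<forall>i<n. (e(1 := c)) 1 i - \<chi> i = 0) \<and> (e(1 := c)) 0 \<in> sing (sec ((e(1 := c)) 1)))
     \<longleftrightarrow> e 0 \<in> sing J" for e :: "nat \<Rightarrow> nat \<Rightarrow> real"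
  proof -
    have "(\<forall>i<n. c i - \<chi> i = 0) \<longleftrightarrow> c = \<chi>" if "c \<in> pts" for c
      using points_eq_iff[OF that \<chi>(1)] by simp
    then have "(\<exists>c\<in>pts. (\<forall>i<n. c i - \<chi> i = 0) \<and> e 0 \<in> sing (sec c)) \<longleftrightarrow> (\<exists>c\<in>pts. c = \<chi> \<and> e 0 \<in> sing (sec c))"
      by (intro bex_cong refl conj_cong)
    also have "\<dots> \<longleftrightarrow> e 0 \<in> sing J" using \<chi> by blast
    finally have "(\<exists>c\<in>pts. (\<forall>i<n. c i - \<chi> i = 0) \<and> e 0 \<in> sing (sec c)) \<longleftrightarrow> e 0 \<in> sing J" .
    moreover have "(e(1 := c)) 1 = c" "(e(1 := c)) 0 = e 0" for c by simp_all
    ultimately show ?thesis by (simp only:)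
  qed
  ultimately have "expr {0} (\<lambda>e. e 0 \<in> sing J)" by (simp only:)
  then have "expr {0} (\<lambda>e. e 0 \<in> sing J \<and> (\<forall>i<n. a i < e 0 i \<and> e 0 i < b i))"
    by (intro expr_and expr_box ab) simp_all
  from rational_point[OF this xp] J(2) ab(3)
  obtain y where y: "y \<in> sing J" "near n y x d" "\<forall>i. y i \<in> \<rat>" using ab(4) by blast
  then have "y = x" using d(2) by blast
  then show ?thesis using y(3) by simp
qed

text \<open>The point \<open>x\<close> may be irrational, so its direction space is described by
  invariance on a rational box around it. Among the small vectors with prescribed rational pivot
  coordinates, the multiple \<open>\<sigma>\<close> of \<open>w i\<close> is the only one leaving
  \<open>X\<close> invariant on the box; hence it is rational.\<close>

lemma dirs_rational:
  assumes x: "x \<in> points" and w: "basis_of n (dirs x) I w" and i: "i \<in> I"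
  shows "w i j \<in> \<rat>"
proof -
  have I: "I \<subseteq> {..<n}" and ech: "echelon n (dirs x) I w" using w by (auto simp: basis_of_def echelon_def)
  have wi: "w i \<in> dirs x" and wI: "\<And>j. j \<in> I \<Longrightarrow> w i j = (if j = i then 1 else 0)"
    using ech i by (auto simp: echelon_def)
  obtain \<rho> where \<rho>: "\<rho> > 0" "\<forall>y\<in>points. near n y x \<rho> \<longrightarrow> (\<forall>t. 0 < t \<and> t \<le> 1 \<longrightarrow> sat M y p = sat M (x + t *\<^sub>R (y - x)) p)"
    using conical[OF x] by blast
  obtain r where r: "r > 0" "\<forall>y\<in>points. near n y x r \<longrightarrow> (\<forall>v\<in>dirs x. near n v 0 r \<longrightarrow> sat M y p = sat M (y + v) p)"
    using uniform_radius by blast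
  obtain a b where ab: "\<And>i. a i \<in> \<rat>" "\<And>i. b i \<in> \<rat>" "\<forall>i<n. a i < x i \<and> x i < b i"
    "\<And>y. \<forall>i<n. a i < y i \<and> y i < b i \<Longrightarrow> near n y x r"
    using rational_box[OF x r(1)] by blast
  obtain \<eta> where \<eta>: "\<eta> > 0" "\<And>y. near n y x \<eta> \<Longrightarrow> \<forall>i<n. a i < y i \<and> y i < b i"
    using box_open[OF ab(3)] by blast
  \<comment> \<open>Rational, because it occurs as a bound in \<open>Q\<close>; below
    \<open>\<rho>/2\<close>, so that a shift by \<open>u\<close> stays in the ball where
    \<open>X\<close> is conical.\<close>
  obtain \<delta> where \<delta>: "\<delta> \<in> \<rat>" "0 < \<delta>" "\<delta> < min r (\<rho>/2)"
    using Rats_dense_in_real[of 0 "min r (\<rho>/2)"] r \<rho> by auto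
  obtain d where d: "0 < d" "\<And>t. \<bar>t\<bar> < d \<Longrightarrow> near n (t *\<^sub>R w i) 0 \<delta>"
    using near_scale_ex[OF \<delta>(2), of n "w i"] by blast
  obtain \<sigma> where \<sigma>: "\<sigma> \<in> \<rat>" "0 < \<sigma>" "\<sigma> < d" using Rats_dense_in_real[OF d(1)] by blast
  define Q where "Q u \<longleftrightarrow> (\<forall>y\<in>points. (\<forall>i<n. a i < y i \<and> y i < b i) \<longrightarrow> sat M y p = sat M (y + u) p) \<and>
    (\<forall>j<n. - \<delta> < u j \<and> u j < \<delta>) \<and> (\<forall>j<n. j \<in> I \<longrightarrow> u j - (if j = i then \<sigma> else 0) = 0)" for u
  have expr_sum: "expr {3, 2, 0} (\<lambda>e. e 3 = e 2 + e 0)"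
    using repr_Sum[of 3 "{3, 2, 0}" 2 0] unfolding expr_def by blast
  \<comment> \<open>The formula can be evaluated only at blocks other than 0, so \<open>y\<close>
    and its translate by block 0 are stored in blocks 2 and 3.\<close>
  have "expr {0} (\<lambda>e. \<forall>y\<in>pts. (\<forall>i<n. a i < (e(2 := y)) 2 i \<and> (e(2 := y)) 2 i < b i) \<longrightarrow>
     (\<forall>q\<in>pts. (e(2 := y, 3 := q)) 3 = (e(2 := y, 3 := q)) 2 + (e(2 := y, 3 := q)) 0 \<longrightarrow>
        sat M ((e(2 := y, 3 := q)) 2) p = sat M ((e(2 := y, 3 := q)) 3) p))"
    by (intro expr_all expr_imp expr_box expr_iff expr_formula expr_sum ab) simp_all
  then have "expr {0} (\<lambda>e. \<forall>y\<in>points. (\<forall>i<n. a i < y i \<and> y i < b i) \<longrightarrow> sat M y p = sat M (y + e 0) p)"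
    by (rule expr_cong) (simp add: supp_in_add)
  moreover have "expr {0} (\<lambda>e. \<forall>j<n. - \<delta> < e 0 j \<and> e 0 j < \<delta>)"
    using expr_box[of 0 "{0}" "\<lambda>i. - \<delta>" "\<lambda>i. \<delta>"] \<delta> by simp
  moreover have "expr {0} (\<lambda>e. \<forall>j<n. j \<in> I \<longrightarrow> e 0 j - (if j = i then \<sigma> else 0) = 0)"
    by (intro expr_alls expr_imp expr_const expr_zero lin_diff lin_coord lin_rat) (use \<sigma> in auto)
  ultimately have eQ: "expr {0} (\<lambda>e. Q (e 0))" unfolding Q_def by (intro expr_and)
  have sw: "\<sigma> *\<^sub>R w i \<in> dirs x" by (rule dirs_scale[OF wi])
  have nsw: "near n (\<sigma> *\<^sub>R w i) 0 \<delta>" using d(2)[of \<sigma>] \<sigma> by simp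
  have "Q (\<sigma> *\<^sub>R w i)"
    unfolding Q_def
  proof (intro conjI ballI impI allI)
    fix y assume "y \<in> points" "\<forall>i<n. a i < y i \<and> y i < b i"
    moreover have "near n (\<sigma> *\<^sub>R w i) 0 r" by (rule near_mono[OF nsw]) (use \<delta> in simp)
    ultimately show "sat M y p = sat M (y + \<sigma> *\<^sub>R w i) p" using r(2) ab(4) sw by blast
  qed (use nsw wI in \<open>auto simp: near_def abs_less_iff\<close>)
  then obtain u where u: "u \<in> points" "Q u" "\<And>i. u i \<in> \<rat>"
    using rational_point[OF eQ] sw dirs_points by blast
  have "u \<in> dirs x"
  \<comment> \<open>Invariance under the single vector \<open>u\<close> on the box, hence on a ball
    around \<open>x\<close>, already makes \<open>u\<close> a direction since \<open>X\<close> is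
    conical at \<open>x\<close>.\<close>
  proof (rule conical_inv[OF order.refl x u(1), of \<rho> "min \<eta> (\<rho>/2)" \<delta>])
    fix y assume "y \<in> points" "near n y x (min \<eta> (\<rho>/2))"
    then show "sat M y p = sat M (y + u) p"
      using u(2) \<eta>(2)[OF near_mono] unfolding Q_def by (meson min.cobounded1)
  next
    show "near n u 0 \<delta>" using u(2) by (auto simp: Q_def near_def abs_less_iff)
  qed (use \<rho> \<eta> \<delta> in auto)
  then have "u = (\<Sum>j\<in>I. u j *\<^sub>R w j)" using w by (auto simp: basis_of_def)
  also have "\<dots> = (\<Sum>j\<in>I. if j = i then \<sigma> *\<^sub>R w i else 0)"
  proof (rule sum.cong[OF refl])
    fix j assume "j \<in> I"
    then have "u j = (if j = i then \<sigma> else 0)" using u(2) I by (auto simp: Q_def)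
    then show "u j *\<^sub>R w j = (if j = i then \<sigma> *\<^sub>R w i else 0)" by simp
  qed
  also have "\<dots> = \<sigma> *\<^sub>R w i" using i basis_finite[OF w] by simp
  finally have "u j = \<sigma> * w i j" by simp
  then have "w i j = u j / \<sigma>" using \<sigma> by simp
  then show ?thesis using u(3)[of j] \<sigma>(1) by (simp add: Rats_divide)
qed

text \<open>\<open>X\<close> is determined by the signs of the equations of the finitely many flats
  \<open>p + L\<close> with \<open>p\<close> an apex and \<open>L\<close> a direction space. If two
  points have equal signs, every flat that passes through a point of the segment between them
  contains both ends, so the segment runs along directions of \<open>X\<close>.\<close>

lemma real_add_expr: "coded.expr real_add n {0} (\<lambda>e. sat M (e 0) p)"
proof -
  interpret R: coded real_add n using n_pos expansion_refl by unfold_locales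
  have "\<exists>I w. basis_of n L I w" if "L \<in> dirs ` points" for L
    using that basis_exists subspace_inv_space dirs_points by blast
  then obtain I w where basis: "\<And>L. L \<in> dirs ` points \<Longrightarrow> basis_of n L (I L) (w L)" by metis
  \<comment> \<open>The \<open>j\<close>-th equation of the flat \<open>x + L\<close>. Its
    coefficients are rational by \<open>apex_rational\<close> and
    \<open>dirs_rational\<close>.\<close>
  define f where "f L x j u = (u j - x j) - (\<Sum>i\<in>I L. w L i j * (u i - x i))"
    for L :: "(nat \<Rightarrow> real) set" and x :: "nat \<Rightarrow> real" and j and u :: "nat \<Rightarrow> real"
  have mem: "u - x \<in> L \<longleftrightarrow> (\<forall>j<n. f L x j u = 0)"
    if "L \<in> dirs ` points" "x \<in> points" "u \<in> points" for L x u
  proof -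
    have "u - x \<in> L \<longleftrightarrow> (\<forall>j<n. (u - x) j = (\<Sum>i\<in>I L. (u - x) i * w L i j))"
      by (rule basis_mem_iff) (use that subspace_inv_space dirs_points basis in \<open>auto intro: supp_in_diff\<close>)
    then show ?thesis by (simp add: f_def mult.commute)
  qed
  have aff: "f L x j (u + t *\<^sub>R (v - u)) = (1 - t) * f L x j u + t * f L x j v" for L x j u v t
  proof -
    have "(\<Sum>i\<in>I L. w L i j * ((u + t *\<^sub>R (v - u)) i - x i)) =
      (\<Sum>i\<in>I L. (1 - t) * (w L i j * (u i - x i)) + t * (w L i j * (v i - x i)))"
      by (rule sum.cong) (simp_all add: algebra_simps)
    then show ?thesis
      by (simp add: f_def sum.distrib sum_distrib_left[symmetric]) (simp add: algebra_simps)
  qed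
  define K where "K = dirs ` points \<times> apex \<times> {..<n}"
  have finK: "finite K" using finite_dirs finite_apex by (simp add: K_def)
  define A where "A = (\<lambda>(L, x, j). \<lambda>e. 0 < f L x j (e (0::nat))) ` K \<union> (\<lambda>(L, x, j). \<lambda>e. f L x j (e (0::nat)) = 0) ` K"
  show ?thesis
  proof (rule R.expr_determined[of A])
    show "finite A" using finK by (simp add: A_def)
    fix Q assume "Q \<in> A"
    then obtain L x j where Lxj: "(L, x, j) \<in> K"
      and Q: "Q = (\<lambda>e. 0 < f L x j (e 0)) \<or> Q = (\<lambda>e. f L x j (e 0) = 0)" by (auto simp: A_def)
    have L: "L \<in> dirs ` points" "x \<in> apex" "j < n" using Lxj by (auto simp: K_def)
    note b = basis[OF L(1)]
    have IL: "I L \<subseteq> {..<n}" using b by (auto simp: basis_of_def echelon_def)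
    have rat: "w L i j \<in> \<rat>" if "i \<in> I L" for i using dirs_rational b that L(1) by blast
    have "R.lin {0} (\<lambda>e. f L x j (e 0))"
      unfolding f_def
      by (intro R.lin_diff R.lin_sum R.lin_scale R.lin_coord R.lin_rat basis_finite[OF b] apex_rational L rat)
        (use IL in auto)
    then show "R.expr {0} Q" using Q R.expr_pos R.expr_zero by blast
  next
    fix e e' :: "nat \<Rightarrow> nat \<Rightarrow> real"
    assume e: "\<And>k. e k \<in> points" "\<And>k. e' k \<in> points" and eq: "\<And>Q. Q \<in> A \<Longrightarrow> Q e = Q e'"
    have same: "0 < f L x j (e 0) \<longleftrightarrow> 0 < f L x j (e' 0)" "f L x j (e 0) = 0 \<longleftrightarrow> f L x j (e' 0) = 0"
      if "(L, x, j) \<in> K" for L x j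
    proof -
      have "(\<lambda>e. 0 < f L x j (e 0)) \<in> A" "(\<lambda>e. f L x j (e 0) = 0) \<in> A"
        using that by (force simp: A_def)+
      from eq[OF this(1)] eq[OF this(2)]
      show "0 < f L x j (e 0) \<longleftrightarrow> 0 < f L x j (e' 0)" "f L x j (e 0) = 0 \<longleftrightarrow> f L x j (e' 0) = 0" .
    qed
    show "sat M (e 0) p = sat M (e' 0) p"
    proof (rule segment_const[OF e])
      fix t :: real assume t: "0 \<le> t" "t \<le> 1"
      let ?u = "e 0 + t *\<^sub>R (e' 0 - e 0)"
      have up: "?u \<in> points" using e by (intro supp_in_add supp_in_scale supp_in_diff)
      obtain x where x: "x \<in> apex" "?u - x \<in> dirs ?u" using flat_apex[OF up] by blast
      have xp: "x \<in> points" using x apex_points by blast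
      have L: "dirs ?u \<in> dirs ` points" using up by blast
      \<comment> \<open>On the segment the equation takes a convex combination of its end values.
        These have the same sign, so the combination vanishes only if both do.\<close>
      have "f (dirs ?u) x j (e 0) = 0 \<and> f (dirs ?u) x j (e' 0) = 0" if j: "j < n" for j
      proof -
        let ?a = "f (dirs ?u) x j (e 0)" and ?b = "f (dirs ?u) x j (e' 0)"
        have "(dirs ?u, x, j) \<in> K" using L x j by (simp add: K_def)
        note s = same[OF this]
        have z: "(1 - t) * ?a + t * ?b = 0" using mem[OF L xp up] x j aff by simp
        have "?a = 0"
        proof (rule ccontr)
          assume a: "?a \<noteq> 0"
          show False
          proof (cases "0 < ?a")
            case True
            then have "0 < (1 - t) * ?a + t * ?b"
              using s t by (cases "t = 0") (auto intro: add_nonneg_pos mult_nonneg_nonneg)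
            then show False using z by simp
          next
            case False
            then have "?a < 0" "?b < 0" using a s by auto
            have "(1 - t) * ?a + t * ?b < 0"
            proof (cases "t = 0")
              case False
              then have "t * ?b < 0" using t \<open>?b < 0\<close> by (intro mult_pos_neg) auto
              moreover have "(1 - t) * ?a \<le> 0" using t \<open>?a < 0\<close> by (intro mult_nonneg_nonpos) auto
              ultimately show ?thesis by linarith
            qed (use \<open>?a < 0\<close> in simp)
            then show False using z by simp
          qed
        qed
        then show ?thesis using s by simp
      qed
      then have "e 0 - x \<in> dirs ?u" "e' 0 - x \<in> dirs ?u" using mem[OF L xp] e by auto
      from subspace_diff[OF subspace_inv_space this(2,1)] show "e' 0 - e 0 \<in> dirs ?u" by simp
    qed
  qed
qed

end

section \<open>Equivalence of the criterion with definability\<close>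

context coded_formula
begin

text \<open>Entries beyond the end of a list are unspecified; since the free variables are below
  \<open>n\<close>, they can be replaced by zeros, which turns lists into points.\<close>

lemma defined_rel_points:
  "defined_rel M n p = {xs. length xs = n \<and> sat M (\<lambda>i. if i < n then xs ! i else 0) p}"
proof -
  have "sat M (\<lambda>i. xs ! i) p = sat M (\<lambda>i. if i < n then xs ! i else 0) p" for xs
    by (rule sat_cong) (use fv in auto)
  then show ?thesis by (simp add: defined_rel_def)
qed

text \<open>The rationality hypothesis enters only in the direction from the criterion to
  definability; the other direction is quantifier elimination.\<close>

theorem crit_iff_definable:
  assumes rational: "\<And>m Y. definable M m Y \<Longrightarrow> Y \<noteq> {} \<Longrightarrow> \<exists>xs\<in>Y. set xs \<subseteq> \<rat>"
  shows "((\<forall>J\<subseteq>{..<n}. finite (sing J)) \<and>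
     (\<forall>z\<in>points. \<exists>r>0. \<forall>y\<in>points. near n y z r \<longrightarrow> sat M y p = sat M (z + (1/2) *\<^sub>R (y - z)) p))
    \<longleftrightarrow> definable real_add n (defined_rel M n p)"
    (is "?C \<longleftrightarrow> ?D")
proof
  assume ?C
  then interpret criterion M n p using rational by unfold_locales blast+
  interpret R: coded real_add n using n_pos expansion_refl by unfold_locales
  show ?D unfolding defined_rel_points using R.expr_definable[OF real_add_expr] .
next
  assume ?D
  then obtain q where q: "formula_in real_add n q" "defined_rel M n p = defined_rel real_add n q"
    unfolding definable_def by blast
  then interpret R: coded_formula real_add n q
    using n_pos expansion_refl by unfold_locales (auto simp: formula_in_def)
  have eq: "sat M x p = sat real_add x q" if x: "x \<in> points" for x
  proof -
    have xs: "(\<lambda>i. if i < n then map x [0..<n] ! i else 0) = x" using x by (auto simp: supp_in_def)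
    have "sat M x p \<longleftrightarrow> map x [0..<n] \<in> defined_rel M n p"
      unfolding defined_rel_points mem_Collect_eq xs by simp
    also have "\<dots> \<longleftrightarrow> sat real_add x q"
      unfolding q(2) R.defined_rel_points mem_Collect_eq xs by simp
    finally show ?thesis .
  qed
  obtain H where "sgn_det_by H (\<lambda>v. sat real_add v q)"
    using real_add_sgn_determined q(1) unfolding formula_in_def sgn_determined_def by blast
  note H = sgn_det_byD[OF this]
  have lin: "linear g" if "(g, d) \<in> H" for g d using H(2)[OF that] by simp
  have det: "sat M x p = sat M y p" if "x \<in> points" "y \<in> points"
    "\<And>g d. (g, d) \<in> H \<Longrightarrow> sgn (g x + d) = sgn (g y + d)" for x y
    unfolding eq[OF that(1)] eq[OF that(2)] by (rule H(3)) (use that(3) in \<open>metis prod.collapse\<close>)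
  show ?C
  proof (intro conjI allI impI ballI)
    fix J assume J: "J \<subseteq> {..<n}"
    show "finite (sing J)" by (rule sgn_det_finite_sing[OF H(1) lin det J])
  next
    fix z assume z: "z \<in> points"
    show "\<exists>r>0. \<forall>y\<in>points. near n y z r \<longrightarrow> sat M y p = sat M (z + (1/2) *\<^sub>R (y - z)) p"
      by (rule sgn_det_halving[OF H(1) lin det z])
  qed
qed

end

section \<open>Computability of the criterion\<close>

text \<open>Closes \<open>recursive\<close> under changing values on lists of the wrong length, so
  that functions can be replaced by equal ones freely.\<close>

definition Rec :: "nat \<Rightarrow> (nat list \<Rightarrow> nat) \<Rightarrow> bool" where
  "Rec m f \<longleftrightarrow> (\<exists>g. recursive m g \<and> (\<forall>xs. length xs = m \<longrightarrow> g xs = f xs))"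

lemma Rec_cong: "Rec m f \<Longrightarrow> (\<And>xs. length xs = m \<Longrightarrow> f xs = g xs) \<Longrightarrow> Rec m g"
  unfolding Rec_def by metis

lemma Rec_proj: "i < m \<Longrightarrow> Rec m (\<lambda>xs. xs ! i)"
  unfolding Rec_def using recursive.proj by blast

lemma Rec_comp:
  assumes h: "Rec (length gs) h" and gs: "\<And>g. g \<in> set gs \<Longrightarrow> Rec m g"
  shows "Rec m (\<lambda>xs. h (map (\<lambda>g. g xs) gs))"
proof -
  obtain h' where h': "recursive (length gs) h'" "\<And>xs. length xs = length gs \<Longrightarrow> h' xs = h xs"
    using h unfolding Rec_def by blast
  obtain G where G: "\<And>g. g \<in> set gs \<Longrightarrow> recursive m (G g)"
    "\<And>g xs. g \<in> set gs \<Longrightarrow> length xs = m \<Longrightarrow> G g xs = g xs"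
    using gs unfolding Rec_def by metis
  have "recursive m (\<lambda>xs. h' (map (\<lambda>g. g xs) (map G gs)))"
    by (rule recursive.comp) (use h'(1) G(1) in auto)
  moreover have "h' (map (\<lambda>g. g xs) (map G gs)) = h (map (\<lambda>g. g xs) gs)" if "length xs = m" for xs
  proof -
    have "map (\<lambda>g. g xs) (map G gs) = map (\<lambda>g. g xs) gs" using G(2) that by simp
    moreover have "h' (map (\<lambda>g. g xs) (map G gs)) = h (map (\<lambda>g. g xs) (map G gs))"
      by (rule h'(2)) simp
    ultimately show ?thesis by (simp only:)
  qed
  ultimately show ?thesis unfolding Rec_def by blast
qed

lemma Rec_comp1: "Rec 1 h \<Longrightarrow> Rec m f \<Longrightarrow> Rec m (\<lambda>xs. h [f xs])"
  using Rec_comp[of "[f]" h m] by simp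

lemma Rec_Suc: "Rec m f \<Longrightarrow> Rec m (\<lambda>xs. Suc (f xs))"
  using Rec_comp1[of "\<lambda>xs. Suc (xs ! 0)" m f] recursive.succ unfolding Rec_def by force

lemma Rec_const: "Rec m (\<lambda>xs. c)"
proof (induction c)
  case 0
  show ?case unfolding Rec_def using recursive.zero by blast
qed (rule Rec_Suc)

lemma Rec_drop:
  assumes "Rec m f" shows "Rec (m + 2) (\<lambda>ys. f (drop 2 ys))"
proof -
  have "Rec (m + 2) (\<lambda>ys. f (map (\<lambda>g. g ys) (map (\<lambda>i ys. ys ! (i + 2)) [0..<m])))"
    by (rule Rec_comp) (use assms Rec_proj in auto)
  then show ?thesis
  proof (rule Rec_cong)
    fix ys :: "nat list" assume "length ys = m + 2"
    then have "map (\<lambda>g. g ys) (map (\<lambda>i ys. ys ! (i + 2)) [0..<m]) = drop 2 ys"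
      by (intro nth_equalityI) (auto simp: add.commute)
    then show "f (map (\<lambda>g. g ys) (map (\<lambda>i ys. ys ! (i + 2)) [0..<m])) = f (drop 2 ys)" by simp
  qed
qed

text \<open>Primitive recursion with a computed number of steps. The step function receives counter
  and previous value in front of the parameters, hence \<open>drop 2\<close>.\<close>

lemma Rec_rec_nat:
  assumes b: "Rec m b" and f: "Rec m f" and s: "Rec (m + 2) (\<lambda>ys. s (drop 2 ys) (ys ! 0) (ys ! 1))"
  shows "Rec m (\<lambda>xs. rec_nat (b xs) (s xs) (f xs))"
proof -
  obtain b' where b': "recursive m b'" "\<And>xs. length xs = m \<Longrightarrow> b' xs = b xs"
    using b unfolding Rec_def by blast
  obtain s' where s': "recursive (m + 2) s'" "\<And>ys. length ys = m + 2 \<Longrightarrow> s' ys = s (drop 2 ys) (ys ! 0) (ys ! 1)"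
    using s unfolding Rec_def by blast
  let ?h = "\<lambda>xs. rec_nat (b' (tl xs)) (\<lambda>k r. s' (k # r # tl xs)) (hd xs)"
  have "Rec (m + 1) ?h" unfolding Rec_def using recursive.prim[OF b'(1) s'(1)] by blast
  then have "Rec m (\<lambda>xs. ?h (map (\<lambda>g. g xs) (f # map (\<lambda>i xs. xs ! i) [0..<m])))"
    by (intro Rec_comp) (use f Rec_proj in auto)
  then show ?thesis
  proof (rule Rec_cong)
    fix xs :: "nat list" assume xs: "length xs = m"
    have m: "map (\<lambda>g. g xs) (f # map (\<lambda>i xs. xs ! i) [0..<m]) = f xs # xs"
      using xs by (auto intro: nth_equalityI)
    show "?h (map (\<lambda>g. g xs) (f # map (\<lambda>i xs. xs ! i) [0..<m])) = rec_nat (b xs) (s xs) (f xs)"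
      unfolding m using xs by (simp add: b'(2) s'(2))
  qed
qed

lemma Rec_Least:
  assumes f: "Rec (m + 1) (\<lambda>ys. f (ys ! 0) (tl ys))" and ex: "\<And>xs. length xs = m \<Longrightarrow> \<exists>k. f k xs = 0"
  shows "Rec m (\<lambda>xs. LEAST k. f k xs = 0)"
proof -
  obtain g where g: "recursive (m + 1) g" "\<And>ys. length ys = m + 1 \<Longrightarrow> g ys = f (ys ! 0) (tl ys)"
    using f unfolding Rec_def by blast
  have e: "g (k # xs) = f k xs" if "length xs = m" for k xs using g(2)[of "k # xs"] that by simp
  have "recursive m (\<lambda>xs. LEAST k. g (k # xs) = 0)"
    by (rule recursive.mini[OF g(1)]) (use e ex in auto)
  then show ?thesis unfolding Rec_def using e by (intro exI conjI) auto
qed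

lemma Rec_pred: "Rec m f \<Longrightarrow> Rec m (\<lambda>xs. f xs - 1)"
proof -
  assume "Rec m f"
  then have "Rec m (\<lambda>xs. rec_nat 0 (\<lambda>k r. k) (f xs))"
    by (intro Rec_rec_nat Rec_const Rec_proj) simp_all
  moreover have "rec_nat 0 (\<lambda>k r. k) a = a - 1" for a :: nat by (cases a) simp_all
  ultimately show ?thesis by simp
qed

lemma Rec_add: "Rec m f \<Longrightarrow> Rec m g \<Longrightarrow> Rec m (\<lambda>xs. f xs + g xs)"
proof -
  assume "Rec m f" "Rec m g"
  then have "Rec m (\<lambda>xs. rec_nat (f xs) (\<lambda>k. Suc) (g xs))"
    by (intro Rec_rec_nat Rec_Suc Rec_proj) simp_all
  moreover have "rec_nat a (\<lambda>k. Suc) b = a + b" for a b :: nat by (induction b) simp_all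
  ultimately show ?thesis by simp
qed

lemma Rec_diff: "Rec m f \<Longrightarrow> Rec m g \<Longrightarrow> Rec m (\<lambda>xs. f xs - g xs)"
proof -
  assume "Rec m f" "Rec m g"
  then have "Rec m (\<lambda>xs. rec_nat (f xs) (\<lambda>k r. r - 1) (g xs))"
    by (intro Rec_rec_nat Rec_pred Rec_proj) simp_all
  moreover have "rec_nat a (\<lambda>k r. r - 1) b = a - b" for a b :: nat by (induction b) simp_all
  ultimately show ?thesis by simp
qed

lemma Rec_mult: "Rec m f \<Longrightarrow> Rec m g \<Longrightarrow> Rec m (\<lambda>xs. f xs * g xs)"
proof -
  assume "Rec m f" "Rec m g"
  then have "Rec m (\<lambda>xs. rec_nat 0 (\<lambda>k r. r + f xs) (g xs))"
    by (intro Rec_rec_nat Rec_add Rec_const Rec_proj Rec_drop) simp_all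
  moreover have "rec_nat 0 (\<lambda>k r. r + a) b = a * b" for a b :: nat by (induction b) simp_all
  ultimately show ?thesis by simp
qed

lemma Rec_triangle: "Rec m f \<Longrightarrow> Rec m (\<lambda>xs. triangle (f xs))"
proof -
  assume "Rec m f"
  then have "Rec m (\<lambda>xs. rec_nat 0 (\<lambda>k r. r + Suc k) (f xs))"
    by (intro Rec_rec_nat Rec_add Rec_Suc Rec_const Rec_proj) simp_all
  moreover have "rec_nat 0 (\<lambda>k r. r + Suc k) a = triangle a" for a :: nat by (induction a) simp_all
  ultimately show ?thesis by simp
qed

lemma Rec_prod_encode: "Rec m f \<Longrightarrow> Rec m g \<Longrightarrow> Rec m (\<lambda>xs. prod_encode (f xs, g xs))"
  unfolding prod_encode_def by (simp, intro Rec_add Rec_triangle)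

lemma triangle_mono: "a \<le> b \<Longrightarrow> triangle a \<le> triangle b"
  by (induction b) (auto simp: le_Suc_eq)

text \<open>The sum of the two components of a Cantor pair. The truncated difference is 0 exactly
  when \<open>x < triangle (Suc k)\<close>, so minimisation finds the diagonal on which
  \<open>x\<close> lies, and both projections follow by subtraction.\<close>

definition diagonal :: "nat \<Rightarrow> nat" where
  "diagonal x = (LEAST k. Suc x - triangle (Suc k) = 0)"

lemma diagonal_prod_encode: "diagonal (prod_encode (a, b)) = a + b"
  unfolding diagonal_def
proof (rule Least_equality)
  show "Suc (prod_encode (a, b)) - triangle (Suc (a + b)) = 0" by (simp add: prod_encode_def)
  fix k assume k: "Suc (prod_encode (a, b)) - triangle (Suc k) = 0"
  show "a + b \<le> k"
  proof (rule ccontr)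
    assume "\<not> a + b \<le> k"
    then have "triangle (Suc k) \<le> triangle (a + b)" by (intro triangle_mono) simp
    then show False using k by (simp add: prod_encode_def)
  qed
qed

lemma Rec_diagonal: "Rec m f \<Longrightarrow> Rec m (\<lambda>xs. diagonal (f xs))"
proof -
  assume f: "Rec m f"
  have "Rec 1 (\<lambda>xs. LEAST k. Suc (xs ! 0) - triangle (Suc k) = 0)"
  proof (rule Rec_Least)
    have "Rec (1 + 1) (\<lambda>ys. Suc (ys ! 1) - triangle (Suc (ys ! 0)))"
      by (intro Rec_diff Rec_Suc Rec_triangle Rec_proj) simp_all
    then show "Rec (1 + 1) (\<lambda>ys. Suc (tl ys ! 0) - triangle (Suc (ys ! 0)))"
      by (rule Rec_cong) (simp add: nth_tl)
    fix xs :: "nat list"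
    have "k \<le> triangle k" for k by (induction k) simp_all
    then show "\<exists>k. Suc (xs ! 0) - triangle (Suc k) = 0"
      by (intro exI[of _ "xs ! 0"]) (simp add: le_SucI trans_le_add2)
  qed
  from Rec_comp1[OF this f] show ?thesis by (simp add: diagonal_def)
qed

lemma Rec_fst: "Rec m f \<Longrightarrow> Rec m (\<lambda>xs. fst (prod_decode (f xs)))"
  and Rec_snd: "Rec m f \<Longrightarrow> Rec m (\<lambda>xs. snd (prod_decode (f xs)))"
proof -
  assume f: "Rec m f"
  have "fst (prod_decode x) = x - triangle (diagonal x) \<and> snd (prod_decode x) = diagonal x - (x - triangle (diagonal x))" for x
  proof -
    obtain a b where x: "x = prod_encode (a, b)" by (metis prod_decode_inverse surj_pair)
    then show ?thesis by (simp add: diagonal_prod_encode) (simp add: prod_encode_def)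
  qed
  then show "Rec m (\<lambda>xs. fst (prod_decode (f xs)))" "Rec m (\<lambda>xs. snd (prod_decode (f xs)))"
    using f by (simp_all add: Rec_diff Rec_triangle Rec_diagonal)
qed

lemma Rec_list_encode_Nil: "Rec m (\<lambda>xs. list_encode [])"
  by (rule Rec_const)

lemma Rec_list_encode_Cons:
  "Rec m f \<Longrightarrow> Rec m (\<lambda>xs. list_encode (g xs)) \<Longrightarrow> Rec m (\<lambda>xs. list_encode (f xs # g xs))"
  by (simp add: Rec_Suc Rec_prod_encode)

lemmas Rec_basic = Rec_prod_encode Rec_list_encode_Nil Rec_list_encode_Cons

section \<open>Computability of the formula constructors\<close>

lemma Rec_cVar: "Rec m f \<Longrightarrow> Rec m (\<lambda>xs. cVar (f xs))"
  unfolding cVar_def by (intro Rec_prod_encode Rec_const)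

lemma Rec_cAdd: "Rec m f \<Longrightarrow> Rec m g \<Longrightarrow> Rec m (\<lambda>xs. cAdd (f xs) (g xs))"
  unfolding cAdd_def by (intro Rec_basic Rec_const)

lemma Rec_cEq: "Rec m f \<Longrightarrow> Rec m g \<Longrightarrow> Rec m (\<lambda>xs. cEq (f xs) (g xs))"
  unfolding cEq_def by (intro Rec_basic Rec_const)

lemma Rec_cLess: "Rec m f \<Longrightarrow> Rec m g \<Longrightarrow> Rec m (\<lambda>xs. cLess (f xs) (g xs))"
  unfolding cLess_def by (intro Rec_basic Rec_const)

lemma Rec_cNeg: "Rec m f \<Longrightarrow> Rec m (\<lambda>xs. cNeg (f xs))"
  unfolding cNeg_def by (intro Rec_basic Rec_const)

lemma Rec_cConj: "Rec m f \<Longrightarrow> Rec m g \<Longrightarrow> Rec m (\<lambda>xs. cConj (f xs) (g xs))"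
  unfolding cConj_def by (intro Rec_basic Rec_const)

lemma Rec_cExi: "Rec m f \<Longrightarrow> Rec m g \<Longrightarrow> Rec m (\<lambda>xs. cExi (f xs) (g xs))"
  unfolding cExi_def by (intro Rec_basic Rec_const)

lemma Rec_cImp: "Rec m f \<Longrightarrow> Rec m g \<Longrightarrow> Rec m (\<lambda>xs. cImp (f xs) (g xs))"
  unfolding cImp_def by (intro Rec_cNeg Rec_cConj)

lemma Rec_cIff: "Rec m f \<Longrightarrow> Rec m g \<Longrightarrow> Rec m (\<lambda>xs. cIff (f xs) (g xs))"
  unfolding cIff_def by (intro Rec_cImp Rec_cConj)

lemma Rec_cV: "Rec m f \<Longrightarrow> Rec m g \<Longrightarrow> Rec m h \<Longrightarrow> Rec m (\<lambda>xs. cV (f xs) (g xs) (h xs))"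
  unfolding cV_def by (intro Rec_cVar Rec_add Rec_mult)

lemma Rec_cExs:
  assumes "Rec m b" "Rec m f" "Rec m c"
  shows "Rec m (\<lambda>xs. cExs (b xs) (f xs) (c xs))"
  unfolding cExs_def
  by (rule Rec_rec_nat[OF assms(3,2)]) (intro Rec_cExi Rec_add Rec_drop[OF assms(1)] Rec_proj; simp)

lemma Rec_cAlls:
  assumes "Rec m f" "Rec (m + 2) (\<lambda>ys. F (drop 2 ys) (ys ! 0))"
  shows "Rec m (\<lambda>xs. cAlls (f xs) (F xs))"
  unfolding cAlls_def
  by (rule Rec_rec_nat[OF Rec_const assms(1)]) (intro Rec_cConj assms(2) Rec_proj; simp)

lemma Rec_cSub:
  assumes "Rec m b" "Rec m f" "Rec m c"
  shows "Rec m (\<lambda>xs. cSub (b xs) (f xs) (c xs))"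
  unfolding cSub_def
  by (rule Rec_rec_nat[OF assms(3,2)])
    (intro Rec_cExi Rec_cConj Rec_cEq Rec_cVar Rec_add Rec_drop[OF assms(1)] Rec_proj; simp)

lemma Rec_cExV: "Rec m f \<Longrightarrow> Rec m c \<Longrightarrow> Rec m (\<lambda>xs. cExV (f xs) k (c xs))"
  unfolding cExV_def by (intro Rec_cExs Rec_mult Rec_const)

lemma Rec_cAllV: "Rec m f \<Longrightarrow> Rec m c \<Longrightarrow> Rec m (\<lambda>xs. cAllV (f xs) k (c xs))"
  unfolding cAllV_def by (intro Rec_cExV Rec_cNeg)

lemma Rec_cX: "Rec m f \<Longrightarrow> Rec m c \<Longrightarrow> Rec m (\<lambda>xs. cX (f xs) (c xs) k)"
  unfolding cX_def by (intro Rec_cSub Rec_mult Rec_const)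

lemma Rec_atoms:
  assumes "Rec m f"
  shows "Rec m (\<lambda>xs. cSec (f xs) a x)" "Rec m (\<lambda>xs. cNear (f xs) x y r)" "Rec m (\<lambda>xs. cZero (f xs) x)"
    "Rec m (\<lambda>xs. cSame (f xs) x y)" "Rec m (\<lambda>xs. cSum (f xs) x y z)" "Rec m (\<lambda>xs. cHalf (f xs) x y z)"
    "Rec m (\<lambda>xs. cPos (f xs) r)"
  unfolding cSec_def cNear_def cZero_def cSame_def cSum_def cHalf_def cPos_def
  by (intro Rec_cAlls Rec_cImp Rec_cNeg Rec_cConj Rec_cEq Rec_cLess Rec_cAdd Rec_cV Rec_const
      Rec_drop[OF assms] Rec_proj assms; simp)+

lemma Rec_cSmall: "Rec m f \<Longrightarrow> Rec m (\<lambda>xs. cSmall (f xs) x r)"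
  unfolding cSmall_def by (intro Rec_cExV Rec_cConj Rec_atoms)

lemmas Rec_formula = Rec_cExV Rec_cAllV Rec_cImp Rec_cIff Rec_cConj Rec_cNeg Rec_atoms Rec_cSmall Rec_cX

lemma Rec_cInv: "Rec m f \<Longrightarrow> Rec m c \<Longrightarrow> Rec m (\<lambda>xs. cInv (f xs) (c xs) u)"
  unfolding cInv_def by (intro Rec_formula)

lemma Rec_cNonsing: "Rec m f \<Longrightarrow> Rec m c \<Longrightarrow> Rec m (\<lambda>xs. cNonsing (f xs) (c xs))"
  unfolding cNonsing_def by (intro Rec_formula Rec_cInv)

lemma Rec_cSing: "Rec m f \<Longrightarrow> Rec m c \<Longrightarrow> Rec m (\<lambda>xs. cSing (f xs) (c xs))"
  unfolding cSing_def by (intro Rec_formula Rec_cNonsing)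

lemma Rec_cCrit: "Rec m f \<Longrightarrow> Rec m c \<Longrightarrow> Rec m (\<lambda>xs. cCrit (f xs) (c xs))"
  unfolding cCrit_def cTame_def cHalving_def by (intro Rec_formula Rec_cSing)

lemma Rec_cClosed: "Rec m f \<Longrightarrow> Rec m c \<Longrightarrow> Rec m (\<lambda>xs. cClosed (f xs) (c xs))"
  unfolding cClosed_def by (intro Rec_cExs Rec_cNeg Rec_cConj Rec_const)

section \<open>Deciding the criterion from the theory\<close>

lemma decidable_iff_Rec: "decidable A \<longleftrightarrow> Rec 1 (\<lambda>xs. if xs ! 0 \<in> A then 1 else 0)"
proof
  assume "decidable A"
  then obtain f where f: "recursive 1 f" "\<And>x. f [x] = (if x \<in> A then 1 else 0)"
    unfolding decidable_def by blast
  have "f xs = (if xs ! 0 \<in> A then 1 else 0)" if "length xs = 1" for xs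
    using that f(2) by (auto simp: length_Suc_conv)
  then show "Rec 1 (\<lambda>xs. if xs ! 0 \<in> A then 1 else 0)" using f(1) unfolding Rec_def by blast
next
  assume "Rec 1 (\<lambda>xs. if xs ! 0 \<in> A then 1 else 0)"
  then obtain f where "recursive 1 f" "\<And>xs. length xs = 1 \<Longrightarrow> f xs = (if xs ! 0 \<in> A then 1 else 0)"
    unfolding Rec_def by blast
  then show "decidable A" unfolding decidable_def by (intro exI[of _ f]) simp
qed

lemma decidable_crit:
  assumes "decidable T"
  shows "decidable {prod_encode (n, c) | n c. 1 \<le> n \<and> cClosed n c \<in> T \<and> cCrit n c \<in> T}"
proof -
  define t where "t x = (if x \<in> T then 1 else 0 :: nat)" for x
  have t: "Rec m (\<lambda>xs. t (f xs))" if "Rec m f" for m f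
    using Rec_comp1[OF assms[unfolded decidable_iff_Rec] that] by (simp add: t_def)
  have s: "Rec m (\<lambda>xs. 1 - (1 - f xs))" if "Rec m f" for m f
    using that by (intro Rec_diff Rec_const)
  \<comment> \<open>A conjunction is a product of indicators; \<open>1 - (1 - n)\<close> is the
    indicator of \<open>1 \<le> n\<close>.\<close>
  have "Rec 1 (\<lambda>xs. let n = fst (prod_decode (xs ! 0)); c = snd (prod_decode (xs ! 0))
    in (1 - (1 - n)) * (t (cClosed n c) * t (cCrit n c)))"
    unfolding Let_def
    by (intro Rec_mult s t Rec_cClosed Rec_cCrit Rec_fst Rec_snd Rec_proj; simp)
  then show ?thesis unfolding decidable_iff_Rec
  proof (rule Rec_cong)
    fix xs :: "nat list"
    obtain n c where x: "xs ! 0 = prod_encode (n, c)" by (metis prod_decode_inverse surj_pair)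
    show "(let n = fst (prod_decode (xs ! 0)); c = snd (prod_decode (xs ! 0))
        in (1 - (1 - n)) * (t (cClosed n c) * t (cCrit n c))) =
      (if xs ! 0 \<in> {prod_encode (n, c) | n c. 1 \<le> n \<and> cClosed n c \<in> T \<and> cCrit n c \<in> T} then 1 else 0)"
      unfolding x by (auto simp: t_def Let_def)
  qed
qed

text \<open>The input is an arbitrary number, so the code must be taken apart again: if the
  quantified number codes a formula, so does the matrix.\<close>

lemma cExs_fm_code: "fm_code r = cExs b m d \<Longrightarrow> \<exists>q. d = fm_code q"
proof (induction m arbitrary: r)
  case (Suc m)
  then show ?case using cExi_fm_code[of r "b + m" "cExs b m d"] by (auto simp: cExs_def)
qed (auto simp: cExs_def)

context coded
begin

text \<open>The matrix is a tautology, so membership in the theory tests only whether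
  \<open>c\<close> codes a well-formed formula with free variables below \<open>n\<close>. In this
  way the decidable theory also recognises the legitimate inputs.\<close>

lemma cClosed_in_theory:
  "cClosed n c \<in> fm_code ` theory_of M \<longleftrightarrow> (\<exists>p. c = fm_code p \<and> formula_in M n p)"
proof
  assume "cClosed n c \<in> fm_code ` theory_of M"
  then obtain r where r: "fm_code r = cClosed n c" "r \<in> theory_of M" by auto
  then obtain q where q: "cNeg (cConj c (cNeg c)) = fm_code q"
    using cExs_fm_code unfolding cClosed_def by blast
  then obtain q' where "cConj c (cNeg c) = fm_code q'" using cNeg_fm_code[of q] by metis
  then obtain p where p: "c = fm_code p" using cConj_fm_code[of q'] by metis
  let ?q = "Neg (Conj p (Neg p))"
  have "cNeg (cConj c (cNeg c)) = fm_code ?q" by (simp add: p cNeg_def cConj_def)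
  then obtain s where s: "cClosed n c = fm_code s" "wf_fm M s \<longleftrightarrow> wf_fm M ?q" "fv s = fv ?q - {0..<0 + n}"
    using cExs_fm[of 0 n ?q] unfolding cClosed_def by auto
  have "s = r" using s(1) r(1) by (simp add: fm_code_inject)
  then have "wf_fm M p" "fv p \<subseteq> {..<n}" using s r(2) by (auto simp: theory_of_def)
  then show "\<exists>p. c = fm_code p \<and> formula_in M n p" using p by (auto simp: formula_in_def)
next
  assume "\<exists>p. c = fm_code p \<and> formula_in M n p"
  then obtain p where p: "c = fm_code p" "wf_fm M p" "fv p \<subseteq> {..<n}" by (auto simp: formula_in_def)
  let ?q = "Neg (Conj p (Neg p))"
  have "cNeg (cConj c (cNeg c)) = fm_code ?q" by (simp add: p cNeg_def cConj_def)
  then obtain s where s: "cClosed n c = fm_code s" "wf_fm M s \<longleftrightarrow> wf_fm M ?q" "fv s = fv ?q - {0..<0 + n}"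
    "\<And>v. sat M v s \<longleftrightarrow> (\<exists>x. sat M (\<lambda>j. if 0 \<le> j \<and> j < 0 + n then x (j - 0) else v j) ?q)"
    using cExs_fm[of 0 n ?q] unfolding cClosed_def by auto
  have "wf_fm M s" "fv s = {}" using s(2,3) p by auto
  moreover have "sat M v s" for v unfolding s(4) by simp
  ultimately have "s \<in> theory_of M" by (simp add: theory_of_def)
  then show "cClosed n c \<in> fm_code ` theory_of M" using s(1) by blast
qed

lemma repr_in_theory:
  assumes "repr {} c (\<lambda>e. Q)"
  shows "c \<in> fm_code ` theory_of M \<longleftrightarrow> Q"
proof -
  obtain p where p: "c = fm_code p" "wf_fm M p" "fv p \<subseteq> vars {}" "\<And>v. sat M v p = Q"
    using assms unfolding repr_def by blast
  have "fm_code p \<in> fm_code ` theory_of M \<longleftrightarrow> p \<in> theory_of M"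
    using fm_code_inject by auto
  then show ?thesis using p by (simp add: theory_of_def vars_def)
qed

end

theorem theorem6p1:
  fixes M :: "real struct"
  assumes "expansion M real_add"
    and "decidable_struct M"
    and "\<And>m Y. definable M m Y \<Longrightarrow> Y \<noteq> {} \<Longrightarrow> \<exists>xs\<in>Y. set xs \<subseteq> \<rat>"
  shows "decidable {prod_encode (n, fm_code p) | n p.
           1 \<le> n \<and> formula_in M n p \<and> definable real_add n (defined_rel M n p)}"
proof -
  let ?T = "fm_code ` theory_of M"
  have crit: "cCrit n (fm_code p) \<in> ?T \<longleftrightarrow> definable real_add n (defined_rel M n p)"
    if "1 \<le> n" "formula_in M n p" for n p
  proof -
    interpret coded_formula M n p
      using assms(1) that by unfold_locales (auto simp: formula_in_def)
    show ?thesis using repr_in_theory[OF repr_Crit] crit_iff_definable[OF assms(3)] by simp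
  qed
  \<comment> \<open>This rejects numbers that code no formula in \<open>n\<close> variables, so
    \<open>cCrit\<close> has to be correct only on genuine formulas.\<close>
  have closed: "cClosed n c \<in> ?T \<longleftrightarrow> (\<exists>p. c = fm_code p \<and> formula_in M n p)" if "1 \<le> n" for n c
  proof -
    interpret coded M n using assms(1) that by unfold_locales
    show ?thesis by (rule cClosed_in_theory)
  qed
  have "1 \<le> n \<and> cClosed n c \<in> ?T \<and> cCrit n c \<in> ?T \<longleftrightarrow>
    (\<exists>p. c = fm_code p \<and> 1 \<le> n \<and> formula_in M n p \<and> definable real_add n (defined_rel M n p))" for n c
  proof (cases "1 \<le> n")
    case True
    show ?thesis unfolding closed[OF True] using crit[OF True] by blast
  qed blast
  then have "{prod_encode (n, fm_code p) | n p.
      1 \<le> n \<and> formula_in M n p \<and> definable real_add n (defined_rel M n p)} =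
    {prod_encode (n, c) | n c. 1 \<le> n \<and> cClosed n c \<in> ?T \<and> cCrit n c \<in> ?T}"
    by (simp only:) blast
  then show ?thesis using decidable_crit assms(2) unfolding decidable_struct_def by simp
qed

end
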